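(* For integers $s,t,u\ge 0$ let $Q(s,t,u)$ be the quiver with the $s+t+u+1$ vertices $a_0,\dots,a_s,\ b_1,\dots,b_t,\ b'_1,\dots,b'_u$ and exactly the following arrows: $a_i\to a_{i-1}$ for $1\le i\le s$; $a_0\to b_1$ (if $t\ge1$); $b_j\to b_{j+1}$ for $1\le j\le t-1$; $a_0\to b'_1$ (if $u\ge 1$); $b'_k\to b'_{k+1}$ for $1\le k\le u-1$. Let $K$ be a field and let $q(s,t,u)$ denote the number of quasi-hereditary structures on the path algebra $KQ(s,t,u)$. If one of $s,t,u$ is equal to $1$, then $q(s,t,u)$ is given as follows, where $c_k$ are the Catalan numbers. (1) For all integers $t,u\ge 0$, $$q(1,t,u) = (c_{t+2} - c_{t+1})(c_{u+2} - c_{u+1})+c_{t+1}c_{u+1}.$$ (2) For all integers $s,t\ge 0$, $$q(s,t,1) = q(s,1,t) = (t+1)c_{s+t+2} - 3t\,c_{s+t+1} - \sum_{k=0}^{t-2}(k+1)c_{t-k-1}c_{s+k+2}.$$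
   Context: For an integer $k\ge0$, $c_k=\frac{(2k)!}{(k+1)!\,k!}$ is the $k$-th Catalan number. Empty sums are $0$. Let $A$ be a finite dimensional $K$-algebra with pairwise orthogonal primitive idempotents $e_1,\dots,e_n$, and $\Lambda=\{1,\dots,n\}$; for a path algebra of a finite quiver these are the trivial paths at the vertices, after numbering the vertices $1,\dots,n$. Modules are finitely generated right $A$-modules. For $i\in\Lambda$, $P(i)=e_iA$ is the indecomposable projective module and $S(i)$ is its top. Let $\sigma,\tau\in\mathfrak S_n$ be permutations of $\Lambda$. The standard module $\Delta^\sigma(i)$ with respect to $\sigma$ is the maximal factor module of $P(i)$ having only composition factors $S(j)$ with $\sigma(j)\le\sigma(i)$. Put $\Delta^\sigma=\{\Delta^\sigma(1),\dots,\Delta^\sigma(n)\}$. An $A$-module $M$ has a $\Delta^\sigma$-filtration if there is a sequence of submodules $M=M_1\supset M_2\supset\dots\supset M_{m+1}=0$ such that for each $1\le k\le m$, $M_k/M_{k+1}\cong\Delta^\sigma(j)$ for some $j\in\Lambda$. The pair $(A,\sigma)$ is a quasi-hereditary algebra if (a) $\operatorname{End}_A(\Delta^\sigma(i))$ is a local algebra for all $i\in\Lambda$, and (b) the right module $A_A$ has a $\Delta^\sigma$-filtration. If $(A,\sigma)$ and $(A,\tau)$ are quasi-hereditary with $\Delta^\sigma=\Delta^\tau$, then $\sigma$ and $\tau$ are called equivalent. An equivalence class of permutations $\sigma$ with $(A,\sigma)$ quasi-hereditary is called a quasi-hereditary structure on $A$. The set of quasi-hereditary structures on $A$ is denoted $\mathrm{qh.str}(A)$,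 so $q(s,t,u)=|\mathrm{qh.str}(KQ(s,t,u))|$. *)

theory Defs
  imports
    "HOL-Algebra.Algebra"
    "HOL-Combinatorics.Permutations"
    "Graph_Theory.Arc_Walk"
begin

section \<open>Right modules\<close>

text \<open>
  Algebras are (not necessarily commutative) rings in the sense of HOL-Algebra. The scalars
  of a \<open>K\<close>-algebra \<open>A\<close> act on an \<open>A\<close>-module through \<open>K\<cdot>1 \<subseteq> A\<close>, so
  submodules, quotients, homomorphisms and endomorphisms as defined below are automatically
  \<open>K\<close>-linear.

  Right modules reuse the library's record \<^type>\<open>module\<close> (and its \<^const>\<open>submodule\<close>):
  the slot \<open>a \<odot>\<^bsub>M\<^esub> x\<close> stands for \<open>x\<cdot>a\<close>. The fields \<^const>\<open>monoid.mult\<close> and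
  \<^const>\<open>one\<close> of that record are meaningless for modules and are ignored.
\<close>

locale right_module = R?: ring R + M?: abelian_group M
  for R :: "('a, 'm) ring_scheme" (structure) and M :: "('a, 'b, 'n) module_scheme" (structure) +
  assumes "\<lbrakk>a \<in> carrier R; x \<in> carrier M\<rbrakk> \<Longrightarrow> a \<odot>\<^bsub>M\<^esub> x \<in> carrier M"
    and "\<lbrakk>a \<in> carrier R; b \<in> carrier R; x \<in> carrier M\<rbrakk> \<Longrightarrow>
      (a \<oplus>\<^bsub>R\<^esub> b) \<odot>\<^bsub>M\<^esub> x = a \<odot>\<^bsub>M\<^esub> x \<oplus>\<^bsub>M\<^esub> b \<odot>\<^bsub>M\<^esub> x"
    and "\<lbrakk>a \<in> carrier R; x \<in> carrier M; y \<in> carrier M\<rbrakk> \<Longrightarrow>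
      a \<odot>\<^bsub>M\<^esub> (x \<oplus>\<^bsub>M\<^esub> y) = a \<odot>\<^bsub>M\<^esub> x \<oplus>\<^bsub>M\<^esub> a \<odot>\<^bsub>M\<^esub> y"
    and "\<lbrakk>a \<in> carrier R; b \<in> carrier R; x \<in> carrier M\<rbrakk> \<Longrightarrow>
      (a \<otimes>\<^bsub>R\<^esub> b) \<odot>\<^bsub>M\<^esub> x = b \<odot>\<^bsub>M\<^esub> (a \<odot>\<^bsub>M\<^esub> x)"
    and "x \<in> carrier M \<Longrightarrow> \<one>\<^bsub>R\<^esub> \<odot>\<^bsub>M\<^esub> x = x"

definition regular_module :: "('a, 'm) ring_scheme \<Rightarrow> ('a, 'a) module" where
  "regular_module A = \<lparr>carrier = carrier A, monoid.mult = monoid.mult A, one = \<one>\<^bsub>A\<^esub>,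
     ring.zero = \<zero>\<^bsub>A\<^esub>, add = add A, smult = (\<lambda>a x. x \<otimes>\<^bsub>A\<^esub> a)\<rparr>"

lemma right_module_regular:
  assumes "ring A"
  shows "right_module A (regular_module A)"
proof -
  interpret A: ring A by (rule assms)
  have "abelian_group (regular_module A)"
    by (rule abelian_groupI)
      (auto simp: regular_module_def A.a_ac intro!: bexI[of _ "\<ominus>\<^bsub>A\<^esub> _"] A.l_neg)
  then show ?thesis
    by (intro right_module.intro right_module_axioms.intro assms)
      (auto simp: regular_module_def A.l_distr A.r_distr A.m_assoc)
qed

definition quotient_module ::
  "('a, 'b, 'm) module_scheme \<Rightarrow> 'b set \<Rightarrow> ('a, 'b set) module" where
  "quotient_module M N = \<lparr>carrier = a_rcosets\<^bsub>M\<^esub> N, monoid.mult = undefined, one = undefined,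
     ring.zero = N, add = set_add M, smult = (\<lambda>a C. \<Union>x\<in>C. N +>\<^bsub>M\<^esub> (a \<odot>\<^bsub>M\<^esub> x))\<rparr>"

definition right_module_hom ::
  "('r, 'm) ring_scheme \<Rightarrow> ('r, 'b, 'n) module_scheme \<Rightarrow> ('r, 'c, 'o) module_scheme \<Rightarrow> ('b \<Rightarrow> 'c) set"
where
  "right_module_hom A M N = {f \<in> carrier M \<rightarrow> carrier N.
     (\<forall>x\<in>carrier M. \<forall>y\<in>carrier M. f (x \<oplus>\<^bsub>M\<^esub> y) = f x \<oplus>\<^bsub>N\<^esub> f y) \<and>
     (\<forall>a\<in>carrier A. \<forall>x\<in>carrier M. f (a \<odot>\<^bsub>M\<^esub> x) = a \<odot>\<^bsub>N\<^esub> f x)}"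

definition right_module_iso ::
  "('r, 'm) ring_scheme \<Rightarrow> ('r, 'b, 'n) module_scheme \<Rightarrow> ('r, 'c, 'o) module_scheme \<Rightarrow> bool"
where
  "right_module_iso A M N \<longleftrightarrow>
     (\<exists>f \<in> right_module_hom A M N. bij_betw f (carrier M) (carrier N))"

text \<open>Endomorphisms are made extensional so that equal endomorphisms are equal functions.\<close>

definition endomorphism_ring ::
  "('r, 'm) ring_scheme \<Rightarrow> ('r, 'b, 'n) module_scheme \<Rightarrow> ('b \<Rightarrow> 'b) ring" where
  "endomorphism_ring A M = \<lparr>carrier = right_module_hom A M M \<inter> extensional (carrier M),
     monoid.mult = (\<lambda>f g. compose (carrier M) f g),
     one = (\<lambda>x\<in>carrier M. x),
     ring.zero = (\<lambda>x\<in>carrier M. \<zero>\<^bsub>M\<^esub>),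
     add = (\<lambda>f g. \<lambda>x\<in>carrier M. f x \<oplus>\<^bsub>M\<^esub> g x)\<rparr>"

definition local_ring :: "('a, 'm) ring_scheme \<Rightarrow> bool" where
  "local_ring R \<longleftrightarrow> ring R \<and> \<one>\<^bsub>R\<^esub> \<noteq> \<zero>\<^bsub>R\<^esub> \<and>
     (\<forall>x \<in> carrier R - Units R. \<forall>y \<in> carrier R - Units R. x \<oplus>\<^bsub>R\<^esub> y \<notin> Units R)"


section \<open>Composition series, filtrations and tops\<close>

definition submodule_chain ::
  "('r, 'm) ring_scheme \<Rightarrow> ('r, 'b, 'n) module_scheme \<Rightarrow> nat \<Rightarrow> (nat \<Rightarrow> 'b set) \<Rightarrow> bool" where
  "submodule_chain A M m N \<longleftrightarrow> N 0 = carrier M \<and> N m = {\<zero>\<^bsub>M\<^esub>} \<and>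
     (\<forall>k\<le>m. submodule (N k) A M) \<and> (\<forall>k<m. N (Suc k) \<subset> N k)"

definition chain_factor ::
  "('r, 'b, 'n) module_scheme \<Rightarrow> (nat \<Rightarrow> 'b set) \<Rightarrow> nat \<Rightarrow> ('r, 'b set) module" where
  "chain_factor M N k =
     quotient_module (M\<lparr>carrier := N k\<rparr>) (N (Suc k))"

definition simple_module ::
  "('r, 'm) ring_scheme \<Rightarrow> ('r, 'b, 'n) module_scheme \<Rightarrow> bool" where
  "simple_module A M \<longleftrightarrow> carrier M \<noteq> {\<zero>\<^bsub>M\<^esub>} \<and>
     (\<forall>N. submodule N A M \<longrightarrow> N = {\<zero>\<^bsub>M\<^esub>} \<or> N = carrier M)"

definition composition_series ::
  "('r, 'm) ring_scheme \<Rightarrow> ('r, 'b, 'n) module_scheme \<Rightarrow> nat \<Rightarrow> (nat \<Rightarrow> 'b set) \<Rightarrow> bool" where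
  "composition_series A M m N \<longleftrightarrow>
     submodule_chain A M m N \<and> (\<forall>k<m. simple_module A (chain_factor M N k))"

text \<open>
  \<open>M\<close> has (finite length and) only composition factors isomorphic to members of \<open>\<S>\<close>;
  by Jordan-Hoelder it does not matter which composition series is used.
\<close>

definition only_composition_factors ::
  "('r, 'm) ring_scheme \<Rightarrow> ('r, 'b, 'n) module_scheme \<Rightarrow> ('r, 'c) module set \<Rightarrow> bool" where
  "only_composition_factors A M \<S> \<longleftrightarrow> (\<exists>m N. composition_series A M m N \<and>
     (\<forall>k<m. \<exists>S\<in>\<S>. right_module_iso A (chain_factor M N k) S))"

definition has_filtration ::
  "('r, 'm) ring_scheme \<Rightarrow> ('r, 'b, 'n) module_scheme \<Rightarrow> ('r, 'c) module set \<Rightarrow> bool" where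
  "has_filtration A M \<D> \<longleftrightarrow> (\<exists>m N. submodule_chain A M m N \<and>
     (\<forall>k<m. \<exists>D\<in>\<D>. right_module_iso A (chain_factor M N k) D))"

definition maximal_submodule ::
  "'b set \<Rightarrow> ('r, 'm) ring_scheme \<Rightarrow> ('r, 'b, 'n) module_scheme \<Rightarrow> bool" where
  "maximal_submodule N A M \<longleftrightarrow> submodule N A M \<and> N \<noteq> carrier M \<and>
     (\<forall>L. submodule L A M \<and> N \<subseteq> L \<longrightarrow> L = N \<or> L = carrier M)"

definition radical_module ::
  "('r, 'm) ring_scheme \<Rightarrow> ('r, 'b, 'n) module_scheme \<Rightarrow> 'b set" where
  "radical_module A M = carrier M \<inter> \<Inter>{N. maximal_submodule N A M}"

definition top_module ::
  "('r, 'm) ring_scheme \<Rightarrow> ('r, 'b, 'n) module_scheme \<Rightarrow> ('r, 'b set) module" where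
  "top_module A M = quotient_module M (radical_module A M)"


section \<open>Quasi-hereditary structures\<close>

text \<open>
  Throughout, \<open>e i\<close> for \<open>i \<in> {1..n}\<close> are the chosen primitive orthogonal
  idempotents of \<open>A\<close>, and \<open>\<sigma>\<close>, \<open>\<tau>\<close> are permutations of \<open>{1..n}\<close>.
\<close>

definition proj_module ::
  "('a, 'm) ring_scheme \<Rightarrow> (nat \<Rightarrow> 'a) \<Rightarrow> nat \<Rightarrow> ('a, 'a) module" where
  "proj_module A e i = (regular_module A)\<lparr>carrier := {e i \<otimes>\<^bsub>A\<^esub> a | a. a \<in> carrier A}\<rparr>"

definition simple_top ::
  "('a, 'm) ring_scheme \<Rightarrow> (nat \<Rightarrow> 'a) \<Rightarrow> nat \<Rightarrow> ('a, 'a set) module" where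
  "simple_top A e i = top_module A (proj_module A e i)"

text \<open>
  The maximal factor module of \<open>P(i)\<close> with a property is the quotient by the least
  submodule for which the quotient has the property; \<open>LEAST\<close> is with respect to inclusion.
\<close>

definition standard_kernel ::
  "('a, 'm) ring_scheme \<Rightarrow> nat \<Rightarrow> (nat \<Rightarrow> 'a) \<Rightarrow> (nat \<Rightarrow> nat) \<Rightarrow> nat \<Rightarrow> 'a set" where
  "standard_kernel A n e \<sigma> i = (LEAST U. submodule U A (proj_module A e i) \<and>
     only_composition_factors A (quotient_module (proj_module A e i) U)
       {simple_top A e j | j. j \<in> {1..n} \<and> \<sigma> j \<le> \<sigma> i})"

definition standard_module ::
  "('a, 'm) ring_scheme \<Rightarrow> nat \<Rightarrow> (nat \<Rightarrow> 'a) \<Rightarrow> (nat \<Rightarrow> nat) \<Rightarrow> nat \<Rightarrow> ('a, 'a set) module" where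
  "standard_module A n e \<sigma> i =
     quotient_module (proj_module A e i) (standard_kernel A n e \<sigma> i)"

definition standard_modules ::
  "('a, 'm) ring_scheme \<Rightarrow> nat \<Rightarrow> (nat \<Rightarrow> 'a) \<Rightarrow> (nat \<Rightarrow> nat) \<Rightarrow> ('a, 'a set) module set" where
  "standard_modules A n e \<sigma> = standard_module A n e \<sigma> ` {1..n}"

definition quasi_hereditary ::
  "('a, 'm) ring_scheme \<Rightarrow> nat \<Rightarrow> (nat \<Rightarrow> 'a) \<Rightarrow> (nat \<Rightarrow> nat) \<Rightarrow> bool" where
  "quasi_hereditary A n e \<sigma> \<longleftrightarrow>
     (\<forall>i\<in>{1..n}. local_ring (endomorphism_ring A (standard_module A n e \<sigma> i))) \<and>
     has_filtration A (regular_module A) (standard_modules A n e \<sigma>)"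

text \<open>Equality of two sets of modules, modules being considered up to isomorphism.\<close>

definition same_modules ::
  "('r, 'm) ring_scheme \<Rightarrow> ('r, 'b) module set \<Rightarrow> ('r, 'c) module set \<Rightarrow> bool" where
  "same_modules A \<D> \<E> \<longleftrightarrow>
     (\<forall>D\<in>\<D>. \<exists>E\<in>\<E>. right_module_iso A D E) \<and> (\<forall>E\<in>\<E>. \<exists>D\<in>\<D>. right_module_iso A D E)"

definition qh_permutations ::
  "('a, 'm) ring_scheme \<Rightarrow> nat \<Rightarrow> (nat \<Rightarrow> 'a) \<Rightarrow> (nat \<Rightarrow> nat) set" where
  "qh_permutations A n e = {\<sigma>. \<sigma> permutes {1..n} \<and> quasi_hereditary A n e \<sigma>}"

definition qh_equivalence ::
  "('a, 'm) ring_scheme \<Rightarrow> nat \<Rightarrow> (nat \<Rightarrow> 'a) \<Rightarrow> ((nat \<Rightarrow> nat) \<times> (nat \<Rightarrow> nat)) set" where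
  "qh_equivalence A n e = {(\<sigma>, \<tau>). \<sigma> \<in> qh_permutations A n e \<and> \<tau> \<in> qh_permutations A n e \<and>
     same_modules A (standard_modules A n e \<sigma>) (standard_modules A n e \<tau>)}"

definition qh_str ::
  "('a, 'm) ring_scheme \<Rightarrow> nat \<Rightarrow> (nat \<Rightarrow> 'a) \<Rightarrow> (nat \<Rightarrow> nat) set set" where
  "qh_str A n e = qh_permutations A n e // qh_equivalence A n e"


section \<open>Path algebras\<close>

text \<open>
  A quiver is a \<^type>\<open>pre_digraph\<close>. A path is a triple \<open>(u, p, v)\<close> of source, list of
  arrows (in the order in which they are traversed) and target; \<open>(v, [], v)\<close> is the trivial
  path at \<open>v\<close>. Paths multiply from left to right: \<open>(u, p, v) \<cdot> (v, q, w) = (u, p @ q, w)\<close>,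
  so \<open>e\<^sub>v A\<close> is spanned by the paths starting at \<open>v\<close>.
\<close>

type_synonym ('v, 'e) qpath = "'v \<times> 'e list \<times> 'v"

definition qpaths :: "('v, 'e) pre_digraph \<Rightarrow> ('v, 'e) qpath set" where
  "qpaths Q = {(u, p, v). pre_digraph.awalk Q u p v}"

text \<open>The pairs of composable paths whose composite is \<open>(u, p, v)\<close>; there are finitely many.\<close>

definition qpath_splits ::
  "('v, 'e) pre_digraph \<Rightarrow> ('v, 'e) qpath \<Rightarrow> (('v, 'e) qpath \<times> ('v, 'e) qpath) set" where
  "qpath_splits Q = (\<lambda>(u, p, v). {((u, p1, w), (w, p2, v)) | p1 p2 w.
     (u, p1, w) \<in> qpaths Q \<and> (w, p2, v) \<in> qpaths Q \<and> p1 @ p2 = p})"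

text \<open>
  An element of \<open>KQ\<close> is its coefficient function. The unit is the sum of all trivial paths;
  as a coefficient function it lies in the carrier since quivers here are finite.
\<close>

definition path_algebra ::
  "'k::field itself \<Rightarrow> ('v, 'e) pre_digraph \<Rightarrow> (('v, 'e) qpath \<Rightarrow> 'k) ring" where
  "path_algebra K Q = \<lparr>
     carrier = {f. finite {x. f x \<noteq> 0} \<and> {x. f x \<noteq> 0} \<subseteq> qpaths Q},
     monoid.mult = (\<lambda>f g x. \<Sum>(y, z) \<in> qpath_splits Q x. f y * g z),
     one = (\<lambda>x. if \<exists>v\<in>verts Q. x = (v, [], v) then 1 else 0),
     ring.zero = (\<lambda>x. 0),
     add = (\<lambda>f g x. f x + g x)\<rparr>"

definition trivial_path :: "'v \<Rightarrow> ('v, 'e) qpath \<Rightarrow> 'k::field" where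
  "trivial_path v = (\<lambda>x. if x = (v, [], v) then 1 else 0)"

text \<open>
  The number of quasi-hereditary structures on \<open>KQ\<close>, with the vertices numbered by \<open>\<nu>\<close>,
  a bijection from \<open>{1..card (verts Q)}\<close> to the vertex set.
\<close>

definition qh_number ::
  "'k::field itself \<Rightarrow> ('v, 'e) pre_digraph \<Rightarrow> (nat \<Rightarrow> 'v) \<Rightarrow> nat" where
  "qh_number K Q \<nu> =
     card (qh_str (path_algebra K Q) (card (verts Q)) (\<lambda>i. trivial_path (\<nu> i)))"

definition vertex_numbering :: "('v, 'e) pre_digraph \<Rightarrow> (nat \<Rightarrow> 'v) \<Rightarrow> bool" where
  "vertex_numbering Q \<nu> \<longleftrightarrow> bij_betw \<nu> {1..card (verts Q)} (verts Q)"


section \<open>The quivers \<open>Q(s,t,u)\<close> and Catalan numbers\<close>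

datatype vertex = VA nat | VB nat | VB' nat

definition quiver_arrows :: "nat \<Rightarrow> nat \<Rightarrow> nat \<Rightarrow> (vertex \<times> vertex) set" where
  "quiver_arrows s t u =
     {(VA i, VA (i - 1)) | i. 1 \<le> i \<and> i \<le> s} \<union>
     (if t \<ge> 1 then {(VA 0, VB 1)} else {}) \<union>
     {(VB j, VB (j + 1)) | j. 1 \<le> j \<and> j + 1 \<le> t} \<union>
     (if u \<ge> 1 then {(VA 0, VB' 1)} else {}) \<union>
     {(VB' k, VB' (k + 1)) | k. 1 \<le> k \<and> k + 1 \<le> u}"

definition quiver :: "nat \<Rightarrow> nat \<Rightarrow> nat \<Rightarrow> (vertex, vertex \<times> vertex) pre_digraph" where
  "quiver s t u = \<lparr>verts = VA ` {0..s} \<union> VB ` {1..t} \<union> VB' ` {1..u},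
     arcs = quiver_arrows s t u, tail = fst, head = snd\<rparr>"

definition catalan :: "nat \<Rightarrow> real" where
  "catalan k = fact (2 * k) / (fact (k + 1) * fact k)"

end

theory Submission
  imports Defs
begin

text \<open>
  Between two vertices of \<open>Q(s,t,u)\<close> there is at most one path, so \<open>KQ\<close> is the incidence algebra of
  the order \<open>v \<preceq> w\<close> (there is a path from \<open>v\<close> to \<open>w\<close>), and the submodules and subquotients that
  matter are spanned by paths. Let \<open>\<rho>\<close> be a permutation, regarded as an order of the vertices. The
  standard module \<open>\<Delta>(v)\<close> is spanned by the paths from \<open>v\<close> on which \<open>\<rho>\<close> is largest at \<open>v\<close>
  (\<open>hidden_paths_least\<close>). Every permutation is quasi-hereditary: the endomorphisms of
  \<open>\<Delta>(v)\<close> are scalars (\<open>local_endomorphism_ring_standard\<close>), and if the paths are grouped by source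
  and by the vertex at which \<open>\<rho>\<close> is largest, then every group spans a standard module, and
  continuing a path can only increase this largest value, so that the groups can be removed
  one after the other (\<open>has_filtration_standard\<close>). Since the set of vertices at which a module does
  not vanish is an isomorphism invariant, two permutations are equivalent if and only if for all
  \<open>v\<close> the same vertices \<open>w\<close> are visible from \<open>v\<close>, that is, carry \<open>\<Delta>(v)\<close>
  (\<open>standard_iso_iff\<close>).

  The quiver is a tree with root \<open>a\<^sub>s\<close> and all arrows pointing away from the root. Label a
  vertex \<open>w\<close> by the number of vertices \<open>v \<noteq> w\<close> from which \<open>w\<close> is visible. Passing from a parent
  with label \<open>k\<close> to a child, the vertices from which the child is visible are the child and an initial
  segment, starting at the root, of the \<open>k + 1\<close> vertices from which the parent is visible. So
  the label of the child is at most \<open>k + 1\<close>, the labels determine the visible sets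
  (\<open>dominators_determined\<close>), and all the labels up to \<open>k + 1\<close> occur, independently at different
  vertices, since the value of \<open>\<rho>\<close> at a new vertex can be inserted anywhere
  (\<open>labelling_realized\<close>). Hence the number of quasi-hereditary structures is the number of labellings in
  which the root has label \<open>0\<close> and labels increase by at most \<open>1\<close> along arrows
  (\<open>qh_number_eq_labellings\<close>).

  For a single path these labellings are Catalan words. Let \<open>N\<^sub>t(k)\<close> be the number of ways to
  label a branch of \<open>t\<close> vertices below a vertex with label \<open>k\<close>; it is a ballot number, and \<open>N\<^sub>t(0) =
  c\<^sub>t\<^sub>+\<^sub>1\<close>. If \<open>Tf(k) = f(0) + \<dots> + f(k + 1)\<close>, then \<open>N\<^sub>t = T\<^sup>t 1\<close> and \<open>q(s,t,u) =
  (T\<^sup>s (N\<^sub>t N\<^sub>u))(0)\<close>, by \<open>qh_number_quiver\<close>. For \<open>s = 1\<close> this is \<open>N\<^sub>t(0) N\<^sub>u(0) + N\<^sub>t(1) N\<^sub>u(1)\<close>, and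
  \<open>N\<^sub>t(1) = N\<^sub>t\<^sub>+\<^sub>1(0) - N\<^sub>t(0)\<close>. If one branch has length \<open>1\<close>, then \<open>N\<^sub>1(k) = k + 2\<close>, and the
  commutator of \<open>T\<close> with the multiplication by \<open>k + 2\<close> relates the values at \<open>(s, t + 1)\<close> and
  \<open>(s + 1, t)\<close>, which yields the formula by induction on \<open>t\<close> (\<open>funpow_step_weighted\<close>).
\<close>

section \<open>Right modules, quotients and homomorphisms\<close>

lemma (in abelian_group) minus_eq_zero_iff:
  "\<lbrakk>x \<in> carrier G; y \<in> carrier G\<rbrakk> \<Longrightarrow> x \<ominus> y = \<zero> \<longleftrightarrow> x = y"
  by (metis a_minus_def minus_equality minus_minus a_inv_closed r_neg)

context right_module
begin

lemma
  shows smult_closed [simp, intro]: "\<lbrakk>a \<in> carrier R; x \<in> carrier M\<rbrakk> \<Longrightarrow> a \<odot>\<^bsub>M\<^esub> x \<in> carrier M"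
    and smult_l_distr: "\<lbrakk>a \<in> carrier R; b \<in> carrier R; x \<in> carrier M\<rbrakk> \<Longrightarrow>
      (a \<oplus>\<^bsub>R\<^esub> b) \<odot>\<^bsub>M\<^esub> x = a \<odot>\<^bsub>M\<^esub> x \<oplus>\<^bsub>M\<^esub> b \<odot>\<^bsub>M\<^esub> x"
    and smult_r_distr: "\<lbrakk>a \<in> carrier R; x \<in> carrier M; y \<in> carrier M\<rbrakk> \<Longrightarrow>
      a \<odot>\<^bsub>M\<^esub> (x \<oplus>\<^bsub>M\<^esub> y) = a \<odot>\<^bsub>M\<^esub> x \<oplus>\<^bsub>M\<^esub> a \<odot>\<^bsub>M\<^esub> y"
    and smult_assoc: "\<lbrakk>a \<in> carrier R; b \<in> carrier R; x \<in> carrier M\<rbrakk> \<Longrightarrow>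
      (a \<otimes>\<^bsub>R\<^esub> b) \<odot>\<^bsub>M\<^esub> x = b \<odot>\<^bsub>M\<^esub> (a \<odot>\<^bsub>M\<^esub> x)"
    and smult_one [simp]: "x \<in> carrier M \<Longrightarrow> \<one>\<^bsub>R\<^esub> \<odot>\<^bsub>M\<^esub> x = x"
  using right_module_axioms by (simp_all add: right_module_def right_module_axioms_def)

lemma smult_zero_right [simp]:
  assumes "a \<in> carrier R" shows "a \<odot>\<^bsub>M\<^esub> \<zero>\<^bsub>M\<^esub> = \<zero>\<^bsub>M\<^esub>"
  using smult_r_distr[OF assms, of "\<zero>\<^bsub>M\<^esub>" "\<zero>\<^bsub>M\<^esub>"] assms by (simp add: M.add.r_cancel_one')

lemma smult_zero_left [simp]:
  assumes "x \<in> carrier M" shows "\<zero>\<^bsub>R\<^esub> \<odot>\<^bsub>M\<^esub> x = \<zero>\<^bsub>M\<^esub>"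
  using smult_l_distr[of "\<zero>\<^bsub>R\<^esub>" "\<zero>\<^bsub>R\<^esub>" x] assms by (simp add: M.add.r_cancel_one')

lemma smult_minus_one:
  assumes "x \<in> carrier M" shows "(\<ominus>\<^bsub>R\<^esub> \<one>\<^bsub>R\<^esub>) \<odot>\<^bsub>M\<^esub> x = \<ominus>\<^bsub>M\<^esub> x"
proof -
  have "(\<ominus>\<^bsub>R\<^esub> \<one>\<^bsub>R\<^esub>) \<odot>\<^bsub>M\<^esub> x \<oplus>\<^bsub>M\<^esub> x = (\<ominus>\<^bsub>R\<^esub> \<one>\<^bsub>R\<^esub> \<oplus>\<^bsub>R\<^esub> \<one>\<^bsub>R\<^esub>) \<odot>\<^bsub>M\<^esub> x"
    using assms by (simp add: smult_l_distr)
  also have "\<dots> = \<zero>\<^bsub>M\<^esub>" using assms by (simp add: R.l_neg)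
  finally show ?thesis using assms by (simp add: M.minus_equality)
qed

lemma smult_minus:
  assumes "a \<in> carrier R" "x \<in> carrier M" shows "a \<odot>\<^bsub>M\<^esub> (\<ominus>\<^bsub>M\<^esub> x) = \<ominus>\<^bsub>M\<^esub> (a \<odot>\<^bsub>M\<^esub> x)"
proof -
  have "a \<odot>\<^bsub>M\<^esub> (\<ominus>\<^bsub>M\<^esub> x) \<oplus>\<^bsub>M\<^esub> a \<odot>\<^bsub>M\<^esub> x = \<zero>\<^bsub>M\<^esub>"
    using assms by (simp add: smult_r_distr[symmetric] M.l_neg)
  then show ?thesis using assms by (simp add: M.minus_equality)
qed

text \<open>Closure under negatives follows from the action of \<open>-1\<close>.\<close>

lemma submodule_iff:
  "submodule N R M \<longleftrightarrow> N \<subseteq> carrier M \<and> \<zero>\<^bsub>M\<^esub> \<in> N \<and> (\<forall>x\<in>N. \<forall>y\<in>N. x \<oplus>\<^bsub>M\<^esub> y \<in> N) \<and>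
     (\<forall>a\<in>carrier R. \<forall>x\<in>N. a \<odot>\<^bsub>M\<^esub> x \<in> N)"
proof -
  have "\<ominus>\<^bsub>M\<^esub> x \<in> N" if "\<forall>a\<in>carrier R. \<forall>x\<in>N. a \<odot>\<^bsub>M\<^esub> x \<in> N" "N \<subseteq> carrier M" "x \<in> N" for x
    using that smult_minus_one[of x] R.a_inv_closed[OF R.one_closed] by (metis subsetD)
  then show ?thesis
    unfolding submodule_def submodule_axioms_def subgroup_def by (auto simp: a_inv_def)
qed

lemma submodule_carrier: "submodule (carrier M) R M"
  by (auto simp: submodule_iff)

lemma right_module_submodule:
  assumes "submodule N R M"
  shows "right_module R (M\<lparr>carrier := N\<rparr>)"
proof -
  have N: "N \<subseteq> carrier M" and inv: "\<And>x. x \<in> N \<Longrightarrow> \<ominus>\<^bsub>M\<^esub> x \<in> N"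
    using assms unfolding submodule_def subgroup_def by (auto simp: a_inv_def)
  have "abelian_group (M\<lparr>carrier := N\<rparr>)"
  proof (rule abelian_groupI)
    fix x assume "x \<in> carrier (M\<lparr>carrier := N\<rparr>)"
    then show "\<exists>y\<in>carrier (M\<lparr>carrier := N\<rparr>). y \<oplus>\<^bsub>M\<lparr>carrier := N\<rparr>\<^esub> x = \<zero>\<^bsub>M\<lparr>carrier := N\<rparr>\<^esub>"
      using N inv[of x] by (intro bexI[of _ "\<ominus>\<^bsub>M\<^esub> x"]) (auto simp: M.l_neg)
  qed (use assms N in \<open>auto simp: submodule_iff M.a_ac subset_iff\<close>)
  then show ?thesis
    using assms N
    by (intro right_module.intro right_module_axioms.intro R.ring_axioms)
      (auto simp: submodule_iff smult_l_distr smult_r_distr smult_assoc subset_iff)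
qed

lemma submodule_of_submodule:
  assumes "submodule N R M"
  shows "submodule L R (M\<lparr>carrier := N\<rparr>) \<longleftrightarrow> submodule L R M \<and> L \<subseteq> N"
proof -
  interpret N: right_module R "M\<lparr>carrier := N\<rparr>" by (rule right_module_submodule[OF assms])
  show ?thesis using assms unfolding N.submodule_iff submodule_iff by auto
qed

lemma coset_smult:
  assumes "submodule N R M" "a \<in> carrier R" "x \<in> carrier M"
  shows "(\<Union>y\<in>N +>\<^bsub>M\<^esub> x. N +>\<^bsub>M\<^esub> (a \<odot>\<^bsub>M\<^esub> y)) = N +>\<^bsub>M\<^esub> (a \<odot>\<^bsub>M\<^esub> x)"
proof -
  interpret N: abelian_subgroup N M
    by (rule abelian_subgroupI2) (use assms M.a_comm_group in \<open>auto simp: submodule_def\<close>)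
  have "N +>\<^bsub>M\<^esub> (a \<odot>\<^bsub>M\<^esub> y) = N +>\<^bsub>M\<^esub> (a \<odot>\<^bsub>M\<^esub> x)" if y: "y \<in> N +>\<^bsub>M\<^esub> x" for y
  proof -
    obtain h where "h \<in> N" "y = h \<oplus>\<^bsub>M\<^esub> x" using y by (auto simp: a_r_coset_def')
    moreover from this have "h \<in> carrier M" "a \<odot>\<^bsub>M\<^esub> h \<in> N" using assms by (auto simp: submodule_iff)
    ultimately have "a \<odot>\<^bsub>M\<^esub> y \<in> N +>\<^bsub>M\<^esub> (a \<odot>\<^bsub>M\<^esub> x)"
      using assms by (auto simp: smult_r_distr a_r_coset_def')
    then show ?thesis using N.a_repr_independence' assms by (metis smult_closed)
  qed
  moreover have "x \<in> N +>\<^bsub>M\<^esub> x" using N.a_rcos_self assms by auto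
  ultimately show ?thesis by blast
qed

lemma quotient_module_simps:
  assumes "submodule N R M"
  shows "carrier (quotient_module M N) = (\<lambda>x. N +>\<^bsub>M\<^esub> x) ` carrier M"
    and "\<zero>\<^bsub>quotient_module M N\<^esub> = N"
    and "\<lbrakk>x \<in> carrier M; y \<in> carrier M\<rbrakk> \<Longrightarrow>
      (N +>\<^bsub>M\<^esub> x) \<oplus>\<^bsub>quotient_module M N\<^esub> (N +>\<^bsub>M\<^esub> y) = N +>\<^bsub>M\<^esub> (x \<oplus>\<^bsub>M\<^esub> y)"
    and "\<lbrakk>a \<in> carrier R; x \<in> carrier M\<rbrakk> \<Longrightarrow>
      a \<odot>\<^bsub>quotient_module M N\<^esub> (N +>\<^bsub>M\<^esub> x) = N +>\<^bsub>M\<^esub> (a \<odot>\<^bsub>M\<^esub> x)"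
    and coset_eq_zero_iff: "x \<in> carrier M \<Longrightarrow> N +>\<^bsub>M\<^esub> x = N \<longleftrightarrow> x \<in> N"
    and coset_eq_iff: "\<lbrakk>x \<in> carrier M; y \<in> carrier M\<rbrakk> \<Longrightarrow>
      N +>\<^bsub>M\<^esub> x = N +>\<^bsub>M\<^esub> y \<longleftrightarrow> x \<ominus>\<^bsub>M\<^esub> y \<in> N"
proof -
  interpret N: abelian_subgroup N M
    by (rule abelian_subgroupI2) (use assms M.a_comm_group in \<open>auto simp: submodule_def\<close>)
  show "carrier (quotient_module M N) = (\<lambda>x. N +>\<^bsub>M\<^esub> x) ` carrier M"
    by (auto simp: quotient_module_def A_RCOSETS_def RCOSETS_def a_r_coset_def)
  show "\<zero>\<^bsub>quotient_module M N\<^esub> = N" by (simp add: quotient_module_def)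
  show "\<lbrakk>x \<in> carrier M; y \<in> carrier M\<rbrakk> \<Longrightarrow>
      (N +>\<^bsub>M\<^esub> x) \<oplus>\<^bsub>quotient_module M N\<^esub> (N +>\<^bsub>M\<^esub> y) = N +>\<^bsub>M\<^esub> (x \<oplus>\<^bsub>M\<^esub> y)"
    by (simp add: quotient_module_def N.a_rcos_sum)
  show "\<lbrakk>a \<in> carrier R; x \<in> carrier M\<rbrakk> \<Longrightarrow>
      a \<odot>\<^bsub>quotient_module M N\<^esub> (N +>\<^bsub>M\<^esub> x) = N +>\<^bsub>M\<^esub> (a \<odot>\<^bsub>M\<^esub> x)"
    using coset_smult[OF assms] by (simp add: quotient_module_def)
  show "x \<in> carrier M \<Longrightarrow> N +>\<^bsub>M\<^esub> x = N \<longleftrightarrow> x \<in> N"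
    using M.a_coset_join1 M.a_coset_join2 N.a_subgroup by metis
  show "\<lbrakk>x \<in> carrier M; y \<in> carrier M\<rbrakk> \<Longrightarrow> N +>\<^bsub>M\<^esub> x = N +>\<^bsub>M\<^esub> y \<longleftrightarrow> x \<ominus>\<^bsub>M\<^esub> y \<in> N"
    using N.a_rcos_module[of y x] N.a_repr_independence'[of x y] N.a_rcos_self[of x]
    by (auto simp: a_minus_def)
qed

lemma right_module_quotient:
  assumes N: "submodule N R M"
  shows "right_module R (quotient_module M N)"
proof -
  note [simp] = quotient_module_simps(1-4)[OF N]
  have inv: "N +>\<^bsub>M\<^esub> (\<ominus>\<^bsub>M\<^esub> x \<oplus>\<^bsub>M\<^esub> x) = N" if "x \<in> carrier M" for x
    using that N coset_eq_zero_iff[OF N, of "\<zero>\<^bsub>M\<^esub>"] by (simp add: M.l_neg submodule_iff)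
  have zero: "N = N +>\<^bsub>M\<^esub> \<zero>\<^bsub>M\<^esub>"
    using N coset_eq_zero_iff[OF N, of "\<zero>\<^bsub>M\<^esub>"] by (simp add: submodule_iff)
  have "abelian_group (quotient_module M N)"
  proof (rule abelian_groupI)
    fix C assume "C \<in> carrier (quotient_module M N)"
    then obtain x where "x \<in> carrier M" "C = N +>\<^bsub>M\<^esub> x" by auto
    then show "\<zero>\<^bsub>quotient_module M N\<^esub> \<oplus>\<^bsub>quotient_module M N\<^esub> C = C"
      using quotient_module_simps(3)[OF N, of "\<zero>\<^bsub>M\<^esub>" x] by (simp add: zero[symmetric])
  next
    fix C assume "C \<in> carrier (quotient_module M N)"
    then obtain x where "x \<in> carrier M" "C = N +>\<^bsub>M\<^esub> x" by auto
    then show "\<exists>D\<in>carrier (quotient_module M N).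
        D \<oplus>\<^bsub>quotient_module M N\<^esub> C = \<zero>\<^bsub>quotient_module M N\<^esub>"
      using inv by (intro bexI[of _ "N +>\<^bsub>M\<^esub> (\<ominus>\<^bsub>M\<^esub> x)"]) auto
  qed (use zero in \<open>auto simp: M.a_ac\<close>)
  then show ?thesis
    by (intro right_module.intro right_module_axioms.intro R.ring_axioms)
      (auto simp: smult_l_distr smult_r_distr smult_assoc)
qed

lemma hom_zero:
  assumes "right_module R N" "f \<in> right_module_hom R M N"
  shows "f \<zero>\<^bsub>M\<^esub> = \<zero>\<^bsub>N\<^esub>"
proof -
  interpret N: right_module R N by fact
  have "f \<zero>\<^bsub>M\<^esub> \<in> carrier N" using assms by (auto simp: right_module_hom_def)
  moreover have "f \<zero>\<^bsub>M\<^esub> \<oplus>\<^bsub>N\<^esub> f \<zero>\<^bsub>M\<^esub> = f \<zero>\<^bsub>M\<^esub>"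
    using assms by (auto simp: right_module_hom_def dest!: bspec[of _ _ "\<zero>\<^bsub>M\<^esub>"])
  ultimately show ?thesis by (simp add: N.M.add.r_cancel_one')
qed

lemma hom_minus:
  assumes "right_module R N" "f \<in> right_module_hom R M N" "x \<in> carrier M" "y \<in> carrier M"
  shows "f (x \<ominus>\<^bsub>M\<^esub> y) = f x \<ominus>\<^bsub>N\<^esub> f y"
proof -
  interpret N: right_module R N by fact
  have "f y \<in> carrier N" using assms by (auto simp: right_module_hom_def)
  moreover have "f (\<ominus>\<^bsub>M\<^esub> y) = (\<ominus>\<^bsub>R\<^esub> \<one>\<^bsub>R\<^esub>) \<odot>\<^bsub>N\<^esub> f y"
    using assms by (auto simp: right_module_hom_def smult_minus_one[symmetric])
  ultimately show ?thesis
    using assms by (auto simp: right_module_hom_def a_minus_def N.smult_minus_one)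
qed

text \<open>The induced map evaluates \<open>f\<close> at a chosen representative of the coset; the choice does not
  matter, since \<open>f\<close> takes equal values at elements that differ by an element of \<open>U\<close>.\<close>

lemma quotient_induced_hom:
  assumes N: "right_module R N" and f: "f \<in> right_module_hom R M N"
    and U: "submodule U R M" and ker: "\<And>x. x \<in> U \<Longrightarrow> f x = \<zero>\<^bsub>N\<^esub>"
  obtains g where "g \<in> right_module_hom R (quotient_module M U) N"
    and "\<And>x. x \<in> carrier M \<Longrightarrow> g (U +>\<^bsub>M\<^esub> x) = f x"
proof -
  interpret N: right_module R N by fact
  define g where "g C = f (SOME x. x \<in> carrier M \<and> C = U +>\<^bsub>M\<^esub> x)" for C
  have g: "g (U +>\<^bsub>M\<^esub> x) = f x" if x: "x \<in> carrier M" for x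
  proof -
    define y where "y = (SOME y. y \<in> carrier M \<and> U +>\<^bsub>M\<^esub> x = U +>\<^bsub>M\<^esub> y)"
    have y: "y \<in> carrier M \<and> U +>\<^bsub>M\<^esub> x = U +>\<^bsub>M\<^esub> y"
      unfolding y_def by (rule someI[of _ x]) (use x in auto)
    then have "f (x \<ominus>\<^bsub>M\<^esub> y) = \<zero>\<^bsub>N\<^esub>" using x by (auto intro!: ker simp: coset_eq_iff[OF U])
    then have "f x = f y" 
      using hom_minus[OF N f x, of y] y x f N.M.minus_eq_zero_iff
      by (auto simp: right_module_hom_def Pi_iff)
    then show ?thesis by (simp add: g_def y_def)
  qed
  have "g \<in> right_module_hom R (quotient_module M U) N"
    using f by (auto simp: right_module_hom_def quotient_module_simps(1,3,4)[OF U] g)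
  with g show ?thesis using that by blast
qed

lemma first_isomorphism:
  assumes N: "right_module R N" and f: "f \<in> right_module_hom R M N"
    and surj: "f ` carrier M = carrier N"
    and U: "submodule U R M" and ker: "\<And>x. x \<in> carrier M \<Longrightarrow> f x = \<zero>\<^bsub>N\<^esub> \<longleftrightarrow> x \<in> U"
  shows "right_module_iso R (quotient_module M U) N"
proof -
  have UM: "U \<subseteq> carrier M" using U by (simp add: submodule_iff)
  interpret N: right_module R N by fact
  obtain g where g: "g \<in> right_module_hom R (quotient_module M U) N"
    "\<And>x. x \<in> carrier M \<Longrightarrow> g (U +>\<^bsub>M\<^esub> x) = f x"
    using quotient_induced_hom[OF N f U] ker UM by (metis subsetD)
  have "inj_on g (carrier (quotient_module M U))"
  proof (rule inj_onI)
    fix C D assume "C \<in> carrier (quotient_module M U)" "D \<in> carrier (quotient_module M U)" "g C = g D"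
    then obtain x y where *: "x \<in> carrier M" "y \<in> carrier M" "C = U +>\<^bsub>M\<^esub> x" "D = U +>\<^bsub>M\<^esub> y" "f x = f y"
      by (auto simp: quotient_module_simps(1)[OF U] g(2))
    have "f (x \<ominus>\<^bsub>M\<^esub> y) = \<zero>\<^bsub>N\<^esub>"
      using hom_minus[OF N f *(1,2)] * f N.M.minus_eq_zero_iff
      by (auto simp: right_module_hom_def Pi_iff)
    then show "C = D" using * ker by (simp add: coset_eq_iff[OF U])
  qed
  moreover have "g ` carrier (quotient_module M U) = carrier N"
    using surj g(2) by (force simp: quotient_module_simps(1)[OF U] image_image)
  ultimately show ?thesis using g(1) by (auto simp: right_module_iso_def bij_betw_def)
qed

text \<open>A composition series of \<open>M/U\<close> consists of sets of cosets, but inductions over \<open>L\<close> need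
  \<open>L/U\<close> as a quotient module of its own. The two agree literally, because the operations of a
  quotient module do not refer to the carrier.\<close>

lemma quotient_module_restrict:
  "(quotient_module M U)\<lparr>carrier := (\<lambda>x. U +>\<^bsub>M\<^esub> x) ` L\<rparr> = quotient_module (M\<lparr>carrier := L\<rparr>) U"
  by (auto simp: quotient_module_def A_RCOSETS_def RCOSETS_def a_r_coset_def r_coset_def
      set_add_def set_mult_def fun_eq_iff)

lemma submodule_quotient:
  assumes U: "submodule U R M" and L: "submodule L R M"
  shows "submodule ((\<lambda>x. U +>\<^bsub>M\<^esub> x) ` L) R (quotient_module M U)"
proof -
  interpret Q: right_module R "quotient_module M U" by (rule right_module_quotient[OF U])
  note q = quotient_module_simps[OF U]
  note L' = L[unfolded submodule_iff]
  have "U +>\<^bsub>M\<^esub> \<zero>\<^bsub>M\<^esub> = U" using q(5)[of "\<zero>\<^bsub>M\<^esub>"] U by (simp add: submodule_iff)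
  then have "U \<in> (\<lambda>x. U +>\<^bsub>M\<^esub> x) ` L" using L' by (metis image_eqI)
  then show ?thesis
    using L' unfolding Q.submodule_iff q(1,2) by (auto simp: q(3,4) subset_iff)
qed

lemma third_isomorphism:
  assumes U: "submodule U R M" and L: "submodule L R M" and "U \<subseteq> L"
  shows "right_module_iso R (quotient_module (quotient_module M U) ((\<lambda>x. U +>\<^bsub>M\<^esub> x) ` L))
    (quotient_module M L)"
proof -
  interpret Q: right_module R "quotient_module M U" by (rule right_module_quotient[OF U])
  have Lmod: "right_module R (quotient_module M L)" by (rule right_module_quotient[OF L])
  have LM: "L \<subseteq> carrier M" using L by (simp add: submodule_iff)
  note q = quotient_module_simps[OF U] and l = quotient_module_simps[OF L]
  have "(\<lambda>x. L +>\<^bsub>M\<^esub> x) \<in> right_module_hom R M (quotient_module M L)"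
    by (auto simp: right_module_hom_def l)
  moreover have "L +>\<^bsub>M\<^esub> x = \<zero>\<^bsub>quotient_module M L\<^esub>" if "x \<in> U" for x
    using that \<open>U \<subseteq> L\<close> LM l(5)[of x] by (auto simp: l(2))
  ultimately obtain g where g: "g \<in> right_module_hom R (quotient_module M U) (quotient_module M L)"
    "\<And>x. x \<in> carrier M \<Longrightarrow> g (U +>\<^bsub>M\<^esub> x) = L +>\<^bsub>M\<^esub> x"
    using quotient_induced_hom[OF Lmod _ U] by blast
  show ?thesis
  proof (rule Q.first_isomorphism[OF Lmod g(1) _ submodule_quotient[OF U L]])
    show "g ` carrier (quotient_module M U) = carrier (quotient_module M L)"
      by (auto simp: q(1) l(1) g(2) image_image)
    fix C assume "C \<in> carrier (quotient_module M U)"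
    then obtain x where x: "x \<in> carrier M" "C = U +>\<^bsub>M\<^esub> x" by (auto simp: q(1))
    have "x \<in> L" if y: "y \<in> L" "U +>\<^bsub>M\<^esub> x = U +>\<^bsub>M\<^esub> y" for y
    proof -
      have "x \<ominus>\<^bsub>M\<^esub> y \<in> L" using y x LM \<open>U \<subseteq> L\<close> q(6)[of x y] by auto
      then have "L +>\<^bsub>M\<^esub> x = L +>\<^bsub>M\<^esub> y" using x y LM l(6)[of x y] by auto
      also have "\<dots> = L" using y LM l(5)[of y] by auto
      finally show ?thesis using x l(5) by simp
    qed
    then show "g C = \<zero>\<^bsub>quotient_module M L\<^esub> \<longleftrightarrow> C \<in> (\<lambda>x. U +>\<^bsub>M\<^esub> x) ` L"
      using x by (auto simp: g(2) l(2,5))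
  qed
qed

lemma iso_sym:
  assumes "right_module_iso R M N"
  shows "right_module_iso R N M"
proof -
  obtain f where f: "f \<in> right_module_hom R M N" "bij_betw f (carrier M) (carrier N)"
    using assms by (auto simp: right_module_iso_def)
  define g where "g = inv_into (carrier M) f"
  have g: "bij_betw g (carrier N) (carrier M)" and fg: "\<And>y. y \<in> carrier N \<Longrightarrow> f (g y) = y"
    using f by (auto simp: g_def bij_betw_inv_into bij_betw_inv_into_right)
  have mem: "g y \<in> carrier M" if "y \<in> carrier N" for y using g that by (auto simp: bij_betw_def)
  have gf: "g (f x) = x" if "x \<in> carrier M" for x
    using f that by (auto simp: g_def bij_betw_inv_into_left)
  have "g \<in> right_module_hom R N M"
    unfolding right_module_hom_def
  proof (intro CollectI conjI ballI)
    fix x y assume "x \<in> carrier N" "y \<in> carrier N"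
    then have "f (g x \<oplus>\<^bsub>M\<^esub> g y) = x \<oplus>\<^bsub>N\<^esub> y" using f mem fg by (auto simp: right_module_hom_def)
    then show "g (x \<oplus>\<^bsub>N\<^esub> y) = g x \<oplus>\<^bsub>M\<^esub> g y"
      using gf mem \<open>x \<in> carrier N\<close> \<open>y \<in> carrier N\<close> by (metis M.a_closed)
  next
    fix a x assume "a \<in> carrier R" "x \<in> carrier N"
    then have "f (a \<odot>\<^bsub>M\<^esub> g x) = a \<odot>\<^bsub>N\<^esub> x" using f mem fg by (auto simp: right_module_hom_def)
    then show "g (a \<odot>\<^bsub>N\<^esub> x) = a \<odot>\<^bsub>M\<^esub> g x"
      using gf mem \<open>a \<in> carrier R\<close> \<open>x \<in> carrier N\<close> by (metis smult_closed)
  qed (use mem in auto)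
  with g show ?thesis by (auto simp: right_module_iso_def)
qed

end

lemma iso_trans:
  assumes "right_module_iso R L M" "right_module_iso R M N"
  shows "right_module_iso R L N"
proof -
  obtain f g where "f \<in> right_module_hom R L M" "bij_betw f (carrier L) (carrier M)"
    "g \<in> right_module_hom R M N" "bij_betw g (carrier M) (carrier N)"
    using assms by (auto simp: right_module_iso_def)
  then show ?thesis
    unfolding right_module_iso_def
    by (intro bexI[of _ "g \<circ> f"]) (auto simp: right_module_hom_def Pi_iff intro: bij_betw_trans)
qed

section \<open>Filtrations and simple modules\<close>

context right_module
begin

lemma has_filtration_zero:
  assumes "carrier M = {\<zero>\<^bsub>M\<^esub>}"
  shows "has_filtration R M \<D>"
  unfolding has_filtration_def submodule_chain_def
  by (rule exI[of _ 0], rule exI[of _ "\<lambda>_. carrier M"]) (use assms submodule_carrier in auto)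

text \<open>The chain of \<open>L\<close> is continued by \<open>M\<close> itself as the new member with index \<open>0\<close>. All the
  filtrations below arise from this step, by induction on the set of paths spanning \<open>M\<close>.\<close>

lemma has_filtration_extend:
  assumes L: "submodule L R M" "L \<noteq> carrier M"
    and filt: "has_filtration R (M\<lparr>carrier := L\<rparr>) \<D>"
    and D: "D \<in> \<D>" "right_module_iso R (quotient_module M L) D"
  shows "has_filtration R M \<D>"
proof -
  obtain m N where N: "submodule_chain R (M\<lparr>carrier := L\<rparr>) m N"
    "\<And>k. k < m \<Longrightarrow> \<exists>D\<in>\<D>. right_module_iso R (chain_factor (M\<lparr>carrier := L\<rparr>) N k) D"
    using filt by (auto simp: has_filtration_def)
  define N' where "N' = (\<lambda>k. case k of 0 \<Rightarrow> carrier M | Suc k \<Rightarrow> N k)"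
  have "submodule_chain R M (Suc m) N'"
    using N(1) L submodule_carrier submodule_of_submodule[OF L(1)]
    unfolding submodule_chain_def N'_def by (auto split: nat.split simp: submodule_iff)
  moreover have "\<exists>D\<in>\<D>. right_module_iso R (chain_factor M N' k) D" if "k < Suc m" for k
  proof (cases k)
    case 0
    then show ?thesis using D N(1) by (auto simp: chain_factor_def N'_def submodule_chain_def)
  next
    case (Suc l)
    then show ?thesis using N(2)[of l] that by (simp add: chain_factor_def N'_def)
  qed
  ultimately show ?thesis unfolding has_filtration_def by blast
qed

lemma simple_module_iso:
  assumes N: "right_module R N" and iso: "right_module_iso R M N" and simple: "simple_module R N"
  shows "simple_module R M"
proof -
  interpret N: right_module R N by fact
  obtain f where f: "f \<in> right_module_hom R M N" "bij_betw f (carrier M) (carrier N)"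
    using iso by (auto simp: right_module_iso_def)
  note f0 = hom_zero[OF N f(1)]
  have inj: "inj_on f (carrier M)" and img: "f ` carrier M = carrier N"
    using f by (auto simp: bij_betw_def)
  have "L = {\<zero>\<^bsub>M\<^esub>} \<or> L = carrier M" if L: "submodule L R M" for L
  proof -
    have LM: "L \<subseteq> carrier M" and "\<zero>\<^bsub>M\<^esub> \<in> L" using L by (auto simp: submodule_iff)
    have "submodule (f ` L) R N"
      unfolding N.submodule_iff
    proof (intro conjI ballI)
      fix x y assume "x \<in> f ` L" "y \<in> f ` L"
      then obtain a b where "a \<in> L" "b \<in> L" "x = f a" "y = f b" by auto
      then show "x \<oplus>\<^bsub>N\<^esub> y \<in> f ` L"
        using L LM f(1) by (auto simp: right_module_hom_def submodule_iff subset_iff intro!: image_eqI[of _ f "a \<oplus>\<^bsub>M\<^esub> b"])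
    next
      fix a x assume "a \<in> carrier R" "x \<in> f ` L"
      then obtain y where "y \<in> L" "x = f y" by auto
      then show "a \<odot>\<^bsub>N\<^esub> x \<in> f ` L"
        using L LM f(1) \<open>a \<in> carrier R\<close>
        by (auto simp: right_module_hom_def submodule_iff subset_iff intro!: image_eqI[of _ f "a \<odot>\<^bsub>M\<^esub> y"])
    next
      show "f ` L \<subseteq> carrier N" using LM img by auto
      show "\<zero>\<^bsub>N\<^esub> \<in> f ` L" using f0 \<open>\<zero>\<^bsub>M\<^esub> \<in> L\<close> by (metis image_eqI)
    qed
    then have "f ` L = f ` {\<zero>\<^bsub>M\<^esub>} \<or> f ` L = f ` carrier M"
      using simple f0 img by (auto simp: simple_module_def)
    then show ?thesis
      using inj_on_image_eq_iff[OF inj LM, of "{\<zero>\<^bsub>M\<^esub>}"] inj_on_image_eq_iff[OF inj LM, of "carrier M"] by simp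
  qed
  moreover have "carrier M \<noteq> {\<zero>\<^bsub>M\<^esub>}" using img f0 simple by (auto simp: simple_module_def)
  ultimately show ?thesis by (auto simp: simple_module_def)
qed

lemma simple_quotient_maximal:
  assumes "maximal_submodule N R M"
  shows "simple_module R (quotient_module M N)"
proof -
  have N: "submodule N R M" and max: "\<And>L. submodule L R M \<Longrightarrow> N \<subseteq> L \<Longrightarrow> L = N \<or> L = carrier M"
    and "N \<noteq> carrier M" using assms by (auto simp: maximal_submodule_def)
  have NM: "N \<subseteq> carrier M" using N by (auto simp: submodule_iff)
  interpret Q: right_module R "quotient_module M N" by (rule right_module_quotient[OF N])
  note q = quotient_module_simps[OF N]
  have "carrier (quotient_module M N) \<noteq> {N}"
  proof
    assume "carrier (quotient_module M N) = {N}"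
    then have "\<forall>x\<in>carrier M. x \<in> N" using q(1) by (auto simp flip: q(5))
    then show False using \<open>N \<noteq> carrier M\<close> NM by auto
  qed
  moreover have "L = {N} \<or> L = carrier (quotient_module M N)" if L: "submodule L R (quotient_module M N)" for L
  proof -
    let ?L = "{x \<in> carrier M. N +>\<^bsub>M\<^esub> x \<in> L}"
    note L' = L[unfolded Q.submodule_iff q(1,2)]
    have "submodule ?L R M"
      unfolding submodule_iff
    proof (intro conjI ballI)
      fix x y assume "x \<in> ?L" "y \<in> ?L"
      then show "x \<oplus>\<^bsub>M\<^esub> y \<in> ?L" using L' by (auto simp flip: q(3))
    next
      fix a x assume "a \<in> carrier R" "x \<in> ?L"
      then show "a \<odot>\<^bsub>M\<^esub> x \<in> ?L" using L' by (auto simp flip: q(4))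
    next
      show "\<zero>\<^bsub>M\<^esub> \<in> ?L" using L' q(5)[of "\<zero>\<^bsub>M\<^esub>"] N by (simp add: submodule_iff)
    qed auto
    moreover have "N \<subseteq> ?L"
    proof
      fix x assume "x \<in> N"
      then have "x \<in> carrier M" "N +>\<^bsub>M\<^esub> x = N" using NM q(5)[of x] by auto
      then show "x \<in> ?L" using L' by simp
    qed
    ultimately consider "?L = N" | "?L = carrier M" using max by blast
    then show ?thesis
    proof cases
      case 1
      have "C = N" if C: "C \<in> L" for C
      proof -
        obtain x where x: "x \<in> carrier M" "C = N +>\<^bsub>M\<^esub> x" using C L' by blast
        then show ?thesis using C 1 q(5)[of x] by auto
      qed
      then show ?thesis using L' by auto
    next
      case 2
      then show ?thesis using L' q(1) by auto
    qed
  qed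
  ultimately show ?thesis by (simp add: simple_module_def q(2))
qed

text \<open>An element \<open>a\<close> that annihilates all the factors of a filtration of length \<open>m\<close> pushes every
  submodule of the filtration into the next one; so it fixes no vector but \<open>0\<close>.\<close>

lemma has_filtration_annihilated:
  assumes filt: "has_filtration R M \<D>" and a: "a \<in> carrier R"
    and ann: "\<And>D. D \<in> \<D> \<Longrightarrow> right_module R D \<and> (\<forall>x\<in>carrier D. a \<odot>\<^bsub>D\<^esub> x = \<zero>\<^bsub>D\<^esub>)"
    and x: "x \<in> carrier M" "a \<odot>\<^bsub>M\<^esub> x = x"
  shows "x = \<zero>\<^bsub>M\<^esub>"
proof -
  obtain m N where N: "submodule_chain R M m N"
    "\<And>k. k < m \<Longrightarrow> \<exists>D\<in>\<D>. right_module_iso R (chain_factor M N k) D"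
    using filt by (auto simp: has_filtration_def)
  have "x \<in> N k" if "k \<le> m" for k
    using that
  proof (induction k)
    case 0
    then show ?case using N(1) x by (simp add: submodule_chain_def)
  next
    case (Suc k)
    have sub: "submodule (N k) R M" "submodule (N (Suc k)) R M" "N (Suc k) \<subseteq> N k" "x \<in> N k"
      using N(1) Suc psubset_imp_subset[of "N (Suc k)" "N k"] by (simp_all add: submodule_chain_def)
    interpret K: right_module R "M\<lparr>carrier := N k\<rparr>" by (rule right_module_submodule[OF sub(1)])
    have sub': "submodule (N (Suc k)) R (M\<lparr>carrier := N k\<rparr>)"
      using sub by (simp add: submodule_of_submodule)
    let ?Q = "quotient_module (M\<lparr>carrier := N k\<rparr>) (N (Suc k))"
    interpret Q: right_module R ?Q by (rule K.right_module_quotient[OF sub'])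
    obtain D f where D: "D \<in> \<D>" and f: "f \<in> right_module_hom R ?Q D" "bij_betw f (carrier ?Q) (carrier D)"
      using N(2)[of k] Suc by (auto simp: right_module_iso_def chain_factor_def)
    let ?C = "N (Suc k) +>\<^bsub>M\<lparr>carrier := N k\<rparr>\<^esub> x"
    have C: "?C \<in> carrier ?Q" using sub K.quotient_module_simps(1)[OF sub'] by auto
    have "a \<odot>\<^bsub>?Q\<^esub> ?C = ?C" using K.quotient_module_simps(4)[OF sub', of a x] sub a x by simp
    moreover have "f (a \<odot>\<^bsub>?Q\<^esub> ?C) = \<zero>\<^bsub>D\<^esub>"
      using f C a ann[OF D] by (auto simp: right_module_hom_def)
    ultimately have "f ?C = f \<zero>\<^bsub>?Q\<^esub>" using Q.hom_zero[OF _ f(1)] ann[OF D] by simp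
    then have "?C = \<zero>\<^bsub>?Q\<^esub>" using f(2) C Q.zero_closed by (auto simp: bij_betw_def dest: inj_onD)
    then show ?case using K.quotient_module_simps(2,5)[OF sub'] sub by simp
  qed
  then show ?thesis using N(1) by (auto simp: submodule_chain_def)
qed

text \<open>A filtration with simple factors is a composition series, so composition series can be
  constructed and analysed by means of the lemmas on filtrations.\<close>

lemma only_composition_factors_iff_filtration:
  assumes simple: "\<And>T. T \<in> \<F> \<Longrightarrow> right_module R T \<and> simple_module R T"
  shows "only_composition_factors R M \<F> \<longleftrightarrow> has_filtration R M \<F>"
proof -
  have "simple_module R (chain_factor M N k)"
    if chain: "submodule_chain R M m N" "k < m" and "T \<in> \<F>" "right_module_iso R (chain_factor M N k) T" for m N k T
  proof -
    have sub: "submodule (N k) R M" "submodule (N (Suc k)) R M" "N (Suc k) \<subseteq> N k"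
      using chain psubset_imp_subset[of "N (Suc k)" "N k"] by (simp_all add: submodule_chain_def)
    interpret K: right_module R "M\<lparr>carrier := N k\<rparr>" by (rule right_module_submodule[OF sub(1)])
    interpret Q: right_module R "chain_factor M N k"
      unfolding chain_factor_def
      by (rule K.right_module_quotient) (use sub in \<open>simp add: submodule_of_submodule\<close>)
    show ?thesis using Q.simple_module_iso[OF _ \<open>right_module_iso R (chain_factor M N k) T\<close>] simple \<open>T \<in> \<F>\<close> by simp
  qed
  then show ?thesis
    unfolding only_composition_factors_def has_filtration_def composition_series_def by meson
qed

end

section \<open>Endomorphism rings of cyclic modules\<close>

lemma local_ringI_division:
  assumes "ring R" "\<one>\<^bsub>R\<^esub> \<noteq> \<zero>\<^bsub>R\<^esub>" "\<And>x. x \<in> carrier R \<Longrightarrow> x \<noteq> \<zero>\<^bsub>R\<^esub> \<Longrightarrow> x \<in> Units R"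
  shows "local_ring R"
proof -
  interpret ring R by fact
  have "\<zero>\<^bsub>R\<^esub> \<notin> Units R" using assms(2) by (auto simp: Units_def)
  moreover have "x = \<zero>\<^bsub>R\<^esub>" if "x \<in> carrier R - Units R" for x using that assms(3) by blast
  ultimately have "x \<oplus>\<^bsub>R\<^esub> y \<notin> Units R" if "x \<in> carrier R - Units R" "y \<in> carrier R - Units R" for x y
    using that by (metis l_zero zero_closed)
  then show ?thesis using assms(1,2) unfolding local_ring_def by blast
qed

context right_module
begin

lemma ring_endomorphism_ring: "ring (endomorphism_ring R M)"
proof -
  let ?E = "endomorphism_ring R M"
  have E: "carrier ?E = right_module_hom R M M \<inter> extensional (carrier M)"
    by (simp add: endomorphism_ring_def)
  have hom: "\<And>f x. \<lbrakk>f \<in> carrier ?E; x \<in> carrier M\<rbrakk> \<Longrightarrow> f x \<in> carrier M"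
    "\<And>f x y. \<lbrakk>f \<in> carrier ?E; x \<in> carrier M; y \<in> carrier M\<rbrakk> \<Longrightarrow> f (x \<oplus>\<^bsub>M\<^esub> y) = f x \<oplus>\<^bsub>M\<^esub> f y"
    "\<And>f x a. \<lbrakk>f \<in> carrier ?E; x \<in> carrier M; a \<in> carrier R\<rbrakk> \<Longrightarrow> f (a \<odot>\<^bsub>M\<^esub> x) = a \<odot>\<^bsub>M\<^esub> f x"
    by (auto simp: E right_module_hom_def)
  have mem: "f \<in> carrier ?E"
    if "f \<in> extensional (carrier M)" "\<And>x. x \<in> carrier M \<Longrightarrow> f x \<in> carrier M"
      "\<And>x y. x \<in> carrier M \<Longrightarrow> y \<in> carrier M \<Longrightarrow> f (x \<oplus>\<^bsub>M\<^esub> y) = f x \<oplus>\<^bsub>M\<^esub> f y"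
      "\<And>a x. a \<in> carrier R \<Longrightarrow> x \<in> carrier M \<Longrightarrow> f (a \<odot>\<^bsub>M\<^esub> x) = a \<odot>\<^bsub>M\<^esub> f x" for f
    using that by (auto simp: E right_module_hom_def)
  have ext: "f = g" if "f \<in> carrier ?E" "g \<in> carrier ?E" "\<And>x. x \<in> carrier M \<Longrightarrow> f x = g x" for f g
    using that by (auto simp: E intro: extensionalityI[of _ "carrier M"])
  have ops [simp]: "x \<in> carrier M \<Longrightarrow> (f \<oplus>\<^bsub>?E\<^esub> g) x = f x \<oplus>\<^bsub>M\<^esub> g x"
    "x \<in> carrier M \<Longrightarrow> (f \<otimes>\<^bsub>?E\<^esub> g) x = f (g x)" "x \<in> carrier M \<Longrightarrow> \<one>\<^bsub>?E\<^esub> x = x"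
    "x \<in> carrier M \<Longrightarrow> \<zero>\<^bsub>?E\<^esub> x = \<zero>\<^bsub>M\<^esub>"
    "f \<oplus>\<^bsub>?E\<^esub> g \<in> extensional (carrier M)" "f \<otimes>\<^bsub>?E\<^esub> g \<in> extensional (carrier M)"
    "\<one>\<^bsub>?E\<^esub> \<in> extensional (carrier M)" "\<zero>\<^bsub>?E\<^esub> \<in> extensional (carrier M)" for f g x
    by (simp_all add: endomorphism_ring_def compose_def)
  have add: "f \<oplus>\<^bsub>?E\<^esub> g \<in> carrier ?E" if f: "f \<in> carrier ?E" and g: "g \<in> carrier ?E" for f g
    by (rule mem) (simp_all add: hom[OF f] hom[OF g] smult_r_distr M.a_ac)
  have mult: "f \<otimes>\<^bsub>?E\<^esub> g \<in> carrier ?E" if f: "f \<in> carrier ?E" and g: "g \<in> carrier ?E" for f g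
    by (rule mem) (simp_all add: hom[OF f] hom[OF g])
  have zero: "\<zero>\<^bsub>?E\<^esub> \<in> carrier ?E" and one: "\<one>\<^bsub>?E\<^esub> \<in> carrier ?E"
    by (auto intro!: mem)
  have "abelian_group ?E"
  proof (rule abelian_groupI)
    fix f assume f: "f \<in> carrier ?E"
    let ?g = "\<lambda>x\<in>carrier M. \<ominus>\<^bsub>M\<^esub> f x"
    have "?g \<in> carrier ?E"
      by (rule mem) (simp_all add: hom[OF f] M.minus_add smult_minus)
    moreover from this have "?g \<oplus>\<^bsub>?E\<^esub> f = \<zero>\<^bsub>?E\<^esub>"
      by (intro ext add zero f) (simp_all add: hom[OF f] M.l_neg)
    ultimately show "\<exists>g\<in>carrier ?E. g \<oplus>\<^bsub>?E\<^esub> f = \<zero>\<^bsub>?E\<^esub>" by blast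
  next
    fix f g h assume "f \<in> carrier ?E" "g \<in> carrier ?E" "h \<in> carrier ?E"
    then show "f \<oplus>\<^bsub>?E\<^esub> g \<oplus>\<^bsub>?E\<^esub> h = f \<oplus>\<^bsub>?E\<^esub> (g \<oplus>\<^bsub>?E\<^esub> h)"
      by (intro ext add) (simp_all add: hom(1) M.a_assoc)
  next
    fix f g assume "f \<in> carrier ?E" "g \<in> carrier ?E"
    then show "f \<oplus>\<^bsub>?E\<^esub> g = g \<oplus>\<^bsub>?E\<^esub> f" by (intro ext add) (simp_all add: hom(1) M.a_comm)
  next
    fix f assume "f \<in> carrier ?E"
    then show "\<zero>\<^bsub>?E\<^esub> \<oplus>\<^bsub>?E\<^esub> f = f" by (intro ext add zero) (simp_all add: hom(1))
  qed (use add zero in blast)+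
  moreover have "Group.monoid ?E"
  proof (rule Group.monoidI)
    fix f g h assume "f \<in> carrier ?E" "g \<in> carrier ?E" "h \<in> carrier ?E"
    then show "f \<otimes>\<^bsub>?E\<^esub> g \<otimes>\<^bsub>?E\<^esub> h = f \<otimes>\<^bsub>?E\<^esub> (g \<otimes>\<^bsub>?E\<^esub> h)"
      by (intro ext mult) (simp_all add: hom(1))
  next
    fix f assume f: "f \<in> carrier ?E"
    then show "\<one>\<^bsub>?E\<^esub> \<otimes>\<^bsub>?E\<^esub> f = f" by (intro ext mult one) (simp_all add: hom(1))
    show "f \<otimes>\<^bsub>?E\<^esub> \<one>\<^bsub>?E\<^esub> = f" using f by (intro ext mult one) (simp_all add: hom(1))
  qed (use mult one in blast)+
  ultimately show ?thesis
  proof (rule ringI)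
    fix f g h assume f: "f \<in> carrier ?E" and g: "g \<in> carrier ?E" and h: "h \<in> carrier ?E"
    show "(f \<oplus>\<^bsub>?E\<^esub> g) \<otimes>\<^bsub>?E\<^esub> h = f \<otimes>\<^bsub>?E\<^esub> h \<oplus>\<^bsub>?E\<^esub> g \<otimes>\<^bsub>?E\<^esub> h"
      by (intro ext mult add f g h) (simp add: hom[OF h])
    show "h \<otimes>\<^bsub>?E\<^esub> (f \<oplus>\<^bsub>?E\<^esub> g) = h \<otimes>\<^bsub>?E\<^esub> f \<oplus>\<^bsub>?E\<^esub> h \<otimes>\<^bsub>?E\<^esub> g"
      by (intro ext mult add f g h) (simp add: hom[OF f] hom[OF g] hom[OF h])
  qed
qed

text \<open>The standard modules meet the hypotheses of the next lemma with \<open>g\<close> the class of an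
  idempotent \<open>e\<close>: an endomorphism maps \<open>g = g\<cdot>e\<close> into the one-dimensional space \<open>M\<cdot>e\<close>, and it
  is determined by the image of the generator \<open>g\<close>.\<close>

lemma local_endomorphism_ring_cyclic:
  assumes g: "g \<in> carrier M" "g \<noteq> \<zero>\<^bsub>M\<^esub>" and gen: "\<And>x. x \<in> carrier M \<Longrightarrow> \<exists>a\<in>carrier R. x = a \<odot>\<^bsub>M\<^esub> g"
    and e: "e \<in> carrier R" "e \<odot>\<^bsub>M\<^esub> g = g"
    and unit: "\<And>x. x \<in> carrier M \<Longrightarrow> e \<odot>\<^bsub>M\<^esub> x \<noteq> \<zero>\<^bsub>M\<^esub> \<Longrightarrow>
      \<exists>c\<in>Units R. (\<forall>a\<in>carrier R. a \<otimes>\<^bsub>R\<^esub> c = c \<otimes>\<^bsub>R\<^esub> a) \<and> e \<odot>\<^bsub>M\<^esub> x = c \<odot>\<^bsub>M\<^esub> g"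
  shows "local_ring (endomorphism_ring R M)"
proof (rule local_ringI_division)
  let ?E = "endomorphism_ring R M"
  show "ring ?E" by (rule ring_endomorphism_ring)
  show "\<one>\<^bsub>?E\<^esub> \<noteq> \<zero>\<^bsub>?E\<^esub>"
    using g by (auto simp: endomorphism_ring_def dest!: fun_cong[of _ _ g])
  fix f assume f: "f \<in> carrier ?E" "f \<noteq> \<zero>\<^bsub>?E\<^esub>"
  have hom: "f \<in> right_module_hom R M M" and fext: "f \<in> extensional (carrier M)"
    using f by (auto simp: endomorphism_ring_def)
  have fa: "f (a \<odot>\<^bsub>M\<^esub> g) = a \<odot>\<^bsub>M\<^esub> f g" if "a \<in> carrier R" for a
    using hom g that by (auto simp: right_module_hom_def)
  have fg: "f g \<in> carrier M" "e \<odot>\<^bsub>M\<^esub> f g = f g"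
    using hom g fa[OF e(1)] e(2) by (auto simp: right_module_hom_def)
  have "f g \<noteq> \<zero>\<^bsub>M\<^esub>"
  proof
    assume "f g = \<zero>\<^bsub>M\<^esub>"
    then have "f x = \<zero>\<^bsub>M\<^esub>" if "x \<in> carrier M" for x using gen[OF that] fa by auto
    then have "f = \<zero>\<^bsub>?E\<^esub>" using fext by (auto simp: endomorphism_ring_def extensional_def)
    then show False using f by simp
  qed
  then obtain c where c: "c \<in> Units R" "f g = c \<odot>\<^bsub>M\<^esub> g"
    and central: "\<And>a. a \<in> carrier R \<Longrightarrow> a \<otimes>\<^bsub>R\<^esub> c = c \<otimes>\<^bsub>R\<^esub> a"
    using unit[OF fg(1)] fg by auto
  then obtain d where d: "d \<in> carrier R" "d \<otimes>\<^bsub>R\<^esub> c = \<one>\<^bsub>R\<^esub>" "c \<otimes>\<^bsub>R\<^esub> d = \<one>\<^bsub>R\<^esub>" and cR: "c \<in> carrier R"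
    by (auto simp: Units_def)
  have centrald: "a \<otimes>\<^bsub>R\<^esub> d = d \<otimes>\<^bsub>R\<^esub> a" if a: "a \<in> carrier R" for a
  proof -
    have "a \<otimes>\<^bsub>R\<^esub> d = (d \<otimes>\<^bsub>R\<^esub> c) \<otimes>\<^bsub>R\<^esub> (a \<otimes>\<^bsub>R\<^esub> d)" using d a by simp
    also have "\<dots> = d \<otimes>\<^bsub>R\<^esub> (c \<otimes>\<^bsub>R\<^esub> a) \<otimes>\<^bsub>R\<^esub> d" using d(1) a cR by (simp add: R.m_assoc)
    also have "c \<otimes>\<^bsub>R\<^esub> a = a \<otimes>\<^bsub>R\<^esub> c" using central[OF a] by simp
    also have "d \<otimes>\<^bsub>R\<^esub> (a \<otimes>\<^bsub>R\<^esub> c) \<otimes>\<^bsub>R\<^esub> d = d \<otimes>\<^bsub>R\<^esub> a \<otimes>\<^bsub>R\<^esub> (c \<otimes>\<^bsub>R\<^esub> d)" using d(1) a cR by (simp add: R.m_assoc)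
    finally show ?thesis using d a by simp
  qed
  have fx: "f x = c \<odot>\<^bsub>M\<^esub> x" if "x \<in> carrier M" for x
    using gen[OF that] fa c cR central g by (auto simp: smult_assoc[symmetric])
  define h where "h = (\<lambda>x\<in>carrier M. d \<odot>\<^bsub>M\<^esub> x)"
  have "h \<in> carrier ?E"
    unfolding h_def endomorphism_ring_def right_module_hom_def
    using d(1) centrald by (auto simp: smult_r_distr smult_assoc[symmetric])
  moreover have "h \<otimes>\<^bsub>?E\<^esub> f = \<one>\<^bsub>?E\<^esub>" "f \<otimes>\<^bsub>?E\<^esub> h = \<one>\<^bsub>?E\<^esub>"
    using d cR by (auto simp: endomorphism_ring_def compose_def h_def fx smult_assoc[symmetric] fun_eq_iff)
  ultimately show "f \<in> Units ?E" using f(1) by (auto simp: Units_def)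
qed

end


section \<open>Path algebras of quivers with unique paths\<close>

locale unique_walk_quiver = wf_digraph Q for Q :: "('v, 'e) pre_digraph" +
  assumes finite_verts: "finite (verts Q)"
    and unique_walk: "\<lbrakk>awalk u p v; awalk u q v\<rbrakk> \<Longrightarrow> p = q"
begin

(* A path is a triple. Quantifiers over paths stay intact, so that they match terms path u v. *)
declare split_paired_All [simp del] split_paired_Ex [simp del]

abbreviation precedes :: "'v \<Rightarrow> 'v \<Rightarrow> bool" (infix "\<preceq>" 50) where
  "u \<preceq> v \<equiv> u \<rightarrow>\<^sup>*\<^bsub>Q\<^esub> v"

lemma precedes_verts: "u \<preceq> v \<Longrightarrow> u \<in> verts Q" "u \<preceq> v \<Longrightarrow> v \<in> verts Q"
  by (auto dest: reachable_in_verts)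

lemma precedes_refl_iff [simp]: "v \<preceq> v \<longleftrightarrow> v \<in> verts Q"
  by (auto dest: reachable_in_verts)

lemma precedes_antisym:
  assumes "u \<preceq> v" "v \<preceq> u" shows "u = v"
proof -
  obtain p q where pq: "awalk u p v" "awalk v q u" using assms by (auto simp: reachable_awalk)
  have "awalk u (p @ q) u" using pq by (rule awalk_appendI)
  moreover have "awalk u [] u" using assms by (auto simp: awalk_Nil_iff dest: reachable_in_verts)
  ultimately have "p @ q = []" by (rule unique_walk)
  then show ?thesis using pq by (simp add: awalk_Nil_iff)
qed

text \<open>Both \<open>v\<close> and \<open>w\<close> lie on the only walk from \<open>u\<close> to \<open>x\<close>, so of its initial segments that
  end in \<open>v\<close> and in \<open>w\<close> one is a prefix of the other.\<close>

lemma interval_chain: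
  assumes "u \<preceq> v" "v \<preceq> x" "u \<preceq> w" "w \<preceq> x"
  shows "v \<preceq> w \<or> w \<preceq> v"
proof -
  obtain p1 p2 q1 q2 where walks: "awalk u p1 v" "awalk v p2 x" "awalk u q1 w" "awalk w q2 x"
    using assms by (auto simp: reachable_awalk)
  have "p1 @ p2 = q1 @ q2" using walks by (blast intro: unique_walk awalk_appendI)
  then obtain r where "p1 = q1 @ r \<or> q1 = p1 @ r" by (auto simp: append_eq_append_conv2)
  then show ?thesis
  proof
    assume "p1 = q1 @ r"
    then have "awalk w r v" using walks by (metis awalk_append_iff awlast_if_cas awalk_def)
    then show ?thesis by (auto simp: reachable_awalk)
  next
    assume "q1 = p1 @ r"
    then have "awalk v r w" using walks by (metis awalk_append_iff awlast_if_cas awalk_def)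
    then show ?thesis by (auto simp: reachable_awalk)
  qed
qed

lemma finite_interval [simp]: "finite {v. u \<preceq> v \<and> v \<preceq> w}" "finite {v. u \<preceq> v}"
  by (rule finite_subset[OF _ finite_verts]; auto dest: reachable_in_verts)+

definition walk :: "'v \<Rightarrow> 'v \<Rightarrow> 'e list" where
  "walk u v = (THE p. awalk u p v)"

lemma walk_eq: "awalk u p v \<Longrightarrow> walk u v = p"
  unfolding walk_def by (rule the_equality) (auto intro: unique_walk)

lemma awalk_walk: "u \<preceq> v \<Longrightarrow> awalk u (walk u v) v"
  using walk_eq by (auto simp: reachable_awalk)

definition path :: "'v \<Rightarrow> 'v \<Rightarrow> ('v, 'e) qpath" where
  "path u v = (u, walk u v, v)"

lemma path_eq_iff [simp]: "path u v = path u' v' \<longleftrightarrow> u = u' \<and> v = v'"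
  by (auto simp: path_def)

lemma qpaths_eq: "qpaths Q = {path u v | u v. u \<preceq> v}"
  by (auto simp: qpaths_def path_def reachable_awalk walk_eq)

lemma path_in_qpaths: "path u v \<in> qpaths Q \<longleftrightarrow> u \<preceq> v"
  by (auto simp: qpaths_eq)

lemma finite_qpaths: "finite (qpaths Q)"
proof -
  have "qpaths Q \<subseteq> (\<lambda>(u, v). path u v) ` (verts Q \<times> verts Q)"
  proof
    fix x assume "x \<in> qpaths Q"
    then obtain u v where "x = path u v" "u \<preceq> v" unfolding qpaths_eq by blast
    then show "x \<in> (\<lambda>(u, v). path u v) ` (verts Q \<times> verts Q)"
      by (intro image_eqI[of _ _ "(u, v)"]) (auto dest: reachable_in_verts)
  qed
  then show ?thesis using finite_verts by (meson finite_SigmaI finite_imageI finite_subset)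
qed

lemma path_refl: "v \<in> verts Q \<Longrightarrow> path v v = (v, [], v)"
  by (auto simp: path_def intro!: walk_eq simp: awalk_Nil_iff)

lemma qpath_splits_path:
  assumes "u \<preceq> w"
  shows "qpath_splits Q (path u w) = (\<lambda>v. (path u v, path v w)) ` {v. u \<preceq> v \<and> v \<preceq> w}"
proof -
  have "walk u v @ walk v w = walk u w" if "u \<preceq> v" "v \<preceq> w" for v
    by (metis awalk_appendI awalk_walk that walk_eq)
  then show ?thesis
    by (auto simp: qpath_splits_def path_def qpaths_def awalk_walk reachable_awalk walk_eq image_iff)
      (metis awalk_appendI walk_eq)
qed

lemma qpath_splits_empty: "x \<notin> qpaths Q \<Longrightarrow> qpath_splits Q x = {}"
  by (auto simp: qpath_splits_def qpaths_def intro: awalk_appendI split: prod.splits)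

end

locale path_algebra_quiver = unique_walk_quiver Q for Q :: "('v, 'e) pre_digraph" +
  fixes K :: "'k::field itself"
begin

abbreviation "A \<equiv> path_algebra K Q"

lemma carrier_iff: "f \<in> carrier A \<longleftrightarrow> (\<forall>x. x \<notin> qpaths Q \<longrightarrow> f x = 0)"
proof -
  have "finite {x. f x \<noteq> 0}" if "{x. f x \<noteq> 0} \<subseteq> qpaths Q"
    using finite_qpaths that by (rule rev_finite_subset)
  then have "f \<in> carrier A \<longleftrightarrow> {x. f x \<noteq> 0} \<subseteq> qpaths Q" by (simp add: path_algebra_def) blast
  then show ?thesis by blast
qed

lemma path_algebra_simps [simp]:
  "f \<oplus>\<^bsub>A\<^esub> g = (\<lambda>x. f x + g x)" "\<zero>\<^bsub>A\<^esub> = (\<lambda>x. 0)"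
  by (simp_all add: path_algebra_def)

lemma path_algebra_eqI:
  assumes "f \<in> carrier A" "g \<in> carrier A" "\<And>u v. u \<preceq> v \<Longrightarrow> f (path u v) = g (path u v)"
  shows "f = g"
proof
  fix x show "f x = g x"
  proof (cases "x \<in> qpaths Q")
    case True
    then show ?thesis using assms(3) unfolding qpaths_eq by blast
  next
    case False
    then show ?thesis using assms(1,2) by (simp add: carrier_iff)
  qed
qed

text \<open>Identifying a path with its pair of end points turns \<open>KQ\<close> into the incidence algebra of the
  partial order \<open>\<preceq>\<close>.\<close>

lemma mult_path:
  assumes "u \<preceq> w"
  shows "(f \<otimes>\<^bsub>A\<^esub> g) (path u w) = (\<Sum>v | u \<preceq> v \<and> v \<preceq> w. f (path u v) * g (path v w))"
  by (simp add: path_algebra_def qpath_splits_path[OF assms] sum.reindex inj_on_def)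

lemma mult_closed: "f \<otimes>\<^bsub>A\<^esub> g \<in> carrier A"
  unfolding carrier_iff by (simp add: path_algebra_def qpath_splits_empty)

lemma one_path: "u \<preceq> v \<Longrightarrow> \<one>\<^bsub>A\<^esub> (path u v) = (if u = v then 1 else 0)"
  using precedes_verts(1) by (auto simp: path_algebra_def path_def walk_eq awalk_Nil_iff)

lemma one_closed: "\<one>\<^bsub>A\<^esub> \<in> carrier A"
  unfolding carrier_iff by (auto simp: path_algebra_def qpaths_def awalk_Nil_iff)

lemma ring_path_algebra: "ring A"
proof (rule ringI)
  show "abelian_group A"
  proof (rule abelian_groupI)
    fix f assume "f \<in> carrier A"
    then show "\<exists>g\<in>carrier A. g \<oplus>\<^bsub>A\<^esub> f = \<zero>\<^bsub>A\<^esub>"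
      by (intro bexI[of _ "\<lambda>x. - f x"]) (auto simp: carrier_iff)
  qed (auto simp: carrier_iff algebra_simps)
  show "Group.monoid A"
  proof (rule Group.monoidI)
    fix f g h
    show "f \<otimes>\<^bsub>A\<^esub> g \<otimes>\<^bsub>A\<^esub> h = f \<otimes>\<^bsub>A\<^esub> (g \<otimes>\<^bsub>A\<^esub> h)"
    proof (rule path_algebra_eqI)
      fix u w assume uw: "u \<preceq> w"
      let ?I = "{v. u \<preceq> v \<and> v \<preceq> w}"
      \<comment> \<open>both bracketings sum \<open>?t x v\<close> over all \<open>u \<preceq> x \<preceq> v \<preceq> w\<close>\<close>
      let ?t = "\<lambda>x v. f (path u x) * g (path x v) * h (path v w)"
      have "(f \<otimes>\<^bsub>A\<^esub> g \<otimes>\<^bsub>A\<^esub> h) (path u w) = (\<Sum>v\<in>?I. \<Sum>x | x \<in> ?I \<and> x \<preceq> v. ?t x v)"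
        unfolding mult_path[OF uw]
        by (rule sum.cong[OF refl])
          (auto simp: mult_path sum_distrib_right intro!: sum.cong dest: reachable_trans)
      also have "\<dots> = (\<Sum>x\<in>?I. \<Sum>v | v \<in> ?I \<and> x \<preceq> v. ?t x v)"
        by (rule sum.swap_restrict) auto
      also have "\<dots> = (f \<otimes>\<^bsub>A\<^esub> (g \<otimes>\<^bsub>A\<^esub> h)) (path u w)"
        unfolding mult_path[OF uw]
        by (rule sum.cong[OF refl])
          (auto simp: mult_path sum_distrib_left mult.assoc intro!: sum.cong dest: reachable_trans)
      finally show "(f \<otimes>\<^bsub>A\<^esub> g \<otimes>\<^bsub>A\<^esub> h) (path u w) = (f \<otimes>\<^bsub>A\<^esub> (g \<otimes>\<^bsub>A\<^esub> h)) (path u w)" .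
    qed (rule mult_closed)+
  next
    fix f assume f: "f \<in> carrier A"
    show "\<one>\<^bsub>A\<^esub> \<otimes>\<^bsub>A\<^esub> f = f"
    proof (rule path_algebra_eqI)
      fix u w assume uw: "u \<preceq> w"
      have "(\<one>\<^bsub>A\<^esub> \<otimes>\<^bsub>A\<^esub> f) (path u w) = (\<Sum>v | u \<preceq> v \<and> v \<preceq> w. if u = v then f (path v w) else 0)"
        unfolding mult_path[OF uw] by (rule sum.cong) (auto simp: one_path)
      then show "(\<one>\<^bsub>A\<^esub> \<otimes>\<^bsub>A\<^esub> f) (path u w) = f (path u w)"
        using uw by (simp add: precedes_verts)
    qed (use f mult_closed in auto)
    show "f \<otimes>\<^bsub>A\<^esub> \<one>\<^bsub>A\<^esub> = f"
    proof (rule path_algebra_eqI)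
      fix u w assume uw: "u \<preceq> w"
      have "(f \<otimes>\<^bsub>A\<^esub> \<one>\<^bsub>A\<^esub>) (path u w) = (\<Sum>v | u \<preceq> v \<and> v \<preceq> w. if w = v then f (path u v) else 0)"
        unfolding mult_path[OF uw] by (rule sum.cong) (auto simp: one_path)
      then show "(f \<otimes>\<^bsub>A\<^esub> \<one>\<^bsub>A\<^esub>) (path u w) = f (path u w)"
        using uw by (simp add: precedes_verts)
    qed (use f mult_closed in auto)
  qed (auto simp: mult_closed one_closed)
  fix f g h
  show "(f \<oplus>\<^bsub>A\<^esub> g) \<otimes>\<^bsub>A\<^esub> h = f \<otimes>\<^bsub>A\<^esub> h \<oplus>\<^bsub>A\<^esub> g \<otimes>\<^bsub>A\<^esub> h"
    by (simp add: path_algebra_def sum.distrib[symmetric] case_prod_beta algebra_simps)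
  show "h \<otimes>\<^bsub>A\<^esub> (f \<oplus>\<^bsub>A\<^esub> g) = h \<otimes>\<^bsub>A\<^esub> f \<oplus>\<^bsub>A\<^esub> h \<otimes>\<^bsub>A\<^esub> g"
    by (simp add: path_algebra_def sum.distrib[symmetric] case_prod_beta algebra_simps)
qed

sublocale A: ring A by (rule ring_path_algebra)

definition single :: "'k \<Rightarrow> 'v \<Rightarrow> 'v \<Rightarrow> ('v, 'e) qpath \<Rightarrow> 'k" where
  "single c u v = (\<lambda>x. if x = path u v then c else 0)"

lemma single_path [simp]: "single c u v (path u' v') = (if u' = u \<and> v' = v then c else 0)"
  by (auto simp: single_def)

lemma single_closed [simp]: "u \<preceq> v \<Longrightarrow> single c u v \<in> carrier A"
  by (auto simp: carrier_iff single_def path_in_qpaths)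

lemma trivial_path_eq: "v \<in> verts Q \<Longrightarrow> trivial_path v = single 1 v v"
  by (auto simp: trivial_path_def single_def path_refl)

lemma mult_single:
  assumes "v \<preceq> w" "u \<preceq> x"
  shows "(f \<otimes>\<^bsub>A\<^esub> single c v w) (path u x) = (if x = w \<and> u \<preceq> v then f (path u v) * c else 0)"
proof -
  have "(f \<otimes>\<^bsub>A\<^esub> single c v w) (path u x) =
      (\<Sum>y | u \<preceq> y \<and> y \<preceq> x. if y = v then (if x = w then f (path u v) * c else 0) else 0)"
    unfolding mult_path[OF assms(2)] by (rule sum.cong) auto
  also have "\<dots> = (if x = w \<and> u \<preceq> v then f (path u v) * c else 0)"
    using assms by auto
  finally show ?thesis .
qed

lemma single_mult:
  assumes "v \<preceq> w" "u \<preceq> x"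
  shows "(single c v w \<otimes>\<^bsub>A\<^esub> f) (path u x) = (if u = v \<and> w \<preceq> x then c * f (path w x) else 0)"
proof -
  have "(single c v w \<otimes>\<^bsub>A\<^esub> f) (path u x) =
      (\<Sum>y | u \<preceq> y \<and> y \<preceq> x. if y = w then (if u = v then c * f (path w x) else 0) else 0)"
    unfolding mult_path[OF assms(2)] by (rule sum.cong) auto
  also have "\<dots> = (if u = v \<and> w \<preceq> x then c * f (path w x) else 0)"
    using assms by auto
  finally show ?thesis .
qed

lemma single_mult_single:
  assumes "u \<preceq> v" "v \<preceq> w"
  shows "single c u v \<otimes>\<^bsub>A\<^esub> single d v w = single (c * d) u w"
  by (rule path_algebra_eqI)
    (use assms reachable_trans[OF assms] in \<open>auto simp: mult_closed single_mult\<close>)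

subsection \<open>Submodules spanned by paths\<close>

definition monomial :: "('v \<times> 'v) set \<Rightarrow> (('v, 'e) qpath \<Rightarrow> 'k) set" where
  "monomial P = {f \<in> carrier A. \<forall>u v. u \<preceq> v \<longrightarrow> (u, v) \<notin> P \<longrightarrow> f (path u v) = 0}"

definition monomial_module :: "('v \<times> 'v) set \<Rightarrow> (('v, 'e) qpath \<Rightarrow> 'k, ('v, 'e) qpath \<Rightarrow> 'k) module" where
  "monomial_module P = (regular_module A)\<lparr>carrier := monomial P\<rparr>"

definition right_closed :: "('v \<times> 'v) set \<Rightarrow> bool" where
  "right_closed P \<longleftrightarrow> (\<forall>u v w. (u, v) \<in> P \<longrightarrow> u \<preceq> v \<longrightarrow> v \<preceq> w \<longrightarrow> (u, w) \<in> P)"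

lemma monomial_mono: "P \<subseteq> N \<Longrightarrow> monomial P \<subseteq> monomial N"
  by (auto simp: monomial_def)

lemma monomial_carrier: "f \<in> monomial P \<Longrightarrow> f \<in> carrier A"
  by (simp add: monomial_def)

lemma single_in_monomial: "u \<preceq> v \<Longrightarrow> (u, v) \<in> P \<Longrightarrow> single c u v \<in> monomial P"
  by (auto simp: monomial_def)

lemma monomial_module_simps [simp]:
  "carrier (monomial_module P) = monomial P"
  "f \<oplus>\<^bsub>monomial_module P\<^esub> g = (\<lambda>x. f x + g x)"
  "\<zero>\<^bsub>monomial_module P\<^esub> = (\<lambda>x. 0)"
  "a \<odot>\<^bsub>monomial_module P\<^esub> f = f \<otimes>\<^bsub>A\<^esub> a"
  "(monomial_module P)\<lparr>carrier := monomial N\<rparr> = monomial_module N"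
  by (simp_all add: monomial_module_def regular_module_def)

lemma right_module_reg: "right_module A (regular_module A)"
  by (rule right_module_regular[OF ring_path_algebra])

lemma monomial_mult:
  assumes P: "right_closed P" and f: "f \<in> monomial P"
  shows "f \<otimes>\<^bsub>A\<^esub> a \<in> monomial P"
  unfolding monomial_def
proof (intro CollectI conjI allI impI mult_closed)
  fix u w assume uw: "u \<preceq> w" "(u, w) \<notin> P"
  then have "f (path u v) = 0" if "u \<preceq> v" "v \<preceq> w" for v
    using P f that by (auto simp: right_closed_def monomial_def)
  then show "(f \<otimes>\<^bsub>A\<^esub> a) (path u w) = 0" by (simp add: mult_path uw)
qed

lemma submodule_monomial_regular: "right_closed P \<Longrightarrow> submodule (monomial P) A (regular_module A)"
  unfolding right_module.submodule_iff[OF right_module_reg]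
  by (auto simp: regular_module_def monomial_mult) (auto simp: monomial_def carrier_iff)

lemma right_module_monomial: "right_closed P \<Longrightarrow> right_module A (monomial_module P)"
  unfolding monomial_module_def
  by (rule right_module.right_module_submodule[OF right_module_reg submodule_monomial_regular])

lemma submodule_monomial:
  assumes "right_closed P" "right_closed N" "N \<subseteq> P"
  shows "submodule (monomial N) A (monomial_module P)"
  using assms monomial_mono unfolding monomial_module_def
  by (subst right_module.submodule_of_submodule[OF right_module_reg]) (auto simp: submodule_monomial_regular)

lemma minus_monomial:
  assumes P: "right_closed P" and "f \<in> monomial P" "g \<in> monomial P"
  shows "f \<ominus>\<^bsub>monomial_module P\<^esub> g = (\<lambda>x. f x - g x)"
proof -
  interpret M: right_module A "monomial_module P" by (rule right_module_monomial[OF P])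
  have "(\<lambda>x. - g x) \<in> monomial P" using assms by (auto simp: monomial_def carrier_iff)
  then have "\<ominus>\<^bsub>monomial_module P\<^esub> g = (\<lambda>x. - g x)" using assms by (intro M.M.minus_equality) auto
  then show ?thesis by (simp add: a_minus_def)
qed

lemma monomial_coset_eq_iff:
  assumes "right_closed P" "right_closed N" "N \<subseteq> P" and "f \<in> monomial P" "g \<in> monomial P"
  shows "monomial N +>\<^bsub>monomial_module P\<^esub> f = monomial N +>\<^bsub>monomial_module P\<^esub> g \<longleftrightarrow>
    (\<forall>u v. u \<preceq> v \<longrightarrow> (u, v) \<notin> N \<longrightarrow> f (path u v) = g (path u v))"
proof -
  interpret M: right_module A "monomial_module P" by (rule right_module_monomial[OF assms(1)])
  have "(\<lambda>x. f x - g x) \<in> carrier A" using assms by (auto simp: monomial_def carrier_iff)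
  then show ?thesis
    using assms by (simp add: M.coset_eq_iff[OF submodule_monomial] minus_monomial) (auto simp: monomial_def)
qed

lemma monomial_coset_zero_iff:
  assumes "right_closed P" "right_closed N" "N \<subseteq> P" and "f \<in> monomial P"
  shows "monomial N +>\<^bsub>monomial_module P\<^esub> f = monomial N \<longleftrightarrow> f \<in> monomial N"
  by (rule right_module.coset_eq_zero_iff[OF right_module_monomial submodule_monomial])
    (use assms in auto)

text \<open>The isomorphism type of a subquotient spanned by paths with a common source depends only on
  the set \<open>D\<close> of their targets: replacing the source of the paths is an isomorphism.\<close>

lemma monomial_subquotient_iso:
  assumes P: "right_closed P" "right_closed N" "N \<subseteq> P"
    and P': "right_closed P'" "right_closed N'" "N' \<subseteq> P'"
    and D: "\<And>u v. u \<preceq> v \<Longrightarrow> (u, v) \<in> P \<and> (u, v) \<notin> N \<longleftrightarrow> u = i \<and> v \<in> D"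
    and D': "\<And>u v. u \<preceq> v \<Longrightarrow> (u, v) \<in> P' \<and> (u, v) \<notin> N' \<longleftrightarrow> u = i' \<and> v \<in> D"
    and reach: "\<And>v. v \<in> D \<Longrightarrow> i \<preceq> v \<and> i' \<preceq> v"
  shows "right_module_iso A (quotient_module (monomial_module P) (monomial N))
    (quotient_module (monomial_module P') (monomial N'))"
proof -
  let ?M = "monomial_module P" and ?M' = "monomial_module P'"
  interpret M: right_module A ?M by (rule right_module_monomial[OF P(1)])
  interpret M': right_module A ?M' by (rule right_module_monomial[OF P'(1)])
  note sub = submodule_monomial[OF P] and sub' = submodule_monomial[OF P']
  note q' = M'.quotient_module_simps[OF sub']
  note eq' = monomial_coset_eq_iff[OF P']
  define move :: "(('v, 'e) qpath \<Rightarrow> 'k) \<Rightarrow> ('v, 'e) qpath \<Rightarrow> 'k" where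
    "move f = (\<lambda>x. if \<exists>v\<in>D. x = path i' v then f (path i (snd (snd x))) else 0)" for f
  have move: "move f (path u v) = (if u = i' \<and> v \<in> D then f (path i v) else 0)" for f u v
    by (auto simp: move_def) (auto simp: path_def)
  have move_in: "move f \<in> monomial P'" for f
    using reach D' by (auto simp: monomial_def move carrier_iff) (auto simp: move_def path_in_qpaths)
  have hom: "(\<lambda>f. monomial N' +>\<^bsub>?M'\<^esub> move f) \<in> right_module_hom A ?M (quotient_module ?M' (monomial N'))"
    unfolding right_module_hom_def
  proof (intro CollectI conjI ballI)
    fix f g assume "f \<in> carrier ?M" "g \<in> carrier ?M"
    then show "monomial N' +>\<^bsub>?M'\<^esub> move (f \<oplus>\<^bsub>?M\<^esub> g) =
        (monomial N' +>\<^bsub>?M'\<^esub> move f) \<oplus>\<^bsub>quotient_module ?M' (monomial N')\<^esub> (monomial N' +>\<^bsub>?M'\<^esub> move g)"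
      using M'.M.a_closed[of "move f" "move g"]
      by (simp add: q'(3) move_in eq') (simp add: move)
  next
    fix a f assume a: "a \<in> carrier A" and f: "f \<in> carrier ?M"
    have "move (f \<otimes>\<^bsub>A\<^esub> a) (path u w) = (move f \<otimes>\<^bsub>A\<^esub> a) (path u w)"
      if uw: "u \<preceq> w" "(u, w) \<notin> N'" for u w
    proof (cases "u = i' \<and> w \<in> D")
      case True
      \<comment> \<open>a path outside \<open>D\<close> which is continued by a path in \<open>D\<close> cannot lie in \<open>N\<close>, so it lies outside \<open>P\<close>\<close>
      have zero: "f (path i v) = 0" if "v \<notin> D" "i \<preceq> v" "v \<preceq> w" for v
      proof -
        have "(i, v) \<notin> P \<or> (i, v) \<in> N" using D[of i v] that by auto
        moreover have "(i, v) \<notin> N" using P(2) that D[of i w] reach[of w] True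
          by (auto simp: right_closed_def)
        ultimately show ?thesis using f that by (auto simp: monomial_def)
      qed
      have "move (f \<otimes>\<^bsub>A\<^esub> a) (path u w) = (\<Sum>v | i \<preceq> v \<and> v \<preceq> w. f (path i v) * a (path v w))"
        using True reach by (simp add: move mult_path)
      also have "\<dots> = (\<Sum>v | v \<in> D \<and> v \<preceq> w. f (path i v) * a (path v w))"
        by (rule sum.mono_neutral_right) (use reach zero in auto)
      also have "\<dots> = (\<Sum>v | i' \<preceq> v \<and> v \<preceq> w. move f (path i' v) * a (path v w))"
        by (rule sum.mono_neutral_cong_left) (use reach in \<open>auto simp: move\<close>)
      also have "\<dots> = (move f \<otimes>\<^bsub>A\<^esub> a) (path u w)"
        using True reach by (simp add: mult_path)
      finally show ?thesis .
    next
      case False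
      then have "(u, w) \<notin> P'" using D' uw by blast
      then have "(move f \<otimes>\<^bsub>A\<^esub> a) (path u w) = 0"
        using monomial_mult[OF P'(1) move_in[of f], of a] uw by (auto simp: monomial_def)
      then show ?thesis using False by (auto simp: move)
    qed
    then show "monomial N' +>\<^bsub>?M'\<^esub> move (a \<odot>\<^bsub>?M\<^esub> f) =
        a \<odot>\<^bsub>quotient_module ?M' (monomial N')\<^esub> (monomial N' +>\<^bsub>?M'\<^esub> move f)"
      using a monomial_mult[OF P'(1) move_in] by (simp add: q'(4) move_in eq')
  qed (auto simp: q' move_in)
  show ?thesis
  proof (rule M.first_isomorphism[OF M'.right_module_quotient[OF sub'] hom _ sub])
    show "(\<lambda>f. monomial N' +>\<^bsub>?M'\<^esub> move f) ` carrier ?M = carrier (quotient_module ?M' (monomial N'))"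
    proof
      show "carrier (quotient_module ?M' (monomial N')) \<subseteq> (\<lambda>f. monomial N' +>\<^bsub>?M'\<^esub> move f) ` carrier ?M"
      proof
        fix C assume "C \<in> carrier (quotient_module ?M' (monomial N'))"
        then obtain g where g: "g \<in> monomial P'" "C = monomial N' +>\<^bsub>?M'\<^esub> g" by (auto simp: q')
        define f where "f = (\<lambda>x. if \<exists>v\<in>D. x = path i v then g (path i' (snd (snd x))) else 0)"
        have f: "f (path u v) = (if u = i \<and> v \<in> D then g (path i' v) else 0)" for u v
          by (auto simp: f_def) (auto simp: path_def)
        have "f \<in> monomial P"
          using reach D by (auto simp: monomial_def f carrier_iff) (auto simp: f_def path_in_qpaths)
        moreover have "C = monomial N' +>\<^bsub>?M'\<^esub> move f"
          unfolding g(2) eq'[OF g(1) move_in]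
          using g(1) D' by (auto simp: move f monomial_def)
        ultimately show "C \<in> (\<lambda>f. monomial N' +>\<^bsub>?M'\<^esub> move f) ` carrier ?M" by auto
      qed
    qed (auto simp: q' move_in)
    fix f assume "f \<in> carrier ?M"
    then have f: "f \<in> monomial P" by simp
    have "move f \<in> monomial N' \<longleftrightarrow> f \<in> monomial N"
    proof -
      have notin: "(i', v) \<notin> N'" "(i, v) \<notin> N" if "v \<in> D" for v
        using that D[of i v] D'[of i' v] reach[of v] by auto
      have "move f \<in> monomial N' \<longleftrightarrow> (\<forall>v\<in>D. f (path i v) = 0)"
        using move_in[of f] notin(1) reach by (auto simp: monomial_def move)
      also have "\<dots> \<longleftrightarrow> f \<in> monomial N"
        using f D notin(2) reach unfolding monomial_def by blast
      finally show ?thesis .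
    qed
    then show "monomial N' +>\<^bsub>?M'\<^esub> move f = \<zero>\<^bsub>quotient_module ?M' (monomial N')\<^esub> \<longleftrightarrow> f \<in> monomial N"
      using monomial_coset_zero_iff[OF P' move_in] by (simp add: q')
  qed
qed

text \<open>The paths that occur in \<open>f\<close> are split off one by one. Multiples come from the right action:
  the scalar \<open>c\<close> acts on a path with target \<open>v\<close> as the element \<open>c\<cdot>e\<^sub>v\<close> of the algebra.\<close>

lemma in_submodule_if_paths:
  assumes P: "right_closed P" and U: "submodule U A (monomial_module P)"
    and f: "f \<in> carrier A" "\<And>u v. u \<preceq> v \<Longrightarrow> f (path u v) \<noteq> 0 \<Longrightarrow> single 1 u v \<in> U"
  shows "f \<in> U"
proof -
  interpret M: right_module A "monomial_module P" by (rule right_module_monomial[OF P])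
  note U' = U[unfolded M.submodule_iff, simplified]
  have "finite {x. f x \<noteq> 0}" using f(1) by (auto simp: path_algebra_def)
  then show ?thesis
    using f
  proof (induction "{x. f x \<noteq> 0}" arbitrary: f rule: finite_psubset_induct)
    case psubset
    show ?case
    proof (cases "\<exists>u v. u \<preceq> v \<and> f (path u v) \<noteq> 0")
      case True
      then obtain u v where uv: "u \<preceq> v" "f (path u v) \<noteq> 0" by blast
      define c where "c = f (path u v)"
      define g where "g = (\<lambda>x. if x = path u v then 0 else f x)"
      have gpath: "g (path u' v') = (if u' = u \<and> v' = v then 0 else f (path u' v'))" for u' v'
        by (simp add: g_def)
      have "{x. g x \<noteq> 0} \<subset> {x. f x \<noteq> 0}" using uv by (auto simp: g_def)
      moreover have "g \<in> carrier A" using psubset.prems(1) by (auto simp: carrier_iff g_def)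
      moreover have "single 1 u' v' \<in> U" if "u' \<preceq> v'" "g (path u' v') \<noteq> 0" for u' v'
        using psubset.prems(2)[OF that(1)] that by (auto simp: gpath split: if_splits)
      ultimately have "g \<in> U" using psubset.hyps(2)[of g] by blast
      moreover have "single c u v \<in> U"
      proof -
        have "single 1 u v \<otimes>\<^bsub>A\<^esub> single c v v \<in> U"
          using U' psubset.prems(2)[OF uv] uv(1) precedes_verts by auto
        then show ?thesis using uv(1) precedes_verts by (simp add: single_mult_single)
      qed
      moreover have "f = (\<lambda>x. g x + single c u v x)" by (auto simp: g_def single_def c_def)
      ultimately show ?thesis using U' by metis
    next
      case False
      then have "f = (\<lambda>x. 0)"
        using psubset.prems(1) by (intro path_algebra_eqI) (auto simp: carrier_iff)
      then show ?thesis using U' by simp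
    qed
  qed
qed

end


context path_algebra_quiver
begin

section \<open>Projective, simple and standard modules\<close>

definition paths_from :: "'v \<Rightarrow> ('v \<times> 'v) set" where
  "paths_from v = {(u, w). u = v}"

definition proper_paths_from :: "'v \<Rightarrow> ('v \<times> 'v) set" where
  "proper_paths_from v = {(u, w). u = v \<and> w \<noteq> v}"

text \<open>These are the vertices \<open>w\<close> such that the path from \<open>v\<close> to \<open>w\<close> survives in the standard module
  of \<open>v\<close>, where \<open>\<rho>\<close> plays the role of the permutation; the paths to the other vertices span the
  kernel of the projection from \<open>P(v)\<close>.\<close>

definition visible :: "('v \<Rightarrow> 'b::linorder) \<Rightarrow> 'v \<Rightarrow> 'v set" where
  "visible \<rho> v = {w. v \<preceq> w \<and> (\<forall>k. v \<preceq> k \<longrightarrow> k \<preceq> w \<longrightarrow> \<rho> k \<le> \<rho> v)}"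

definition hidden_paths_from :: "('v \<Rightarrow> 'b::linorder) \<Rightarrow> 'v \<Rightarrow> ('v \<times> 'v) set" where
  "hidden_paths_from \<rho> v = {(u, w). u = v \<and> w \<notin> visible \<rho> v}"

definition simple_at :: "'v \<Rightarrow> (('v, 'e) qpath \<Rightarrow> 'k, (('v, 'e) qpath \<Rightarrow> 'k) set) module" where
  "simple_at v = quotient_module (monomial_module (paths_from v)) (monomial (proper_paths_from v))"

definition standard :: "('v \<Rightarrow> 'b::linorder) \<Rightarrow> 'v \<Rightarrow> (('v, 'e) qpath \<Rightarrow> 'k, (('v, 'e) qpath \<Rightarrow> 'k) set) module"
  where "standard \<rho> v =
    quotient_module (monomial_module (paths_from v)) (monomial (hidden_paths_from \<rho> v))"

lemma visible_self: "v \<in> verts Q \<Longrightarrow> v \<in> visible \<rho> v"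
  by (auto simp: visible_def dest: precedes_antisym)

lemma visible_precedes: "w \<in> visible \<rho> v \<Longrightarrow> v \<preceq> w"
  by (simp add: visible_def)

lemma right_closed_paths_from [simp]:
  "right_closed (paths_from v)" "right_closed (proper_paths_from v)"
  "right_closed (hidden_paths_from \<rho> v)"
proof -
  show "right_closed (proper_paths_from v)"
    unfolding right_closed_def proper_paths_from_def by (auto dest: precedes_antisym)
  show "right_closed (hidden_paths_from \<rho> v)"
    unfolding right_closed_def hidden_paths_from_def visible_def
    by (auto dest: reachable_trans)
qed (auto simp: right_closed_def paths_from_def)

lemma paths_from_subsets [simp]:
  "proper_paths_from v \<subseteq> paths_from v" "hidden_paths_from \<rho> v \<subseteq> paths_from v"
  by (auto simp: paths_from_def proper_paths_from_def hidden_paths_from_def)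

lemma single_mult_paths_from:
  assumes "f \<in> monomial (paths_from v)" "v \<in> verts Q"
  shows "single 1 v v \<otimes>\<^bsub>A\<^esub> f = f"
  by (rule path_algebra_eqI)
    (use assms in \<open>auto simp: single_mult mult_closed monomial_def paths_from_def\<close>)

lemma mult_single_paths_from:
  assumes "f \<in> monomial (paths_from v)" "v \<preceq> w"
  shows "f \<otimes>\<^bsub>A\<^esub> single c w w = single (f (path v w) * c) v w"
  by (rule path_algebra_eqI)
    (use assms precedes_verts in \<open>auto simp: mult_single mult_closed monomial_def paths_from_def\<close>)

lemma proj_carrier:
  assumes "v \<in> verts Q"
  shows "{trivial_path v \<otimes>\<^bsub>A\<^esub> a | a. a \<in> carrier A} = monomial (paths_from v)"
proof
  show "{trivial_path v \<otimes>\<^bsub>A\<^esub> a | a. a \<in> carrier A} \<subseteq> monomial (paths_from v)"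
    using assms by (auto simp: trivial_path_eq monomial_def mult_closed single_mult paths_from_def)
  show "monomial (paths_from v) \<subseteq> {trivial_path v \<otimes>\<^bsub>A\<^esub> a | a. a \<in> carrier A}"
    using assms single_mult_paths_from[OF _ assms]
    by (force simp: trivial_path_eq dest: monomial_carrier)
qed

lemma right_module_simple_at [simp]: "right_module A (simple_at v)"
  unfolding simple_at_def
  by (intro right_module.right_module_quotient right_module_monomial submodule_monomial) simp_all

lemma right_module_standard [simp]: "right_module A (standard \<rho> v)"
  unfolding standard_def
  by (intro right_module.right_module_quotient right_module_monomial submodule_monomial) simp_all

text \<open>The paths of positive length span the only maximal submodule of \<open>P(v)\<close>: an element
  with a nonzero coefficient \<open>c\<close> at the trivial path generates the idempotent
  \<open>e\<^sub>v\<close>, since no other path leads from \<open>v\<close> to \<open>v\<close>.\<close>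

lemma proper_submodule_paths_from:
  assumes v: "v \<in> verts Q" and L: "submodule L A (monomial_module (paths_from v))"
    and "L \<noteq> monomial (paths_from v)"
  shows "L \<subseteq> monomial (proper_paths_from v)"
proof (rule ccontr)
  interpret M: right_module A "monomial_module (paths_from v)" by (simp add: right_module_monomial)
  note L' = L[unfolded M.submodule_iff, simplified]
  assume "\<not> L \<subseteq> monomial (proper_paths_from v)"
  then obtain f where f: "f \<in> L" "f \<notin> monomial (proper_paths_from v)" by blast
  have fP: "f \<in> monomial (paths_from v)" using f(1) L' by blast
  then have "f (path v v) \<noteq> 0"
    using f(2) by (auto simp: monomial_def paths_from_def proper_paths_from_def)
  then have "f \<otimes>\<^bsub>A\<^esub> single (inverse (f (path v v))) v v = single 1 v v"
    using fP v by (simp add: mult_single_paths_from)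
  moreover have "f \<otimes>\<^bsub>A\<^esub> single (inverse (f (path v v))) v v \<in> L" using L' f(1) v by simp
  ultimately have e: "single 1 v v \<in> L" by simp
  have "g \<in> L" if g: "g \<in> monomial (paths_from v)" for g
  proof -
    have "single 1 v v \<otimes>\<^bsub>A\<^esub> g \<in> L" using L' e monomial_carrier[OF g] by blast
    then show ?thesis by (simp add: single_mult_paths_from[OF g v])
  qed
  then show False using L' assms(3) by blast
qed

lemma maximal_submodule_paths_from:
  assumes v: "v \<in> verts Q"
  shows "maximal_submodule N A (monomial_module (paths_from v)) \<longleftrightarrow> N = monomial (proper_paths_from v)"
proof -
  let ?M = "monomial_module (paths_from v)" and ?N = "monomial (proper_paths_from v)"
  have sub: "submodule ?N A ?M" by (rule submodule_monomial) simp_all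
  have "single 1 v v \<notin> ?N" using v by (auto simp: monomial_def proper_paths_from_def)
  moreover have "single 1 v v \<in> monomial (paths_from v)"
    using v by (auto intro: single_in_monomial simp: paths_from_def)
  ultimately have ne: "?N \<noteq> carrier ?M" by auto
  have max: "L = ?N \<or> L = carrier ?M" if "submodule L A ?M" "?N \<subseteq> L" for L
    using proper_submodule_paths_from[OF v that(1)] that(2) by auto
  show ?thesis
    using sub ne max proper_submodule_paths_from[OF v] unfolding maximal_submodule_def
    by (metis monomial_module_simps(1))
qed

lemma simple_simple_at: "v \<in> verts Q \<Longrightarrow> simple_module A (simple_at v)"
  unfolding simple_at_def
  by (intro right_module.simple_quotient_maximal right_module_monomial)
    (simp_all add: maximal_submodule_paths_from)

lemma simple_at_annihilated:
  assumes "v \<in> verts Q" "k \<in> verts Q" "k \<noteq> v" "x \<in> carrier (simple_at v)"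
  shows "single 1 k k \<odot>\<^bsub>simple_at v\<^esub> x = \<zero>\<^bsub>simple_at v\<^esub>"
proof -
  let ?M = "monomial_module (paths_from v)"
  interpret M: right_module A ?M by (simp add: right_module_monomial)
  have sub: "submodule (monomial (proper_paths_from v)) A ?M" by (rule submodule_monomial) simp_all
  note q = M.quotient_module_simps[OF sub]
  obtain f where f: "f \<in> monomial (paths_from v)" "x = monomial (proper_paths_from v) +>\<^bsub>?M\<^esub> f"
    using assms(4) by (auto simp: simple_at_def q)
  have "f \<otimes>\<^bsub>A\<^esub> single 1 k k \<in> monomial (proper_paths_from v)"
    using assms f(1) by (auto simp: monomial_def mult_closed mult_single paths_from_def proper_paths_from_def)
  then show ?thesis
    using f assms(2) monomial_mult[OF right_closed_paths_from(1) f(1)] by (simp add: simple_at_def q)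
qed

text \<open>Removing the paths with source \<open>v\<close> one by one, each time one that continues no other path still
  present, gives a composition series; the factor belonging to a path with target \<open>w\<close> is \<open>S(w)\<close>.\<close>

lemma has_filtration_simples:
  assumes N: "right_closed N"
  shows "\<lbrakk>right_closed P; N \<subseteq> P; P \<subseteq> paths_from v;
     \<And>w. v \<preceq> w \<Longrightarrow> (v, w) \<in> P \<Longrightarrow> (v, w) \<notin> N \<Longrightarrow> simple_at w \<in> \<F>\<rbrakk> \<Longrightarrow>
    has_filtration A (quotient_module (monomial_module P) (monomial N)) \<F>"
proof (induction "card {w. v \<preceq> w \<and> (v, w) \<in> P \<and> (v, w) \<notin> N}" arbitrary: P rule: less_induct)
  case less
  let ?W = "{w. v \<preceq> w \<and> (v, w) \<in> P \<and> (v, w) \<notin> N}"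
  let ?M = "monomial_module P"
  interpret M: right_module A ?M using less.prems by (simp add: right_module_monomial)
  have subN: "submodule (monomial N) A ?M" using N less.prems by (simp add: submodule_monomial)
  interpret Q: right_module A "quotient_module ?M (monomial N)" by (rule M.right_module_quotient[OF subN])
  note q = M.quotient_module_simps[OF subN]
  have fin: "finite ?W" by (rule finite_subset[OF _ finite_interval(2)[of v]]) auto
  show ?case
  proof (cases "?W = {}")
    case True
    have "monomial P \<subseteq> monomial N"
    proof
      fix f assume f: "f \<in> monomial P"
      have "f (path u w) = 0" if "u \<preceq> w" "(u, w) \<notin> N" for u w
        using f that True less.prems(3) by (auto simp: monomial_def paths_from_def)
      then show "f \<in> monomial N" using f by (auto simp: monomial_def)
    qed
    moreover have "monomial N \<subseteq> monomial P" using less.prems by (simp add: monomial_mono)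
    moreover have "(\<lambda>x. 0) \<in> monomial N" using M.submodule_iff[of "monomial N"] subN by simp
    ultimately have "carrier (quotient_module ?M (monomial N)) = {\<zero>\<^bsub>quotient_module ?M (monomial N)\<^esub>}"
      using q(5) by (auto simp: q(1,2) image_iff)
    then show ?thesis by (rule Q.has_filtration_zero)
  next
    case False
    \<comment> \<open>\<open>h\<close> increases strictly along paths, so a path whose target minimizes \<open>h\<close> is no continuation
      of another path in \<open>P - N\<close>, and removing it leaves a right closed set\<close>
    define h where "h w = card {k. k \<preceq> w}" for w
    have hmono: "h k < h w" if "k \<preceq> w" "k \<noteq> w" for k w
    proof -
      have "finite {k. k \<preceq> w}" by (rule finite_subset[OF _ finite_verts]) (auto dest: precedes_verts)
      moreover have "{x. x \<preceq> k} \<subset> {x. x \<preceq> w}"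
        using that precedes_antisym[of k w] precedes_verts(2)[of k w] by (auto intro: reachable_trans)
      ultimately show ?thesis unfolding h_def by (rule psubset_card_mono)
    qed
    obtain w where w: "w \<in> ?W" and min: "\<And>k. k \<in> ?W \<Longrightarrow> h w \<le> h k"
    proof
      show "arg_min_on h ?W \<in> ?W" by (rule arg_min_if_finite(1)[OF fin False])
      show "h (arg_min_on h ?W) \<le> h k" if "k \<in> ?W" for k
        using arg_min_if_finite(2)[OF fin False, of h] that by (meson not_le)
    qed
    define P' where "P' = P - {(v, w)}"
    have P': "right_closed P'" "P' \<subseteq> P" "N \<subseteq> P'"
    proof -
      show "right_closed P'"
        unfolding right_closed_def
      proof (intro allI impI)
        fix u x y assume a: "(u, x) \<in> P'" "u \<preceq> x" "x \<preceq> y"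
        then have "(u, y) \<in> P" using less.prems(1) by (auto simp: P'_def right_closed_def)
        moreover have "\<not> (u = v \<and> y = w)"
        proof
          assume uy: "u = v \<and> y = w"
          then have "x \<noteq> w" "(v, x) \<in> P" using a by (auto simp: P'_def)
          moreover from this have "(v, x) \<notin> N"
            using N w a uy by (auto simp: right_closed_def)
          ultimately show False using min[of x] hmono[of x w] a uy by auto
        qed
        ultimately show "(u, y) \<in> P'" by (auto simp: P'_def)
      qed
    qed (use w less.prems(2) in \<open>auto simp: P'_def\<close>)
    have subP': "submodule (monomial P') A ?M" using P' less.prems by (simp add: submodule_monomial)
    have NP': "monomial N \<subseteq> monomial P'" using P' by (simp add: monomial_mono)
    let ?L = "(\<lambda>x. monomial N +>\<^bsub>?M\<^esub> x) ` monomial P'"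
    show ?thesis
    proof (rule Q.has_filtration_extend)
      show "submodule ?L A (quotient_module ?M (monomial N))"
        by (rule M.submodule_quotient[OF subN subP'])
      have "single 1 v w \<in> monomial P" using w by (auto intro: single_in_monomial)
      moreover have "monomial N +>\<^bsub>?M\<^esub> single 1 v w \<notin> ?L"
      proof
        assume "monomial N +>\<^bsub>?M\<^esub> single 1 v w \<in> ?L"
        then obtain f where "f \<in> monomial P'"
          "monomial N +>\<^bsub>?M\<^esub> single 1 v w = monomial N +>\<^bsub>?M\<^esub> f" by blast
        moreover from this have "f \<in> monomial P" using P'(2) monomial_mono by blast
        ultimately have "single 1 v w (path v w) = f (path v w)"
          using w \<open>single 1 v w \<in> monomial P\<close> monomial_coset_eq_iff[OF less.prems(1) N less.prems(2)]
          by blast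
        moreover have "f (path v w) = 0"
          using \<open>f \<in> monomial P'\<close> w by (auto simp: monomial_def P'_def)
        ultimately show False by simp
      qed
      ultimately show "?L \<noteq> carrier (quotient_module ?M (monomial N))" by (auto simp: q(1))
      have "{w. v \<preceq> w \<and> (v, w) \<in> P' \<and> (v, w) \<notin> N} \<subset> ?W" using w by (auto simp: P'_def)
      then have "card {w. v \<preceq> w \<and> (v, w) \<in> P' \<and> (v, w) \<notin> N} < card ?W"
        using fin by (rule psubset_card_mono[rotated])
      then have "has_filtration A (quotient_module (monomial_module P') (monomial N)) \<F>"
        using less.hyps[of P'] less.prems P' by blast
      then show "has_filtration A ((quotient_module ?M (monomial N))\<lparr>carrier := ?L\<rparr>) \<F>"
        by (simp add: M.quotient_module_restrict)
      show "simple_at w \<in> \<F>" using less.prems w by blast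
      have "right_module_iso A (quotient_module ?M (monomial P')) (simple_at w)"
        unfolding simple_at_def
      proof (rule monomial_subquotient_iso[where i = v and i' = w and D = "{w}"])
        show "(x, y) \<in> P \<and> (x, y) \<notin> P' \<longleftrightarrow> x = v \<and> y \<in> {w}" for x y
          using w by (auto simp: P'_def)
        show "(x, y) \<in> paths_from w \<and> (x, y) \<notin> proper_paths_from w \<longleftrightarrow> x = w \<and> y \<in> {w}" for x y
          by (auto simp: paths_from_def proper_paths_from_def)
      qed (use P' less.prems w precedes_verts in auto)
      then show "right_module_iso A (quotient_module (quotient_module ?M (monomial N)) ?L) (simple_at w)"
        by (rule iso_trans[OF M.third_isomorphism[OF subN subP' NP']])
    qed
  qed
qed

text \<open>If \<open>w\<close> is not visible from \<open>v\<close>, then a vertex \<open>k\<close> with \<open>\<rho> k > \<rho> v\<close> lies on the path from \<open>v\<close>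
  to \<open>w\<close>. The path from \<open>v\<close> to \<open>k\<close> is fixed by \<open>e\<^sub>k\<close>, which annihilates every module in
  \<open>\<F>\<close>; so this path, and with it its continuation to \<open>w\<close>, vanishes in every quotient of
  \<open>P(v)\<close> with composition factors in \<open>\<F>\<close>. Conversely, the quotient by all these paths has only
  the composition factors \<open>S(w)\<close> with \<open>w\<close> visible from \<open>v\<close>, which belong to \<open>\<F>\<close>.\<close>

lemma hidden_paths_least:
  fixes \<rho> :: "'v \<Rightarrow> 'b::linorder"
  assumes v: "v \<in> verts Q" and \<F>: "\<F> = simple_at ` {w \<in> verts Q. \<rho> w \<le> \<rho> v}"
  shows "(LEAST U. submodule U A (monomial_module (paths_from v)) \<and>
     only_composition_factors A (quotient_module (monomial_module (paths_from v)) U) \<F>) =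
     monomial (hidden_paths_from \<rho> v)"
proof (rule Least_equality)
  let ?M = "monomial_module (paths_from v)"
  interpret M: right_module A ?M by (simp add: right_module_monomial)
  have simples: "right_module A F \<and> simple_module A F" if "F \<in> \<F>" for F
    using that simple_simple_at by (auto simp: \<F>)
  have filt_iff: "only_composition_factors A (quotient_module ?M U) \<F> \<longleftrightarrow>
      has_filtration A (quotient_module ?M U) \<F>" if "submodule U A ?M" for U
    by (rule right_module.only_composition_factors_iff_filtration[OF M.right_module_quotient[OF that]])
      (use simples in auto)
  have sub: "submodule (monomial (hidden_paths_from \<rho> v)) A ?M" by (rule submodule_monomial) simp_all
  have "has_filtration A (quotient_module ?M (monomial (hidden_paths_from \<rho> v))) \<F>"
  proof (rule has_filtration_simples)
    fix w assume "v \<preceq> w" "(v, w) \<notin> hidden_paths_from \<rho> v"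
    then show "simple_at w \<in> \<F>"
      using precedes_verts(2)[of v w] by (auto simp: \<F> hidden_paths_from_def visible_def)
  qed simp_all
  then show "submodule (monomial (hidden_paths_from \<rho> v)) A ?M \<and>
      only_composition_factors A (quotient_module ?M (monomial (hidden_paths_from \<rho> v))) \<F>"
    using sub filt_iff by simp
  fix U assume "submodule U A ?M \<and> only_composition_factors A (quotient_module ?M U) \<F>"
  then have U: "submodule U A ?M" and filt: "has_filtration A (quotient_module ?M U) \<F>"
    using filt_iff by auto
  interpret Q: right_module A "quotient_module ?M U" by (rule M.right_module_quotient[OF U])
  note q = M.quotient_module_simps[OF U]
  note U' = U[unfolded M.submodule_iff, simplified]
  have large: "single 1 v k \<in> U" if k: "v \<preceq> k" "\<rho> v < \<rho> k" for k
  proof -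
    let ?x = "U +>\<^bsub>?M\<^esub> single 1 v k"
    have kv: "k \<in> verts Q" using k precedes_verts by blast
    have mem: "single 1 v k \<in> monomial (paths_from v)"
      using k by (auto intro: single_in_monomial simp: paths_from_def)
    have "?x = \<zero>\<^bsub>quotient_module ?M U\<^esub>"
    proof (rule Q.has_filtration_annihilated[OF filt])
      show "single 1 k k \<in> carrier A" using kv by simp
      show "right_module A F \<and> (\<forall>x\<in>carrier F. single 1 k k \<odot>\<^bsub>F\<^esub> x = \<zero>\<^bsub>F\<^esub>)" if F: "F \<in> \<F>" for F
      proof -
        obtain w where w: "F = simple_at w" "w \<in> verts Q" "\<rho> w \<le> \<rho> v" using F unfolding \<F> by blast
        then have "k \<noteq> w" using k(2) by auto
        then show ?thesis using simple_at_annihilated[OF w(2) kv] right_module_simple_at unfolding w(1) by blast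
      qed
      show "?x \<in> carrier (quotient_module ?M U)" using mem by (simp add: q)
      show "single 1 k k \<odot>\<^bsub>quotient_module ?M U\<^esub> ?x = ?x"
        using mem kv k by (simp add: q(4) single_mult_single)
    qed
    then show ?thesis using mem by (simp add: q)
  qed
  show "monomial (hidden_paths_from \<rho> v) \<le> U"
  proof
    fix f assume f: "f \<in> monomial (hidden_paths_from \<rho> v)"
    show "f \<in> U"
    proof (rule in_submodule_if_paths[OF _ U])
      fix u w assume uw: "u \<preceq> w" "f (path u w) \<noteq> 0"
      then have "(u, w) \<in> hidden_paths_from \<rho> v" using f by (auto simp: monomial_def)
      then obtain k where k: "u = v" "v \<preceq> k" "k \<preceq> w" "\<rho> v < \<rho> k"
        using uw by (auto simp: hidden_paths_from_def visible_def not_le)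
      then have "single 1 v k \<otimes>\<^bsub>A\<^esub> single 1 k w \<in> U" using large U' by simp
      then show "single 1 u w \<in> U" using k by (simp add: single_mult_single)
    qed (use f in \<open>auto dest: monomial_carrier\<close>)
  qed
qed

section \<open>Every order of the vertices is quasi-hereditary\<close>

lemma local_endomorphism_ring_standard:
  assumes v: "v \<in> verts Q"
  shows "local_ring (endomorphism_ring A (standard \<rho> v))"
proof -
  let ?M = "monomial_module (paths_from v)" and ?U = "monomial (hidden_paths_from \<rho> v)"
  interpret M: right_module A ?M by (simp add: right_module_monomial)
  have U: "submodule ?U A ?M" by (rule submodule_monomial) simp_all
  interpret D: right_module A "standard \<rho> v" by simp
  note q = M.quotient_module_simps[OF U, folded standard_def]
  have e: "single 1 v v \<in> monomial (paths_from v)"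
    using v by (auto intro: single_in_monomial simp: paths_from_def)
  have e_U: "single 1 v v \<notin> ?U"
    using v visible_self[OF v] by (auto simp: monomial_def hidden_paths_from_def)
  show ?thesis
  proof (rule D.local_endomorphism_ring_cyclic)
    show "?U +>\<^bsub>?M\<^esub> single 1 v v \<in> carrier (standard \<rho> v)" using e by (simp add: q)
    show "?U +>\<^bsub>?M\<^esub> single 1 v v \<noteq> \<zero>\<^bsub>standard \<rho> v\<^esub>" using e e_U by (simp add: q)
    show "single 1 v v \<in> carrier A" using v by simp
    show "single 1 v v \<odot>\<^bsub>standard \<rho> v\<^esub> (?U +>\<^bsub>?M\<^esub> single 1 v v) = ?U +>\<^bsub>?M\<^esub> single 1 v v"
      using e v by (simp add: q(4) single_mult_single)
    fix x assume "x \<in> carrier (standard \<rho> v)"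
    then obtain f where f: "f \<in> monomial (paths_from v)" "x = ?U +>\<^bsub>?M\<^esub> f" by (auto simp: q)
    show "\<exists>a\<in>carrier A. x = a \<odot>\<^bsub>standard \<rho> v\<^esub> (?U +>\<^bsub>?M\<^esub> single 1 v v)"
    proof
      show "f \<in> carrier A" using f by (simp add: monomial_carrier)
      then show "x = f \<odot>\<^bsub>standard \<rho> v\<^esub> (?U +>\<^bsub>?M\<^esub> single 1 v v)"
        using f e v by (simp add: q(4) single_mult_paths_from)
    qed
    assume nz: "single 1 v v \<odot>\<^bsub>standard \<rho> v\<^esub> x \<noteq> \<zero>\<^bsub>standard \<rho> v\<^esub>"
    define c where "c = f (path v v)"
    have fe: "f \<otimes>\<^bsub>A\<^esub> single 1 v v = single c v v" using f v by (simp add: mult_single_paths_from c_def)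
    have "c \<noteq> 0"
    proof
      assume "c = 0"
      then have "single c v v \<in> ?U" using v by (auto simp: monomial_def)
      moreover have "single 1 v v \<odot>\<^bsub>standard \<rho> v\<^esub> x = ?U +>\<^bsub>?M\<^esub> single c v v"
        using f v fe by (simp add: q(4))
      moreover have "single c v v \<in> monomial (paths_from v)"
        using v by (auto intro: single_in_monomial simp: paths_from_def)
      ultimately show False using nz by (simp add: q)
    qed
    \<comment> \<open>the central unit asked for is \<open>c\<cdot>1\<close>\<close>
    define scalar :: "'k \<Rightarrow> ('v, 'e) qpath \<Rightarrow> 'k" where "scalar d = (\<lambda>x. d * \<one>\<^bsub>A\<^esub> x)" for d
    have scalar: "scalar d \<in> carrier A" for d
      using one_closed by (auto simp: scalar_def carrier_iff)
    have scalar_mult: "scalar d \<otimes>\<^bsub>A\<^esub> g = (\<lambda>x. d * g x)" "g \<otimes>\<^bsub>A\<^esub> scalar d = (\<lambda>x. d * g x)"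
      if g: "g \<in> carrier A" for d g
    proof -
      have "scalar d \<otimes>\<^bsub>A\<^esub> g = (\<lambda>x. d * (\<one>\<^bsub>A\<^esub> \<otimes>\<^bsub>A\<^esub> g) x)" "g \<otimes>\<^bsub>A\<^esub> scalar d = (\<lambda>x. d * (g \<otimes>\<^bsub>A\<^esub> \<one>\<^bsub>A\<^esub>) x)"
        by (simp_all add: path_algebra_def scalar_def sum_distrib_left case_prod_beta algebra_simps)
      then show "scalar d \<otimes>\<^bsub>A\<^esub> g = (\<lambda>x. d * g x)" "g \<otimes>\<^bsub>A\<^esub> scalar d = (\<lambda>x. d * g x)"
        using g by simp_all
    qed
    show "\<exists>c\<in>Units A. (\<forall>a\<in>carrier A. a \<otimes>\<^bsub>A\<^esub> c = c \<otimes>\<^bsub>A\<^esub> a) \<and>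
        single 1 v v \<odot>\<^bsub>standard \<rho> v\<^esub> x = c \<odot>\<^bsub>standard \<rho> v\<^esub> (?U +>\<^bsub>?M\<^esub> single 1 v v)"
    proof (intro bexI[of _ "scalar c"] conjI ballI)
      have "scalar c \<otimes>\<^bsub>A\<^esub> scalar (inverse c) = \<one>\<^bsub>A\<^esub>" "scalar (inverse c) \<otimes>\<^bsub>A\<^esub> scalar c = \<one>\<^bsub>A\<^esub>"
        using \<open>c \<noteq> 0\<close> scalar scalar_mult(1) by (auto simp: scalar_def)
      then show "scalar c \<in> Units A" using scalar by (auto simp: Units_def)
      show "a \<otimes>\<^bsub>A\<^esub> scalar c = scalar c \<otimes>\<^bsub>A\<^esub> a" if "a \<in> carrier A" for a
        using that by (simp add: scalar_mult)
      have "single 1 v v \<otimes>\<^bsub>A\<^esub> scalar c = single c v v"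
        using v by (simp add: scalar_mult) (auto simp: single_def)
      then show "single 1 v v \<odot>\<^bsub>standard \<rho> v\<^esub> x = scalar c \<odot>\<^bsub>standard \<rho> v\<^esub> (?U +>\<^bsub>?M\<^esub> single 1 v v)"
        using f e v scalar fe by (simp add: q(4))
    qed
  qed
qed

definition peak :: "('v \<Rightarrow> 'b::linorder) \<Rightarrow> 'v \<Rightarrow> 'v \<Rightarrow> 'v" where
  "peak \<rho> u w = (THE k. u \<preceq> k \<and> k \<preceq> w \<and> (\<forall>x. u \<preceq> x \<longrightarrow> x \<preceq> w \<longrightarrow> \<rho> x \<le> \<rho> k))"

lemma peak_eq_iff:
  assumes inj: "inj_on \<rho> (verts Q)" and uw: "u \<preceq> w"
  shows "peak \<rho> u w = k \<longleftrightarrow> u \<preceq> k \<and> k \<preceq> w \<and> (\<forall>x. u \<preceq> x \<longrightarrow> x \<preceq> w \<longrightarrow> \<rho> x \<le> \<rho> k)"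
proof -
  let ?max = "\<lambda>k. u \<preceq> k \<and> k \<preceq> w \<and> (\<forall>x. u \<preceq> x \<longrightarrow> x \<preceq> w \<longrightarrow> \<rho> x \<le> \<rho> k)"
  let ?I = "{x. u \<preceq> x \<and> x \<preceq> w}"
  have "?I \<noteq> {}" using uw precedes_verts by auto
  then have "Max (\<rho> ` ?I) \<in> \<rho> ` ?I" by (intro Max_in) auto
  then obtain m where m: "m \<in> ?I" "\<rho> m = Max (\<rho> ` ?I)" by auto
  have "?max m" using m by auto
  have uniq: "k = l" if "?max k" "?max l" for k l
    using that inj precedes_verts by (metis inj_onD order_antisym)
  have "peak \<rho> u w = m"
    unfolding peak_def by (rule the_equality) (fact \<open>?max m\<close>, rule uniq[OF _ \<open>?max m\<close>])
  then show ?thesis using \<open>?max m\<close> uniq[of m k] by metis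
qed

text \<open>Classify the paths with source \<open>u\<close> by the vertex \<open>k\<close> at which \<open>\<rho>\<close> is largest: the
  class of \<open>k\<close> has the same targets as the paths that span \<open>\<Delta>(k)\<close>, because every vertex on
  a path through \<open>k\<close> precedes \<open>k\<close> or is preceded by \<open>k\<close>.\<close>

lemma peak_eq_iff_visible:
  assumes inj: "inj_on \<rho> (verts Q)" and uw: "u \<preceq> w" "peak \<rho> u w = k" and ux: "u \<preceq> x"
  shows "peak \<rho> u x = k \<longleftrightarrow> x \<in> visible \<rho> k"
proof
  have k: "u \<preceq> k" "k \<preceq> w" "\<And>y. u \<preceq> y \<Longrightarrow> y \<preceq> w \<Longrightarrow> \<rho> y \<le> \<rho> k"
    using peak_eq_iff[OF inj uw(1)] uw(2) by auto
  show "peak \<rho> u x = k \<Longrightarrow> x \<in> visible \<rho> k"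
    using peak_eq_iff[OF inj ux] by (auto simp: visible_def intro: reachable_trans)
  assume x: "x \<in> visible \<rho> k"
  have "\<rho> y \<le> \<rho> k" if "u \<preceq> y" "y \<preceq> x" for y
  proof -
    have "y \<preceq> k \<or> k \<preceq> y" using interval_chain[of u y x k] that k x by (auto simp: visible_def)
    then show ?thesis using x that k by (auto simp: visible_def intro: reachable_trans)
  qed
  then show "peak \<rho> u x = k" using x k peak_eq_iff[OF inj ux] by (auto simp: visible_def)
qed

text \<open>Continuing a path can only raise the largest value of \<open>\<rho>\<close> on it. So removing a class of paths
  for which this value is least leaves a right closed set, and the factor is a standard
  module. The induction is on the number of paths that remain.\<close>

lemma has_filtration_standard:
  assumes inj: "inj_on \<rho> (verts Q)"
    and \<F>: "\<And>v. v \<in> verts Q \<Longrightarrow> standard \<rho> v \<in> \<F>"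
  shows "\<lbrakk>right_closed P; P \<subseteq> {(u, w). u \<preceq> w};
     \<And>u w x. \<lbrakk>(u, w) \<in> P; u \<preceq> x; peak \<rho> u x = peak \<rho> u w\<rbrakk> \<Longrightarrow> (u, x) \<in> P\<rbrakk> \<Longrightarrow>
    has_filtration A (monomial_module P) \<F>"
proof (induction "card P" arbitrary: P rule: less_induct)
  case less
  interpret M: right_module A "monomial_module P" using less.prems by (simp add: right_module_monomial)
  have "P \<subseteq> verts Q \<times> verts Q" using less.prems(2) precedes_verts by auto
  then have fin: "finite P" using finite_verts by (meson finite_SigmaI finite_subset)
  show ?case
  proof (cases "P = {}")
    case True
    have "f = (\<lambda>x. 0)" if "f \<in> monomial P" for f
      by (rule path_algebra_eqI) (use that True in \<open>auto simp: monomial_def carrier_iff\<close>)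
    moreover have "(\<lambda>x. 0) \<in> monomial P" by (simp add: monomial_def carrier_iff)
    ultimately have "monomial P = {\<lambda>x. 0}" by blast
    then show ?thesis by (intro M.has_filtration_zero) simp
  next
    case False
    let ?p = "\<lambda>(u, w). \<rho> (peak \<rho> u w)"
    have "Min (?p ` P) \<in> ?p ` P" using fin False by (intro Min_in) auto
    then obtain u w where uw: "(u, w) \<in> P" "\<rho> (peak \<rho> u w) = Min (?p ` P)" by auto
    have min: "\<rho> (peak \<rho> u w) \<le> \<rho> (peak \<rho> x y)" if "(x, y) \<in> P" for x y
      unfolding uw(2) using that fin by (intro Min_le) (auto intro: rev_image_eqI)
    define k where "k = peak \<rho> u w"
    have "u \<preceq> w" using uw less.prems(2) by auto
    then have k: "u \<preceq> k" "k \<preceq> w" using peak_eq_iff[OF inj, of u w k] by (auto simp: k_def)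
    define P' where "P' = {(x, y) \<in> P. \<not> (x = u \<and> peak \<rho> u y = k)}"
    have P'P: "P' \<subseteq> P" by (auto simp: P'_def)
    have closed: "right_closed P'"
      unfolding right_closed_def
    proof (intro allI impI)
      fix x y z assume a: "(x, y) \<in> P'" "x \<preceq> y" "y \<preceq> z"
      then have yP: "(x, y) \<in> P" and zP: "(x, z) \<in> P" using less.prems(1) by (auto simp: P'_def right_closed_def)
      have "\<not> (x = u \<and> peak \<rho> u z = k)"
      proof
        assume z: "x = u \<and> peak \<rho> u z = k"
        define l where "l = peak \<rho> u y"
        have l: "u \<preceq> l" "l \<preceq> y" using peak_eq_iff[OF inj, of u y l] a z by (auto simp: l_def)
        have "u \<preceq> z" using a z by (auto intro: reachable_trans)
        then have "\<rho> l \<le> \<rho> k" using peak_eq_iff[OF inj, of u z k] l a z by (auto intro: reachable_trans)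
        moreover have "\<rho> k \<le> \<rho> l" using min[OF yP] z by (simp add: k_def l_def)
        ultimately have "l = k" using inj k l precedes_verts by (metis inj_onD order_antisym)
        then show False using a z by (auto simp: P'_def l_def)
      qed
      then show "(x, z) \<in> P'" using zP by (auto simp: P'_def)
    qed
    have sub: "submodule (monomial P') A (monomial_module P)"
      using less.prems(1) closed P'P by (rule submodule_monomial)
    show ?thesis
    proof (rule M.has_filtration_extend[OF sub])
      have "single 1 u w \<in> monomial P" using uw \<open>u \<preceq> w\<close> by (auto intro: single_in_monomial)
      moreover have "single 1 u w \<notin> monomial P'" using \<open>u \<preceq> w\<close> by (auto simp: monomial_def P'_def k_def)
      ultimately show "monomial P' \<noteq> carrier (monomial_module P)" by auto
      have "P' \<subset> P" using uw P'P by (auto simp: P'_def k_def)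
      then have "card P' < card P" using fin by (rule psubset_card_mono[rotated])
      moreover have "(x, z) \<in> P'" if "(x, y) \<in> P'" "x \<preceq> z" "peak \<rho> x z = peak \<rho> x y" for x y z
        using less.prems(3)[of x y z] that by (auto simp: P'_def)
      ultimately have "has_filtration A (monomial_module P') \<F>"
        using less.hyps[of P'] closed P'P less.prems(2) by blast
      then show "has_filtration A ((monomial_module P)\<lparr>carrier := monomial P'\<rparr>) \<F>" by simp
      show "standard \<rho> k \<in> \<F>" using k precedes_verts \<F> by blast
      show "right_module_iso A (quotient_module (monomial_module P) (monomial P')) (standard \<rho> k)"
        unfolding standard_def
      proof (rule monomial_subquotient_iso[where i = u and i' = k and D = "visible \<rho> k"])
        fix x y assume "x \<preceq> y"
        then show "(x, y) \<in> P \<and> (x, y) \<notin> P' \<longleftrightarrow> x = u \<and> y \<in> visible \<rho> k"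
          using peak_eq_iff_visible[OF inj \<open>u \<preceq> w\<close> k_def[symmetric], of y] less.prems(3)[OF uw(1), of y]
          by (auto simp: P'_def k_def)
        show "(x, y) \<in> paths_from k \<and> (x, y) \<notin> hidden_paths_from \<rho> k \<longleftrightarrow> x = k \<and> y \<in> visible \<rho> k"
          by (auto simp: paths_from_def hidden_paths_from_def)
      next
        show "u \<preceq> y \<and> k \<preceq> y" if "y \<in> visible \<rho> k" for y
          using that k by (auto simp: visible_def intro: reachable_trans)
      qed (use closed less.prems P'P in auto)
    qed
  qed
qed

lemma has_filtration_regular:
  assumes inj: "inj_on \<rho> (verts Q)" and \<F>: "\<And>v. v \<in> verts Q \<Longrightarrow> standard \<rho> v \<in> \<F>"
  shows "has_filtration A (regular_module A) \<F>"
proof -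
  have "has_filtration A (monomial_module {(u, w). u \<preceq> w}) \<F>"
    by (rule has_filtration_standard[OF inj \<F>]) (auto simp: right_closed_def intro: reachable_trans)
  moreover have "monomial_module {(u, w). u \<preceq> w} = regular_module A"
    by (auto simp: monomial_module_def monomial_def regular_module_def)
  ultimately show ?thesis by simp
qed

text \<open>The vertices visible from \<open>v\<close> are those with \<open>\<Delta>(v)\<cdot>e\<^sub>w \<noteq> 0\<close>, and an isomorphism maps a
  nonzero element fixed by \<open>e\<^sub>w\<close> to another one.\<close>

lemma visible_subset_if_iso:
  assumes iso: "right_module_iso A (standard \<rho> v) (standard \<rho>' v')"
  shows "visible \<rho> v \<subseteq> visible \<rho>' v'"
proof
  fix w assume w: "w \<in> visible \<rho> v"
  then have vw: "v \<preceq> w" "w \<in> verts Q" using precedes_verts by (auto simp: visible_def)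
  let ?M = "monomial_module (paths_from v)" and ?U = "monomial (hidden_paths_from \<rho> v)"
  let ?M' = "monomial_module (paths_from v')" and ?U' = "monomial (hidden_paths_from \<rho>' v')"
  interpret M: right_module A ?M by (simp add: right_module_monomial)
  interpret M': right_module A ?M' by (simp add: right_module_monomial)
  have U: "submodule ?U A ?M" "submodule ?U' A ?M'" by (rule submodule_monomial; simp)+
  interpret D: right_module A "standard \<rho> v" by simp
  interpret D': right_module A "standard \<rho>' v'" by simp
  note q = M.quotient_module_simps[OF U(1), folded standard_def]
    and q' = M'.quotient_module_simps[OF U(2), folded standard_def]
  obtain f where f: "f \<in> right_module_hom A (standard \<rho> v) (standard \<rho>' v')"
    "inj_on f (carrier (standard \<rho> v))" using iso by (auto simp: right_module_iso_def bij_betw_def)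
  let ?x = "?U +>\<^bsub>?M\<^esub> single 1 v w"
  have mem: "single 1 v w \<in> monomial (paths_from v)"
    using vw by (auto intro: single_in_monomial simp: paths_from_def)
  then have x: "?x \<in> carrier (standard \<rho> v)" by (simp add: q)
  have "single 1 v w \<notin> ?U" using w vw by (auto simp: monomial_def hidden_paths_from_def)
  then have "?x \<noteq> \<zero>\<^bsub>standard \<rho> v\<^esub>" using mem by (simp add: q)
  then have nz: "f ?x \<noteq> \<zero>\<^bsub>standard \<rho>' v'\<^esub>"
    using f x D.zero_closed D.hom_zero[OF _ f(1)] by (metis D'.right_module_axioms inj_onD)
  have ex: "single 1 w w \<odot>\<^bsub>standard \<rho> v\<^esub> ?x = ?x" using mem vw by (simp add: q(4) single_mult_single)
  have "f (single 1 w w \<odot>\<^bsub>standard \<rho> v\<^esub> ?x) = single 1 w w \<odot>\<^bsub>standard \<rho>' v'\<^esub> f ?x"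
    using f(1) x vw by (simp add: right_module_hom_def)
  then have fx: "single 1 w w \<odot>\<^bsub>standard \<rho>' v'\<^esub> f ?x = f ?x" unfolding ex by simp
  have "f ?x \<in> carrier (standard \<rho>' v')" using f(1) x by (auto simp: right_module_hom_def)
  then obtain h where h: "h \<in> monomial (paths_from v')" "f ?x = ?U' +>\<^bsub>?M'\<^esub> h" by (auto simp: q')
  have "h \<otimes>\<^bsub>A\<^esub> single 1 w w \<in> monomial (paths_from v')" using h by (simp add: monomial_mult)
  moreover have "?U' +>\<^bsub>?M'\<^esub> (h \<otimes>\<^bsub>A\<^esub> single 1 w w) \<noteq> ?U'"
    using fx nz h vw by (simp add: q'(2,4))
  ultimately have "h \<otimes>\<^bsub>A\<^esub> single 1 w w \<notin> ?U'" by (simp add: q'(5))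
  then obtain u x where ux: "u \<preceq> x" "(u, x) \<notin> hidden_paths_from \<rho>' v'" "(h \<otimes>\<^bsub>A\<^esub> single 1 w w) (path u x) \<noteq> 0"
    by (auto simp: monomial_def mult_closed)
  then have "x = w" "h (path u w) \<noteq> 0" using vw by (auto simp: mult_single split: if_splits)
  then have "u = v'" using h ux by (auto simp: monomial_def paths_from_def)
  then show "w \<in> visible \<rho>' v'" using ux \<open>x = w\<close> by (auto simp: hidden_paths_from_def)
qed

lemma standard_iso_iff:
  assumes "v \<in> verts Q" "v' \<in> verts Q"
  shows "right_module_iso A (standard \<rho> v) (standard \<rho>' v') \<longleftrightarrow> v = v' \<and> visible \<rho> v = visible \<rho>' v'"
proof
  assume iso: "right_module_iso A (standard \<rho> v) (standard \<rho>' v')"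
  then have "right_module_iso A (standard \<rho>' v') (standard \<rho> v)"
    by (rule right_module.iso_sym[OF right_module_standard])
  then have eq: "visible \<rho> v = visible \<rho>' v'"
    using visible_subset_if_iso[OF iso] visible_subset_if_iso by blast
  then have "v' \<preceq> v" "v \<preceq> v'" using assms visible_self visible_precedes by metis+
  then show "v = v' \<and> visible \<rho> v = visible \<rho>' v'" using eq precedes_antisym by blast
next
  assume eq: "v = v' \<and> visible \<rho> v = visible \<rho>' v'"
  have "standard \<rho> v = standard \<rho>' v'"
    unfolding standard_def hidden_paths_from_def conjunct2[OF eq] unfolding conjunct1[OF eq] ..
  moreover have "right_module_iso A (standard \<rho>' v') (standard \<rho>' v')"
    unfolding right_module_iso_def by (intro bexI[of _ id]) (auto simp: right_module_hom_def)
  ultimately show "right_module_iso A (standard \<rho> v) (standard \<rho>' v')" by simp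
qed

end


section \<open>Quasi-hereditary structures and visibility\<close>

lemma card_quotient_kernel:
  "card (P // {(x, y). x \<in> P \<and> y \<in> P \<and> F x = F y}) = card (F ` P)"
proof -
  have "P // {(x, y). x \<in> P \<and> y \<in> P \<and> F x = F y} = (\<lambda>z. {y \<in> P. F y = z}) ` (F ` P)"
    by (force simp: quotient_def Image_def)
  moreover have "inj_on (\<lambda>z. {y \<in> P. F y = z}) (F ` P)"
    by (rule inj_onI) blast
  ultimately show ?thesis by (simp add: card_image)
qed

locale numbered_quiver = path_algebra_quiver Q K
  for Q :: "('v, 'e) pre_digraph" and K :: "'k::field itself" +
  fixes \<nu> :: "nat \<Rightarrow> 'v"
  assumes bij_\<nu>: "bij_betw \<nu> {1..card (verts Q)} (verts Q)"
begin

abbreviation "n \<equiv> card (verts Q)"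
abbreviation "e \<equiv> \<lambda>i. trivial_path (\<nu> i) :: ('v, 'e) qpath \<Rightarrow> 'k"

definition vertex_order :: "(nat \<Rightarrow> nat) \<Rightarrow> 'v \<Rightarrow> nat" where
  "vertex_order \<sigma> v = \<sigma> (inv_into {1..n} \<nu> v)"

lemma \<nu>_verts: "i \<in> {1..n} \<Longrightarrow> \<nu> i \<in> verts Q"
  using bij_\<nu> by (auto simp: bij_betw_def)

lemma vertex_order_\<nu>: "i \<in> {1..n} \<Longrightarrow> vertex_order \<sigma> (\<nu> i) = \<sigma> i"
  using bij_\<nu> by (simp add: vertex_order_def bij_betw_def inv_into_f_f)

lemma verts_cases:
  assumes "v \<in> verts Q" obtains i where "i \<in> {1..n}" "v = \<nu> i"
  using assms bij_\<nu> unfolding bij_betw_def by blast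

lemma inj_vertex_order:
  assumes "\<sigma> permutes {1..n}" shows "inj_on (vertex_order \<sigma>) (verts Q)"
proof (rule inj_onI)
  fix v w assume "v \<in> verts Q" "w \<in> verts Q" "vertex_order \<sigma> v = vertex_order \<sigma> w"
  then show "v = w"
    using permutes_inj[OF assms] by (metis injD verts_cases vertex_order_\<nu>)
qed

lemma proj_module_eq: "i \<in> {1..n} \<Longrightarrow> proj_module A e i = monomial_module (paths_from (\<nu> i))"
  using proj_carrier[OF \<nu>_verts] by (simp add: proj_module_def monomial_module_def)

lemma simple_top_eq:
  assumes "i \<in> {1..n}" shows "simple_top A e i = simple_at (\<nu> i)"
proof -
  have "radical_module A (proj_module A e i) = monomial (proper_paths_from (\<nu> i))"
    using assms monomial_mono[OF paths_from_subsets(1)]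
    by (auto simp: radical_module_def proj_module_eq maximal_submodule_paths_from \<nu>_verts)
  then show ?thesis using assms by (simp add: simple_top_def top_module_def simple_at_def proj_module_eq)
qed

text \<open>This is the bridge to the definition by means of \<open>LEAST\<close>: the standard kernel is spanned by the
  paths to vertices that are not visible.\<close>

lemma standard_module_eq:
  assumes i: "i \<in> {1..n}"
  shows "standard_module A n e \<sigma> i = standard (vertex_order \<sigma>) (\<nu> i)"
proof -
  have "{simple_top A e j | j. j \<in> {1..n} \<and> \<sigma> j \<le> \<sigma> i} =
      simple_at ` {w \<in> verts Q. vertex_order \<sigma> w \<le> vertex_order \<sigma> (\<nu> i)}" (is "?l = ?r")
  proof
    show "?l \<subseteq> ?r" using i by (auto simp: simple_top_eq vertex_order_\<nu> \<nu>_verts)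
    show "?r \<subseteq> ?l"
    proof
      fix F assume "F \<in> ?r"
      then obtain w where w: "w \<in> verts Q" "vertex_order \<sigma> w \<le> vertex_order \<sigma> (\<nu> i)" "F = simple_at w"
        by blast
      then obtain j where "j \<in> {1..n}" "w = \<nu> j" using verts_cases by blast
      then show "F \<in> ?l" using w i by (auto simp: simple_top_eq vertex_order_\<nu> intro!: exI[of _ j])
    qed
  qed
  then have "standard_kernel A n e \<sigma> i = monomial (hidden_paths_from (vertex_order \<sigma>) (\<nu> i))"
    unfolding standard_kernel_def proj_module_eq[OF i]
    using hidden_paths_least[OF \<nu>_verts[OF i] refl] by simp
  then show ?thesis using i by (simp add: standard_module_def standard_def proj_module_eq)
qed

lemma standard_modules_eq:
  "standard_modules A n e \<sigma> = standard (vertex_order \<sigma>) ` verts Q"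
proof -
  have "standard_modules A n e \<sigma> = (\<lambda>i. standard (vertex_order \<sigma>) (\<nu> i)) ` {1..n}"
    unfolding standard_modules_def by (rule image_cong) (simp_all add: standard_module_eq)
  also have "\<dots> = standard (vertex_order \<sigma>) ` \<nu> ` {1..n}" by (simp add: image_image)
  finally show ?thesis using bij_\<nu> by (simp add: bij_betw_def)
qed

lemma qh_permutations_eq: "qh_permutations A n e = {\<sigma>. \<sigma> permutes {1..n}}"
proof -
  have "quasi_hereditary A n e \<sigma>" if "\<sigma> permutes {1..n}" for \<sigma>
    unfolding quasi_hereditary_def standard_modules_eq
  proof (intro conjI ballI)
    show "local_ring (endomorphism_ring A (standard_module A n e \<sigma> i))" if "i \<in> {1..n}" for i
      unfolding standard_module_eq[OF that] by (rule local_endomorphism_ring_standard[OF \<nu>_verts[OF that]])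
    show "has_filtration A (regular_module A) (standard (vertex_order \<sigma>) ` verts Q)"
      by (rule has_filtration_regular[OF inj_vertex_order[OF that]]) simp
  qed
  then show ?thesis by (auto simp: qh_permutations_def)
qed

lemma same_modules_iff:
  "same_modules A (standard_modules A n e \<sigma>) (standard_modules A n e \<tau>) \<longleftrightarrow>
    (\<forall>v\<in>verts Q. visible (vertex_order \<sigma>) v = visible (vertex_order \<tau>) v)"
  unfolding same_modules_def standard_modules_eq by (auto simp: standard_iso_iff)

end

section \<open>Forests\<close>

text \<open>At most one arrow ends in each vertex, and \<open>depth\<close> excludes cycles; so from a vertex there is only
  one way back, which leads to a root.\<close>

locale out_forest = wf_digraph Q for Q :: "('v, 'e) pre_digraph" +
  fixes depth :: "'v \<Rightarrow> nat"
  assumes finite_vertices: "finite (verts Q)"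
    and depth_less: "a \<in> arcs Q \<Longrightarrow> depth (tail Q a) < depth (head Q a)"
    and inj_head: "inj_on (head Q) (arcs Q)"
begin

lemma depth_awalk: "awalk u p v \<Longrightarrow> depth u \<le> depth v"
proof (induction p arbitrary: u)
  case (Cons a p)
  then show ?case using depth_less[of a] by (fastforce simp: awalk_Cons_iff)
qed (simp add: awalk_Nil_iff)

lemma awalk_snoc_iff: "awalk u (p @ [a]) v \<longleftrightarrow> a \<in> arcs Q \<and> awalk u p (tail Q a) \<and> v = head Q a"
  by (auto simp: awalk_simps dest: awlast_if_cas simp: awalk_def)

lemma walk_unique: "awalk u p v \<Longrightarrow> awalk u q v \<Longrightarrow> p = q"
proof (induction p arbitrary: v q rule: rev_induct)
  case Nil
  show ?case
  proof (cases q rule: rev_cases)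
    case (snoc r a)
    then show ?thesis
      using Nil depth_awalk[of u r "tail Q a"] depth_less[of a]
      by (auto simp: awalk_snoc_iff awalk_Nil_iff simp del: awalk_append_iff)
  qed simp
next
  case (snoc a p)
  note p = snoc.prems(1)[unfolded awalk_snoc_iff]
  show ?case
  proof (cases q rule: rev_cases)
    case Nil
    then show ?thesis
      using p snoc.prems(2) depth_awalk[of u p "tail Q a"] depth_less[of a] by (auto simp: awalk_Nil_iff)
  next
    case (snoc r b)
    have q: "b \<in> arcs Q" "awalk u r (tail Q b)" "v = head Q b"
      using snoc.prems(2) snoc by (auto simp: awalk_snoc_iff simp del: awalk_append_iff)
    then have "a = b" using p inj_head by (auto dest: inj_onD)
    then show ?thesis using snoc.IH[of "tail Q a" r] p q snoc by simp
  qed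
qed

sublocale unique_walk_quiver Q
  by unfold_locales (use finite_vertices walk_unique in auto)

lemma precedes_depth: "u \<preceq> v \<Longrightarrow> depth u \<le> depth v"
  by (auto simp: reachable_awalk dest: depth_awalk)

lemma precedes_head_iff:
  assumes "a \<in> arcs Q"
  shows "u \<preceq> head Q a \<longleftrightarrow> u = head Q a \<or> u \<preceq> tail Q a"
proof
  assume "u \<preceq> head Q a"
  then obtain p where p: "awalk u p (head Q a)" by (auto simp: reachable_awalk)
  show "u = head Q a \<or> u \<preceq> tail Q a"
  proof (cases p rule: rev_cases)
    case (snoc r b)
    then have "b = a" "awalk u r (tail Q b)"
      using p assms inj_head by (auto simp: awalk_snoc_iff simp del: awalk_append_iff dest: inj_onD)
    then show ?thesis by (auto simp: reachable_awalk)
  qed (use p in \<open>simp add: awalk_Nil_iff\<close>)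
next
  assume "u = head Q a \<or> u \<preceq> tail Q a"
  moreover have "tail Q a \<preceq> head Q a" using arc_implies_awalk[OF assms] assms
    by (auto simp: reachable_awalk arc_to_ends_def awalk_simps intro!: exI[of _ "[a]"])
  ultimately show "u \<preceq> head Q a" using assms by (auto intro: reachable_trans)
qed

definition roots :: "'v set" where
  "roots = verts Q - head Q ` arcs Q"

lemma precedes_root_iff:
  assumes "v \<in> roots"
  shows "u \<preceq> v \<longleftrightarrow> u = v"
proof
  assume "u \<preceq> v"
  then obtain p where "awalk u p v" by (auto simp: reachable_awalk)
  then show "u = v"
    using assms by (cases p rule: rev_cases)
      (auto simp: awalk_snoc_iff awalk_Nil_iff roots_def simp del: awalk_append_iff)
qed (use assms in \<open>simp add: roots_def\<close>)

lemma vertex_induct [consumes 1, case_names root arc]: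
  assumes "v \<in> verts Q"
    and root: "\<And>v. v \<in> roots \<Longrightarrow> thesis v"
    and arc: "\<And>a. a \<in> arcs Q \<Longrightarrow> thesis (tail Q a) \<Longrightarrow> thesis (head Q a)"
  shows "thesis v"
  using assms(1)
proof (induction "depth v" arbitrary: v rule: less_induct)
  case less
  show ?case
  proof (cases "v \<in> roots")
    case False
    then obtain a where "a \<in> arcs Q" "v = head Q a" using less.prems by (auto simp: roots_def)
    then show ?thesis using less.hyps[of "tail Q a"] depth_less arc by simp
  qed (rule root)
qed

lemma predecessors_chain:
  assumes "u \<preceq> w" "v \<preceq> w" shows "u \<preceq> v \<or> v \<preceq> u"
proof -
  have "w \<in> verts Q" using assms precedes_verts by blast
  then show ?thesis
    using assms
  proof (induction arbitrary: u v rule: vertex_induct)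
    case (root w)
    then show ?case by (simp add: precedes_root_iff) (auto simp: roots_def)
  next
    case (arc a)
    then show ?case by (metis precedes_head_iff)
  qed
qed

subsection \<open>Labellings\<close>

text \<open>The same relation as \<open>visible\<close>, seen from the other end: on the way back from \<open>w\<close> to the root,
  the dominators are the vertices at which \<open>\<rho>\<close> attains a new record.\<close>

definition dominators :: "('v \<Rightarrow> 'b::linorder) \<Rightarrow> 'v \<Rightarrow> 'v set" where
  "dominators \<rho> w = {u. u \<preceq> w \<and> (\<forall>k. u \<preceq> k \<longrightarrow> k \<preceq> w \<longrightarrow> \<rho> k \<le> \<rho> u)}"

definition dominator_count :: "('v \<Rightarrow> 'b::linorder) \<Rightarrow> 'v \<Rightarrow> nat" where
  "dominator_count \<rho> w = card (dominators \<rho> w - {w})"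

text \<open>The functions that occur as \<open>dominator_count\<close>: a vertex can only be dominated by itself and by the
  dominators of its parent, of which there is one more than the count of the parent.\<close>

definition labellings :: "('v \<Rightarrow> nat) set" where
  "labellings = {h. h \<in> extensional (verts Q) \<and> (\<forall>v\<in>roots. h v = 0) \<and>
     (\<forall>a\<in>arcs Q. h (head Q a) \<le> Suc (h (tail Q a)))}"

lemma finite_dominators [simp]: "finite (dominators \<rho> w)"
  by (rule finite_subset[OF _ finite_verts]) (auto simp: dominators_def dest: precedes_verts)

lemma dominators_precedes: "u \<in> dominators \<rho> w \<Longrightarrow> u \<preceq> w"
  by (simp add: dominators_def)

lemma dominators_cong:
  "(\<And>k. k \<preceq> w \<Longrightarrow> \<rho> k = \<rho>' k) \<Longrightarrow> dominators \<rho> w = dominators \<rho>' w"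
  unfolding dominators_def by (intro Collect_cong conj_cong refl all_cong imp_cong) auto

lemma dominators_root: "v \<in> roots \<Longrightarrow> dominators \<rho> v = {v}"
  by (auto simp: dominators_def precedes_root_iff)

lemma head_not_precedes_tail: "a \<in> arcs Q \<Longrightarrow> \<not> head Q a \<preceq> tail Q a"
  using precedes_depth[of "head Q a" "tail Q a"] depth_less[of a] by auto

lemma dominators_head:
  assumes a: "a \<in> arcs Q" and inj: "inj_on \<rho> {u. u \<preceq> head Q a}"
  shows "dominators \<rho> (head Q a) = insert (head Q a) {u \<in> dominators \<rho> (tail Q a). \<rho> (head Q a) < \<rho> u}"
proof -
  note prec = precedes_head_iff[OF a]
  have self: "head Q a \<preceq> k \<and> k \<preceq> head Q a \<longleftrightarrow> k = head Q a" for k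
    using a by (auto dest: precedes_antisym)
  have iff: "u \<in> dominators \<rho> (head Q a) \<longleftrightarrow> u \<in> dominators \<rho> (tail Q a) \<and> \<rho> (head Q a) < \<rho> u"
    if u: "u \<noteq> head Q a" for u
  proof
    assume dom: "u \<in> dominators \<rho> (head Q a)"
    then have tail: "u \<preceq> tail Q a" using u prec by (auto simp: dominators_def)
    moreover have "\<rho> (head Q a) \<le> \<rho> u" using dom a by (auto simp: dominators_def)
    moreover have "\<rho> (head Q a) \<noteq> \<rho> u" using inj u tail a prec by (auto dest!: inj_onD)
    ultimately show "u \<in> dominators \<rho> (tail Q a) \<and> \<rho> (head Q a) < \<rho> u"
      using dom by (auto simp: dominators_def prec)
  next
    assume "u \<in> dominators \<rho> (tail Q a) \<and> \<rho> (head Q a) < \<rho> u"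
    then show "u \<in> dominators \<rho> (head Q a)" by (auto simp: dominators_def prec)
  qed
  have "\<rho> k \<le> \<rho> (head Q a)" if "head Q a \<preceq> k" "k \<preceq> head Q a" for k
    using self[of k] that by simp
  then have mem: "head Q a \<in> dominators \<rho> (head Q a)" using a by (simp add: dominators_def)
  show ?thesis
  proof (rule Set.set_eqI)
    fix u show "u \<in> dominators \<rho> (head Q a) \<longleftrightarrow>
        u \<in> insert (head Q a) {u \<in> dominators \<rho> (tail Q a). \<rho> (head Q a) < \<rho> u}"
      using mem iff[of u] by (cases "u = head Q a") simp_all
  qed
qed

lemma dominators_self: "w \<in> verts Q \<Longrightarrow> w \<in> dominators \<rho> w"
  by (auto simp: dominators_def dest: precedes_antisym)

lemma card_dominators: "w \<in> verts Q \<Longrightarrow> card (dominators \<rho> w) = Suc (dominator_count \<rho> w)"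
  unfolding dominator_count_def
  by (rule card_Suc_Diff1[symmetric]) (simp_all add: dominators_self)

lemma dominator_count_head:
  assumes a: "a \<in> arcs Q" and inj: "inj_on \<rho> {u. u \<preceq> head Q a}"
  shows "dominator_count \<rho> (head Q a) = card {u \<in> dominators \<rho> (tail Q a). \<rho> (head Q a) < \<rho> u}"
  unfolding dominator_count_def dominators_head[OF assms]
  using head_not_precedes_tail[OF a] by (intro arg_cong[of _ _ card]) (auto dest: dominators_precedes)

lemma dominator_count_labelling:
  assumes inj: "inj_on \<rho> (verts Q)"
  shows "restrict (dominator_count \<rho>) (verts Q) \<in> labellings"
proof -
  have "dominator_count \<rho> (head Q a) \<le> Suc (dominator_count \<rho> (tail Q a))" if a: "a \<in> arcs Q" for a
  proof -
    have "inj_on \<rho> {u. u \<preceq> head Q a}" by (rule inj_on_subset[OF inj]) (auto dest: precedes_verts)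
    then have "dominator_count \<rho> (head Q a) \<le> card (dominators \<rho> (tail Q a))"
      by (simp add: dominator_count_head[OF a] card_mono)
    then show ?thesis using a by (simp add: card_dominators)
  qed
  moreover have "dominator_count \<rho> v = 0" if "v \<in> roots" for v
    using dominators_root[OF that, of \<rho>] by (simp add: dominator_count_def)
  ultimately show ?thesis by (auto simp: labellings_def roots_def)
qed

text \<open>Read from the root on, \<open>\<rho>\<close> decreases along the dominators of the tail of an arrow. So those of
  them which also dominate the head are the ones closest to the root, and their number determines
  them.\<close>

lemma dominators_determined:
  fixes \<rho> :: "'v \<Rightarrow> 'b::linorder" and \<rho>' :: "'v \<Rightarrow> 'c::linorder"
  assumes inj: "inj_on \<rho> (verts Q)" "inj_on \<rho>' (verts Q)"
    and eq: "\<And>v. v \<in> verts Q \<Longrightarrow> dominator_count \<rho> v = dominator_count \<rho>' v"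
    and v: "v \<in> verts Q"
  shows "dominators \<rho> v = dominators \<rho>' v"
  using v
proof (induction rule: vertex_induct)
  case (root v)
  then show ?case by (simp add: dominators_root)
next
  case (arc a)
  let ?h = "head Q a" and ?D = "dominators \<rho> (tail Q a)"
  have inj': "inj_on \<rho> {u. u \<preceq> ?h}" "inj_on \<rho>' {u. u \<preceq> ?h}"
    by (rule inj_on_subset[OF inj(1)] inj_on_subset[OF inj(2)]; auto dest: precedes_verts)+
  let ?B = "{u \<in> ?D. \<rho> ?h < \<rho> u}" and ?B' = "{u \<in> ?D. \<rho>' ?h < \<rho>' u}"
  have D': "?D = dominators \<rho>' (tail Q a)" by (rule arc.IH)
  have card: "card ?B = card ?B'"
    using eq[of ?h] arc.hyps dominator_count_head[OF arc.hyps inj'(1)] dominator_count_head[OF arc.hyps inj'(2)]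
    by (simp flip: D')
  have up: "w \<in> ?B" if "u \<in> ?B" "w \<in> ?D" "w \<preceq> u" for u w
    using that by (auto simp: dominators_def intro: less_le_trans)
  have up': "w \<in> ?B'" if "u \<in> ?B'" "w \<in> ?D" "w \<preceq> u" for u w
    using that unfolding D' by (auto simp: dominators_def intro: less_le_trans)
  have "?B \<subseteq> ?B' \<or> ?B' \<subseteq> ?B"
  proof (rule ccontr)
    assume "\<not> ?thesis"
    then obtain u w where uw: "u \<in> ?B" "u \<notin> ?B'" "w \<in> ?B'" "w \<notin> ?B" by blast
    then have "u \<preceq> tail Q a" "w \<preceq> tail Q a" by (auto dest: dominators_precedes)
    then consider "u \<preceq> w" | "w \<preceq> u" using predecessors_chain by blast
    then show False using up[of u w] up'[of w u] uw by cases blast+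
  qed
  then have "?B = ?B'"
    using card card_subset_eq[of ?B' ?B] card_subset_eq[of ?B ?B'] by auto
  then show ?case
    using dominators_head[OF arc.hyps inj'(1)] dominators_head[OF arc.hyps inj'(2)] by (simp flip: D')
qed

end

text \<open>The \<open>k\<close> largest elements of \<open>B\<close> form a set \<open>U\<close>, and every \<open>x\<close> in the gap between \<open>B - U\<close> and
  \<open>U\<close> has \<open>k\<close> elements above it; the gap is infinite, so it is not exhausted by \<open>F\<close>.\<close>

lemma exists_real_with_card_above:
  fixes B F :: "real set"
  assumes "finite B" "finite F" "k \<le> card B"
  shows "\<exists>x. x \<notin> F \<and> card {y \<in> B. x < y} = k"
proof -
  have "\<exists>U\<subseteq>B. card U = k \<and> (\<forall>u\<in>U. \<forall>y\<in>B - U. y < u)"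
    using assms(3)
  proof (induction k)
    case 0
    then show ?case by (intro exI[of _ "{}"]) auto
  next
    case (Suc k)
    then obtain U where U: "U \<subseteq> B" "card U = k" "\<forall>u\<in>U. \<forall>y\<in>B - U. y < u" by auto
    have finU: "finite U" using U(1) assms(1) finite_subset by blast
    have ne: "B - U \<noteq> {}" using Suc.prems U by (metis Diff_eq_empty_iff Suc_n_not_le_n subset_antisym)
    let ?m = "Max (B - U)"
    have m: "?m \<in> B - U" "\<And>y. y \<in> B - U \<Longrightarrow> y \<le> ?m"
      using ne assms(1) by (auto intro: Max_in simp del: Diff_iff)
    have "card (insert ?m U) = Suc k" using m(1) finU U(2) by simp
    moreover have "y < u" if "u \<in> insert ?m U" "y \<in> B - insert ?m U" for u y
      using that U(3) m(2)[of y] by (cases "u = ?m") (auto simp: less_le)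
    ultimately show ?case using U(1) m(1) by (intro exI[of _ "insert ?m U"]) auto
  qed
  then obtain U where U: "U \<subseteq> B" "card U = k" "\<forall>u\<in>U. \<forall>y\<in>B - U. y < u" by blast
  have finU: "finite U" using U(1) assms(1) finite_subset by blast
  \<comment> \<open>the additional elements take care of the cases that \<open>U\<close> or \<open>B - U\<close> is empty\<close>
  define b where "b = Min (insert (Max (insert 0 B) + 1) U)"
  define a where "a = Max (insert (b - 1) (B - U))"
  have "y < Max (insert 0 B) + 1" if "y \<in> B" for y
  proof -
    have "y \<le> Max (insert 0 B)" using that assms(1) by (intro Max_ge) auto
    then show ?thesis by simp
  qed
  then have "y < b" if "y \<in> B - U" for y
    unfolding b_def using that U finU by (subst Min_gr_iff) auto
  then have "a < b" unfolding a_def using assms(1) by (subst Max_less_iff) auto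
  then have "infinite ({a<..<b} - F)" using assms(2) by (simp add: Diff_infinite_finite)
  then obtain x where "x \<in> {a<..<b} - F" using infinite_imp_nonempty by blast
  then have x: "a < x" "x < b" "x \<notin> F" by auto
  have "{y \<in> B. x < y} = U"
  proof -
    have "x < u" if "u \<in> U" for u
      using x(2) that finU Min_le[of "insert (Max (insert 0 B) + 1) U" u] by (auto simp: b_def)
    moreover have "y \<le> x" if y: "y \<in> B - U" for y
    proof -
      have "y \<le> a" unfolding a_def by (rule Max_ge) (use y assms(1) in auto)
      then show ?thesis using x(1) by simp
    qed
    ultimately show ?thesis using U(1) by (auto simp: not_less[symmetric])
  qed
  then show ?thesis using U(2) x(3) by blast
qed

context out_forest
begin

text \<open>The vertices are inserted into the order one by one, starting at the roots. The value of a new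
  vertex \<open>w\<close> is only constrained by the number \<open>h w\<close> of dominators of its parent that it has to
  stay below, and it does not affect the vertices inserted before, none of which \<open>w\<close> precedes.\<close>

lemma labelling_realized:
  assumes h: "h \<in> labellings"
  shows "\<exists>\<rho> :: 'v \<Rightarrow> real. inj_on \<rho> (verts Q) \<and> (\<forall>v\<in>verts Q. dominator_count \<rho> v = h v)"
proof -
  have "\<lbrakk>W \<subseteq> verts Q; \<And>u v. v \<in> W \<Longrightarrow> u \<preceq> v \<Longrightarrow> u \<in> W\<rbrakk> \<Longrightarrow>
      \<exists>\<rho> :: 'v \<Rightarrow> real. inj_on \<rho> W \<and> (\<forall>v\<in>W. dominator_count \<rho> v = h v)" for W
  proof (induction "card W" arbitrary: W)
    case 0
    then have "W = {}" using finite_verts finite_subset by (metis card_eq_0_iff)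
    then show ?case by simp
  next
    case (Suc m)
    have finW: "finite W" using Suc.prems(1) finite_verts finite_subset by blast
    have "W \<noteq> {}" using Suc.hyps(2) by auto
    then have "Max (depth ` W) \<in> depth ` W" using finW by (intro Max_in) auto
    then obtain w where "w \<in> W" "depth w = Max (depth ` W)" by auto
    then have w: "w \<in> W" "\<And>v. v \<in> W \<Longrightarrow> depth v \<le> depth w" using finW by auto
    have wv: "w \<in> verts Q" using w Suc.prems by blast
    let ?W = "W - {w}"
    have not_above: "\<not> w \<preceq> v" if v: "v \<in> ?W" for v
    proof
      assume "w \<preceq> v"
      then have "v \<noteq> w" "v \<in> verts Q" "depth v \<le> depth w" using v w(2) precedes_verts by auto
      have "depth w < depth v"
        using \<open>v \<in> verts Q\<close> \<open>w \<preceq> v\<close> \<open>v \<noteq> w\<close>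
      proof (cases "v \<in> roots")
        case False
        then obtain a where a: "a \<in> arcs Q" "v = head Q a" using \<open>v \<in> verts Q\<close> by (auto simp: roots_def)
        then have "w \<preceq> tail Q a" using \<open>w \<preceq> v\<close> \<open>v \<noteq> w\<close> precedes_head_iff by auto
        then show ?thesis using precedes_depth[of w "tail Q a"] depth_less[OF a(1)] a by simp
      qed (simp add: precedes_root_iff)
      then show False using \<open>depth v \<le> depth w\<close> by simp
    qed
    have "m = card ?W" using Suc.hyps(2) w(1) finW by simp
    moreover have "u \<in> ?W" if "v \<in> ?W" "u \<preceq> v" for u v
      using Suc.prems(2)[of v u] that not_above[of v] by auto
    ultimately obtain \<rho> :: "'v \<Rightarrow> real" where \<rho>: "inj_on \<rho> ?W" "\<And>v. v \<in> ?W \<Longrightarrow> dominator_count \<rho> v = h v"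
      using Suc.hyps(1)[of ?W] Suc.prems(1) by blast
    have "\<exists>x. x \<notin> \<rho> ` ?W \<and> dominator_count (\<rho>(w := x)) w = h w"
    proof (cases "w \<in> roots")
      case True
      obtain x where "x \<notin> \<rho> ` ?W" using finW ex_new_if_finite[OF infinite_UNIV_char_0, of "\<rho> ` ?W"] by auto
      moreover have "dominator_count (\<rho>(w := x)) w = h w"
        using True h dominators_root[OF True, of "\<rho>(w := x)"] by (simp add: dominator_count_def labellings_def)
      ultimately show ?thesis by blast
    next
      case False
      then obtain a where a: "a \<in> arcs Q" "w = head Q a" using wv by (auto simp: roots_def)
      let ?D = "dominators \<rho> (tail Q a)"
      have tail: "tail Q a \<in> ?W" "\<And>u. u \<preceq> tail Q a \<Longrightarrow> u \<in> ?W"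
      proof -
        show W: "u \<in> ?W" if "u \<preceq> tail Q a" for u
        proof -
          have "u \<preceq> w" using that a precedes_head_iff by blast
          moreover have "u \<noteq> w" using that head_not_precedes_tail a by auto
          ultimately show ?thesis using Suc.prems(2) w(1) by blast
        qed
        then show "tail Q a \<in> ?W" using a by simp
      qed
      have inj: "inj_on \<rho> ?D" by (rule inj_on_subset[OF \<rho>(1)]) (use tail(2) dominators_precedes in blast)
      have "h w \<le> Suc (h (tail Q a))" using h a by (auto simp: labellings_def)
      also have "\<dots> = card (\<rho> ` ?D)" using \<rho>(2)[OF tail(1)] a inj by (simp add: card_image card_dominators)
      finally obtain x where x: "x \<notin> \<rho> ` ?W" "card {y \<in> \<rho> ` ?D. x < y} = h w"
        using exists_real_with_card_above[of "\<rho> ` ?D" "\<rho> ` ?W" "h w"] finW by auto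
      let ?\<rho> = "\<rho>(w := x)"
      have "inj_on ?\<rho> {u. u \<preceq> head Q a}"
      proof (rule inj_on_subset)
        show "inj_on ?\<rho> W" using \<rho>(1) x(1) by (auto simp: inj_on_def)
        show "{u. u \<preceq> head Q a} \<subseteq> W" using Suc.prems(2) w(1) a by blast
      qed
      then have "dominator_count ?\<rho> w = card {u \<in> dominators ?\<rho> (tail Q a). ?\<rho> w < ?\<rho> u}"
        using dominator_count_head[OF a(1), of ?\<rho>] unfolding a(2)[symmetric] by blast
      also have "dominators ?\<rho> (tail Q a) = ?D" by (rule dominators_cong) (use tail(2) in auto)
      also have "{u \<in> ?D. ?\<rho> w < ?\<rho> u} = {u \<in> ?D. x < \<rho> u}"
        using tail(2) by (auto dest: dominators_precedes)
      also have "card \<dots> = card (\<rho> ` {u \<in> ?D. x < \<rho> u})"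
        by (rule card_image[symmetric]) (rule inj_on_subset[OF inj], auto)
      also have "\<rho> ` {u \<in> ?D. x < \<rho> u} = {y \<in> \<rho> ` ?D. x < y}" by auto
      finally show ?thesis using x by (metis (no_types, lifting))
    qed
    then obtain x where x: "x \<notin> \<rho> ` ?W" "dominator_count (\<rho>(w := x)) w = h w" by blast
    have "dominator_count (\<rho>(w := x)) v = h v" if v: "v \<in> W" for v
    proof (cases "v = w")
      case False
      then have "k \<noteq> w" if "k \<preceq> v" for k using not_above[of v] that v by auto
      then have "dominators (\<rho>(w := x)) v = dominators \<rho> v" by (intro dominators_cong) auto
      then show ?thesis using \<rho>(2)[of v] v False by (simp add: dominator_count_def)
    qed (use x in simp)
    moreover have "inj_on (\<rho>(w := x)) W" using \<rho>(1) x(1) by (auto simp: inj_on_def)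
    ultimately show ?case by blast
  qed
  from this[of "verts Q"] show ?thesis by (auto dest: precedes_verts)
qed

end

text \<open>The permutation sends \<open>i\<close> to the rank of \<open>g i\<close> among the values of \<open>g\<close>.\<close>

lemma exists_permutation_same_order:
  fixes g :: "nat \<Rightarrow> real"
  assumes "inj_on g {1..n}"
  obtains \<sigma> where "\<sigma> permutes {1..n}"
    "\<And>i j. i \<in> {1..n} \<Longrightarrow> j \<in> {1..n} \<Longrightarrow> \<sigma> i \<le> \<sigma> j \<longleftrightarrow> g i \<le> g j"
proof -
  define r where "r i = card {j \<in> {1..n}. g j \<le> g i}" for i
  define \<sigma> where "\<sigma> i = (if i \<in> {1..n} then r i else i)" for i
  have mono: "r i < r j" if "i \<in> {1..n}" "j \<in> {1..n}" "g i < g j" for i j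
  proof -
    have "j \<in> {j' \<in> {1..n}. g j' \<le> g j} - {j' \<in> {1..n}. g j' \<le> g i}" using that by simp
    then have "{j' \<in> {1..n}. g j' \<le> g i} \<subset> {j' \<in> {1..n}. g j' \<le> g j}" using that by fastforce
    then show ?thesis unfolding r_def by (rule psubset_card_mono[rotated]) simp
  qed
  have iff: "r i \<le> r j \<longleftrightarrow> g i \<le> g j" if "i \<in> {1..n}" "j \<in> {1..n}" for i j
    using mono[of i j] mono[of j i] that inj_onD[OF assms, of i j]
    by (cases "g i" "g j" rule: linorder_cases) auto
  have "inj_on r {1..n}"
    using iff assms by (intro inj_onI) (metis inj_onD order_antisym order_refl)
  moreover have "r ` {1..n} \<subseteq> {1..n}"
  proof
    fix x assume "x \<in> r ` {1..n}"
    then obtain i where i: "i \<in> {1..n}" "x = r i" by blast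
    have "r i \<le> card {1..n}" unfolding r_def by (rule card_mono) auto
    moreover have "r i > 0" unfolding r_def using i by (subst card_gt_0_iff) auto
    ultimately show "x \<in> {1..n}" using i by simp
  qed
  ultimately have "bij_betw r {1..n} {1..n}" by (simp add: bij_betw_def endo_inj_surj)
  then have "bij_betw \<sigma> {1..n} {1..n}" using bij_betw_cong[of "{1..n}" \<sigma> r "{1..n}"] by (simp add: \<sigma>_def)
  then have "\<sigma> permutes {1..n}" by (rule bij_imp_permutes) (auto simp: \<sigma>_def)
  then show ?thesis using that iff by (simp add: \<sigma>_def)
qed

locale numbered_forest = out_forest Q depth + numbered_quiver Q K \<nu>
  for Q :: "('v, 'e) pre_digraph" and depth :: "'v \<Rightarrow> nat" and K :: "'k::field itself" and \<nu> :: "nat \<Rightarrow> 'v"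
begin

text \<open>Two permutations are equivalent if and only if they have the same dominators, that is, the same
  numbers of dominators; and the labellings are the numbers that occur.\<close>

lemma qh_number_eq_labellings: "qh_number K Q \<nu> = card labellings"
proof -
  let ?P = "{\<sigma>. \<sigma> permutes {1..n}}"
  let ?F = "\<lambda>\<sigma>. restrict (dominator_count (vertex_order \<sigma>)) (verts Q)"
  have same: "(\<forall>v\<in>verts Q. visible (vertex_order \<sigma>) v = visible (vertex_order \<tau>) v) \<longleftrightarrow> ?F \<sigma> = ?F \<tau>"
    if "\<sigma> \<in> ?P" "\<tau> \<in> ?P" for \<sigma> \<tau>
  proof -
    have dual: "u \<in> dominators \<rho> w \<longleftrightarrow> w \<in> visible \<rho> u" for u w and \<rho> :: "'v \<Rightarrow> nat"
      by (auto simp: dominators_def visible_def)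
    have "(\<forall>v\<in>verts Q. visible (vertex_order \<sigma>) v = visible (vertex_order \<tau>) v) \<longleftrightarrow>
        (\<forall>v\<in>verts Q. dominators (vertex_order \<sigma>) v = dominators (vertex_order \<tau>) v)"
      using visible_precedes dominators_precedes precedes_verts unfolding set_eq_iff dual by metis
    also have "\<dots> \<longleftrightarrow> (\<forall>v\<in>verts Q. dominator_count (vertex_order \<sigma>) v = dominator_count (vertex_order \<tau>) v)"
    proof
      assume eq: "\<forall>v\<in>verts Q. dominator_count (vertex_order \<sigma>) v = dominator_count (vertex_order \<tau>) v"
      show "\<forall>v\<in>verts Q. dominators (vertex_order \<sigma>) v = dominators (vertex_order \<tau>) v"
        by (intro ballI dominators_determined) (use inj_vertex_order that eq in auto)
    qed (simp add: dominator_count_def)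
    also have "\<dots> \<longleftrightarrow> ?F \<sigma> = ?F \<tau>" by (auto simp: fun_eq_iff restrict_def)
    finally show ?thesis .
  qed
  have "qh_equivalence A n e = {(\<sigma>, \<tau>). \<sigma> \<in> ?P \<and> \<tau> \<in> ?P \<and> ?F \<sigma> = ?F \<tau>}"
    unfolding qh_equivalence_def qh_permutations_eq same_modules_iff using same by blast
  then have "qh_number K Q \<nu> = card (?P // {(\<sigma>, \<tau>). \<sigma> \<in> ?P \<and> \<tau> \<in> ?P \<and> ?F \<sigma> = ?F \<tau>})"
    by (simp add: qh_number_def qh_str_def qh_permutations_eq)
  also have "\<dots> = card (?F ` ?P)" by (rule card_quotient_kernel)
  also have "?F ` ?P = labellings"
  proof
    show "?F ` ?P \<subseteq> labellings" using dominator_count_labelling inj_vertex_order by blast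
    show "labellings \<subseteq> ?F ` ?P"
    proof
      fix h assume h: "h \<in> labellings"
      then obtain \<rho> :: "'v \<Rightarrow> real" where \<rho>: "inj_on \<rho> (verts Q)" "\<forall>v\<in>verts Q. dominator_count \<rho> v = h v"
        using labelling_realized by blast
      have "inj_on (\<rho> \<circ> \<nu>) {1..n}" using \<rho>(1) bij_\<nu> by (auto simp: bij_betw_def intro: comp_inj_on)
      then obtain \<sigma> where \<sigma>: "\<sigma> permutes {1..n}"
        "\<And>i j. i \<in> {1..n} \<Longrightarrow> j \<in> {1..n} \<Longrightarrow> \<sigma> i \<le> \<sigma> j \<longleftrightarrow> \<rho> (\<nu> i) \<le> \<rho> (\<nu> j)"
        by (rule exists_permutation_same_order) auto
      have "vertex_order \<sigma> u \<le> vertex_order \<sigma> v \<longleftrightarrow> \<rho> u \<le> \<rho> v" if "u \<in> verts Q" "v \<in> verts Q" for u v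
        using that by (auto elim!: verts_cases simp: vertex_order_\<nu> \<sigma>(2) simp del: atLeastAtMost_iff)
      then have "dominators (vertex_order \<sigma>) v = dominators \<rho> v" for v
        unfolding dominators_def by (auto dest: precedes_verts)
      then have "?F \<sigma> = h"
        using \<rho>(2) h by (auto simp: dominator_count_def labellings_def extensional_def)
      then show "h \<in> ?F ` ?P" using \<sigma>(1) by blast
    qed
  qed
  finally show ?thesis .
qed

end


section \<open>Counting the labellings\<close>

text \<open>The labels along a branch of \<open>t\<close> vertices which is attached to a vertex with label \<open>k\<close>.\<close>

fun walks :: "nat \<Rightarrow> nat \<Rightarrow> nat list set" where
  "walks k 0 = {[]}"
| "walks k (Suc t) = (\<Union>j\<le>Suc k. (#) j ` walks j t)"

lemma finite_walks [simp]: "finite (walks k t)"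
  by (induction k t rule: walks.induct) auto

lemma walks_iff:
  "w \<in> walks k t \<longleftrightarrow> length w = t \<and> (\<forall>i<t. w ! i \<le> Suc ((k # w) ! i))"
proof (induction t arbitrary: k w)
  case (Suc t)
  show ?case
  proof (cases w)
    case (Cons j v)
    have "w \<in> walks k (Suc t) \<longleftrightarrow> j \<le> Suc k \<and> v \<in> walks j t" by (auto simp: Cons)
    also have "\<dots> \<longleftrightarrow> length w = Suc t \<and> (\<forall>i<Suc t. w ! i \<le> Suc ((k # w) ! i))"
      by (auto simp: Suc.IH Cons All_less_Suc2)
    finally show ?thesis .
  qed auto
qed auto

text \<open>The transfer operator of these walks: a vertex below one with label \<open>k\<close> has one of the labels
  \<open>0, \<dots>, k + 1\<close>.\<close>

definition step :: "(nat \<Rightarrow> real) \<Rightarrow> nat \<Rightarrow> real" where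
  "step f k = (\<Sum>j\<le>Suc k. f j)"

lemma sum_walks: "(\<Sum>w\<in>walks k t. f (last (k # w))) = (step ^^ t) f k"
proof (induction t arbitrary: k)
  case (Suc t)
  have "(\<Sum>w\<in>walks k (Suc t). f (last (k # w))) =
      (\<Sum>j\<le>Suc k. \<Sum>w\<in>(#) j ` walks j t. f (last (k # w)))"
    unfolding walks.simps by (rule sum.UNION_disjoint) auto
  also have "\<dots> = (\<Sum>j\<le>Suc k. \<Sum>w\<in>walks j t. f (last (j # w)))"
    by (rule sum.cong[OF refl]) (simp add: sum.reindex)
  also have "\<dots> = step ((step ^^ t) f) k" by (simp only: Suc.IH step_def[of "(step ^^ t) f"])
  finally show ?case by simp
qed simp

definition walk_number :: "nat \<Rightarrow> nat \<Rightarrow> real" where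
  "walk_number t = (step ^^ t) (\<lambda>_. 1)"

lemma card_walks: "real (card (walks k t)) = walk_number t k"
  using sum_walks[of "\<lambda>_. 1" k t] by (simp add: walk_number_def)

definition quiver_depth :: "nat \<Rightarrow> vertex \<Rightarrow> nat" where
  "quiver_depth s v = (case v of VA i \<Rightarrow> s - i | VB j \<Rightarrow> s + j | VB' j \<Rightarrow> s + j)"

lemma quiver_simps [simp]:
  "verts (quiver s t u) = VA ` {0..s} \<union> VB ` {1..t} \<union> VB' ` {1..u}"
  "arcs (quiver s t u) = quiver_arrows s t u" "tail (quiver s t u) = fst" "head (quiver s t u) = snd"
  by (simp_all add: quiver_def)

lemma out_forest_quiver: "out_forest (quiver s t u) (quiver_depth s)"
proof
  show "inj_on (head (quiver s t u)) (arcs (quiver s t u))"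
    by (auto simp: quiver_arrows_def inj_on_def split: if_splits)
qed (auto simp: quiver_arrows_def quiver_depth_def split: if_splits)

lemma labellings_quiver:
  "out_forest.labellings (quiver s t u) = {h \<in> extensional (verts (quiver s t u)). h (VA s) = 0 \<and>
     (\<forall>i<s. h (VA i) \<le> Suc (h (VA (Suc i)))) \<and>
     (\<forall>j<t. h (VB (Suc j)) \<le> Suc (if j = 0 then h (VA 0) else h (VB j))) \<and>
     (\<forall>j<u. h (VB' (Suc j)) \<le> Suc (if j = 0 then h (VA 0) else h (VB' j)))}"
proof -
  interpret out_forest "quiver s t u" "quiver_depth s" by (rule out_forest_quiver)
  have arrows: "quiver_arrows s t u = (\<lambda>i. (VA (Suc i), VA i)) ` {..<s} \<union>
      (\<lambda>j. (if j = 0 then VA 0 else VB j, VB (Suc j))) ` {..<t} \<union>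
      (\<lambda>j. (if j = 0 then VA 0 else VB' j, VB' (Suc j))) ` {..<u}" (is "_ = ?r")
  proof
    show "quiver_arrows s t u \<subseteq> ?r"
    proof
      fix x assume "x \<in> quiver_arrows s t u"
      then consider (a) i where "x = (VA i, VA (i - 1))" "1 \<le> i" "i \<le> s"
        | (b0) "x = (VA 0, VB 1)" "t \<ge> 1" | (b) j where "x = (VB j, VB (j + 1))" "1 \<le> j" "j + 1 \<le> t"
        | (c0) "x = (VA 0, VB' 1)" "u \<ge> 1" | (c) j where "x = (VB' j, VB' (j + 1))" "1 \<le> j" "j + 1 \<le> u"
        unfolding quiver_arrows_def by (auto split: if_splits)
      then show "x \<in> ?r"
      proof cases
        case (a i)
        then show ?thesis by (intro UnI1 image_eqI[of _ _ "i - 1"]) auto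
      next
        case b0
        then show ?thesis by (intro UnI1 UnI2 image_eqI[of _ _ 0]) auto
      next
        case (b j)
        then show ?thesis by (intro UnI1 UnI2 image_eqI[of _ _ j]) auto
      next
        case c0
        then show ?thesis by (intro UnI2 image_eqI[of _ _ 0]) auto
      next
        case (c j)
        then show ?thesis by (intro UnI2 image_eqI[of _ _ j]) auto
      qed
    qed
    show "?r \<subseteq> quiver_arrows s t u" unfolding quiver_arrows_def by (auto split: if_splits)
  qed
  have "head (quiver s t u) ` arcs (quiver s t u) = VA ` {..<s} \<union> VB ` Suc ` {..<t} \<union> VB' ` Suc ` {..<u}"
    by (simp add: arrows image_Un image_image)
  then have "roots = {VA s}"
    unfolding roots_def by (auto simp: image_Suc_lessThan)
  then show ?thesis
    unfolding labellings_def by (simp add: arrows ball_Un if_distrib[of h for h] cong: if_cong) (auto 0 3)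
qed

text \<open>The root \<open>a\<^sub>s\<close> has label \<open>0\<close>, and the labels of the other \<open>s\<close> vertices of the stem form a
  walk \<open>p\<close> from \<open>0\<close>. Its last element, or \<open>0\<close> if \<open>s = 0\<close>, is the label of \<open>a\<^sub>0\<close>; this is the
  only value that the two branches share, so they contribute independent factors.\<close>

lemma card_labellings_quiver:
  "real (card (out_forest.labellings (quiver s t u))) =
    (step ^^ s) (\<lambda>k. walk_number t k * walk_number u k) 0"
proof -
  let ?V = "verts (quiver s t u)" and ?L = "out_forest.labellings (quiver s t u)"
  let ?W = "SIGMA p:walks 0 s. walks (last (0 # p)) t \<times> walks (last (0 # p)) u"
  define f :: "(vertex \<Rightarrow> nat) \<Rightarrow> nat list \<times> nat list \<times> nat list" where
    "f h = (map (\<lambda>i. h (VA (s - Suc i))) [0..<s], map (\<lambda>j. h (VB (Suc j))) [0..<t],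
       map (\<lambda>j. h (VB' (Suc j))) [0..<u])" for h
  define g :: "nat list \<times> nat list \<times> nat list \<Rightarrow> vertex \<Rightarrow> nat" where
    "g = (\<lambda>(p, q, r). \<lambda>v\<in>?V. case v of VA i \<Rightarrow> (0 # p) ! (s - i) | VB j \<Rightarrow> q ! (j - 1) | VB' j \<Rightarrow> r ! (j - 1))"
  have last: "last (0 # p) = (0 # p) ! s" if "length p = s" for p :: "nat list"
    using that last_conv_nth[of "0 # p"] by simp
  have "bij_betw f ?L ?W"
  proof (rule bij_betw_byWitness[where f' = g])
    show "\<forall>h\<in>?L. g (f h) = h"
    proof
      fix h assume "h \<in> ?L"
      then have h: "h \<in> extensional ?V" "h (VA s) = 0" by (auto simp: labellings_quiver)
      show "g (f h) = h"
      proof (rule extensionalityI[of _ ?V])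
        show "g (f h) \<in> extensional ?V" by (simp add: g_def f_def)
        fix v assume "v \<in> ?V"
        then show "g (f h) v = h v" using h(2)
          by (auto simp: g_def f_def nth_Cons split: nat.split intro!: arg_cong[of _ _ h])
      qed (rule h(1))
    qed
    show "\<forall>w\<in>?W. f (g w) = w"
    proof
      fix w assume "w \<in> ?W"
      then obtain p q r where w: "w = (p, q, r)" "length p = s" "length q = t" "length r = u"
        by (auto simp: walks_iff)
      show "f (g w) = w"
        using w(2-4) by (auto simp: w(1) f_def g_def intro!: nth_equalityI)
    qed
    show "f ` ?L \<subseteq> ?W"
    proof
      fix w assume "w \<in> f ` ?L"
      then obtain h where h: "h \<in> ?L" "w = f h" by blast
      define p where "p = map (\<lambda>i. h (VA (s - Suc i))) [0..<s]"
      have p: "(0 # p) ! i = h (VA (s - i))" if "i \<le> s" for i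
        using that h(1) by (auto simp: p_def nth_Cons labellings_quiver split: nat.split)
      have "p \<in> walks 0 s"
        unfolding walks_iff
      proof (intro conjI allI impI)
        show "length p = s" by (simp add: p_def)
        fix i assume i: "i < s"
        then have "h (VA (s - Suc i)) \<le> Suc (h (VA (Suc (s - Suc i))))" using h(1) by (simp add: labellings_quiver)
        then show "p ! i \<le> Suc ((0 # p) ! i)" using i p[of i] by (simp add: p_def Suc_diff_Suc)
      qed
      moreover have "last (0 # p) = h (VA 0)" using last[of p] p[of s] by (simp add: p_def)
      moreover have "map (\<lambda>j. h (VB (Suc j))) [0..<t] \<in> walks (h (VA 0)) t"
        "map (\<lambda>j. h (VB' (Suc j))) [0..<u] \<in> walks (h (VA 0)) u"
        using h(1) by (auto simp: walks_iff labellings_quiver nth_Cons split: nat.split)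
      ultimately show "w \<in> ?W" using h(2) by (simp add: f_def p_def)
    qed
    show "g ` ?W \<subseteq> ?L"
    proof
      fix h assume "h \<in> g ` ?W"
      then obtain p q r where h: "h = g (p, q, r)" and p: "length p = s" "\<And>i. i < s \<Longrightarrow> p ! i \<le> Suc ((0 # p) ! i)"
        and q: "length q = t" "\<And>i. i < t \<Longrightarrow> q ! i \<le> Suc ((last (0 # p) # q) ! i)"
        and r: "length r = u" "\<And>i. i < u \<Longrightarrow> r ! i \<le> Suc ((last (0 # p) # r) ! i)"
        unfolding image_iff Bex_def by (auto simp: walks_iff simp del: last.simps)
      have "h (VA i) \<le> Suc (h (VA (Suc i)))" if "i < s" for i
        using p(2)[of "s - Suc i"] that by (auto simp: h g_def nth_Cons Suc_diff_Suc[symmetric] split: nat.split)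
      moreover have "h (VB (Suc j)) \<le> Suc (if j = 0 then h (VA 0) else h (VB j))" if "j < t" for j
        using q(2)[OF that] that unfolding last[OF p(1)] by (cases j) (simp_all add: h g_def)
      moreover have "h (VB' (Suc j)) \<le> Suc (if j = 0 then h (VA 0) else h (VB' j))" if "j < u" for j
        using r(2)[OF that] that unfolding last[OF p(1)] by (cases j) (simp_all add: h g_def)
      ultimately show "h \<in> ?L" by (simp add: labellings_quiver) (simp add: h g_def)
    qed
  qed
  then have "card ?L = card ?W" by (rule bij_betw_same_card)
  also have "\<dots> = (\<Sum>p\<in>walks 0 s. card (walks (last (0 # p)) t) * card (walks (last (0 # p)) u))"
    by (simp add: card_SigmaI card_cartesian_product)
  also have "real \<dots> = (\<Sum>p\<in>walks 0 s. walk_number t (last (0 # p)) * walk_number u (last (0 # p)))"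
    by (simp only: of_nat_sum of_nat_mult card_walks)
  also have "\<dots> = (step ^^ s) (\<lambda>k. walk_number t k * walk_number u k) 0"
    by (rule sum_walks)
  finally show ?thesis .
qed

lemma qh_number_quiver:
  assumes "vertex_numbering (quiver s t u) \<nu>"
  shows "real (qh_number K (quiver s t u) \<nu>) = (step ^^ s) (\<lambda>k. walk_number t k * walk_number u k) 0"
proof -
  interpret out_forest "quiver s t u" "quiver_depth s" by (rule out_forest_quiver)
  interpret numbered_forest "quiver s t u" "quiver_depth s" K \<nu>
    by unfold_locales (use assms in \<open>simp add: vertex_numbering_def\<close>)
  show ?thesis using card_labellings_quiver qh_number_eq_labellings by simp
qed

section \<open>Catalan number identities\<close>

lemma walk_number_0 [simp]: "walk_number 0 = (\<lambda>_. 1)"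
  by (simp add: walk_number_def)

lemma walk_number_Suc: "walk_number (Suc t) = step (walk_number t)"
  by (simp add: walk_number_def)

lemma funpow_step_walk_number: "(step ^^ s) (walk_number t) = walk_number (s + t)"
  by (simp add: walk_number_def funpow_add)

lemma step_add: "step (\<lambda>k. f k + g k) = (\<lambda>k. step f k + step g k)"
  by (rule ext) (simp only: step_def sum.distrib)

lemma step_mult: "step (\<lambda>k. c * f k) = (\<lambda>k. c * step f k)"
  by (rule ext) (simp only: step_def sum_distrib_left)

lemma funpow_step_add: "(step ^^ s) (\<lambda>k. f k + g k) = (\<lambda>k. (step ^^ s) f k + (step ^^ s) g k)"
  by (induction s) (simp_all add: step_add)

lemma funpow_step_mult: "(step ^^ s) (\<lambda>k. c * f k) = (\<lambda>k. c * (step ^^ s) f k)"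
  by (induction s) (simp_all add: step_mult)

text \<open>These are ballot numbers. The recurrence in \<open>t\<close> follows by induction on \<open>k\<close>, as the sum over
  the labels \<open>j \<le> k + 1\<close> gains one summand when \<open>k\<close> increases.\<close>

lemma walk_number_formula:
  "walk_number t k = (real k + 2) * fact (2 * t + k + 1) / (fact t * fact (t + k + 2))"
proof (induction t arbitrary: k)
  case 0
  have "fact (k + 2) = (real k + 2) * fact (k + 1)" by (simp add: algebra_simps)
  then show ?case by simp
next
  case (Suc t)
  let ?c = "\<lambda>t k. (real k + 2) * fact (2 * t + k + 1) / (fact t * fact (t + k + 2)) :: real"
  have fact_Suc': "fact (Suc m) = (real m + 1) * fact m" for m by (simp add: algebra_simps)
  have "(\<Sum>j\<le>Suc k. ?c t j) = ?c (Suc t) k"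
  proof (induction k)
    case 0
    define x :: real where "x = fact (2 * t + 1)"
    define y :: real where "y = fact t"
    define z :: real where "z = fact (t + 2)"
    have "y > 0" "z > 0" by (simp_all add: y_def z_def)
    have facts: "fact (2 * t + 2) = (2 * real t + 2) * x" "fact (2 * t + 3) = (2 * real t + 3) * (2 * real t + 2) * x"
      "fact (Suc t) = (real t + 1) * y" "fact (t + 3) = (real t + 3) * z"
      by (simp_all add: x_def y_def z_def eval_nat_numeral fact_Suc' algebra_simps)
    have "(\<Sum>j\<le>Suc 0. ?c t j) = 2 * x / (y * z) + 3 * fact (2 * t + 2) / (y * fact (t + 3))"
      by (simp add: x_def y_def z_def eval_nat_numeral)
    also have "\<dots> = 2 * fact (2 * t + 3) / (fact (Suc t) * fact (t + 3))"
      unfolding facts using \<open>y > 0\<close> \<open>z > 0\<close> by (simp add: divide_simps) (simp add: algebra_simps)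
    finally show ?case by (simp add: eval_nat_numeral)
  next
    case (Suc k)
    define x :: real where "x = fact (2 * t + k + 3)"
    define y :: real where "y = fact t"
    define z :: real where "z = fact (t + k + 3)"
    have "y > 0" "z > 0" by (simp_all add: y_def z_def)
    have facts: "fact (2 * t + k + 4) = (2 * real t + real k + 4) * x"
      "fact (Suc t) = (real t + 1) * y" "fact (t + k + 4) = (real t + real k + 4) * z"
      by (simp_all add: x_def y_def z_def eval_nat_numeral fact_Suc' algebra_simps)
    have "(\<Sum>j\<le>Suc (Suc k). ?c t j) = ?c (Suc t) k + ?c t (Suc (Suc k))"
      using Suc.IH by (simp only: sum.atMost_Suc[of _ "Suc k"])
    also have "\<dots> = (real k + 2) * x / (fact (Suc t) * z) + (real k + 4) * x / (y * fact (t + k + 4))"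
      by (simp add: x_def y_def z_def eval_nat_numeral add_ac)
    also have "\<dots> = (real k + 3) * fact (2 * t + k + 4) / (fact (Suc t) * fact (t + k + 4))"
      unfolding facts using \<open>y > 0\<close> \<open>z > 0\<close>
      by (simp add: divide_simps add_pos_nonneg) (simp add: algebra_simps)
    finally show ?case by (simp add: eval_nat_numeral add_ac)
  qed
  then show ?case by (simp only: walk_number_Suc step_def[of "walk_number t"] Suc.IH)
qed

lemma walk_number_catalan: "walk_number t 0 = catalan (t + 1)"
proof -
  have "fact (2 * (t + 1)) = (2 * real t + 2) * fact (2 * t + 1)"
    by (simp add: eval_nat_numeral algebra_simps)
  moreover have "fact (t + 1) = (real t + 1) * fact t" by (simp add: algebra_simps)
  moreover have "t + 1 + 1 = t + 2" by simp
  ultimately have "catalan (t + 1) = (2 * real t + 2) * fact (2 * t + 1) / (fact (t + 2) * ((real t + 1) * fact t))"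
    unfolding catalan_def by (simp only:)
  also have "\<dots> = 2 * fact (2 * t + 1) / (fact t * fact (t + 2))"
    by (simp add: divide_simps)
  finally show ?thesis by (simp add: walk_number_formula)
qed

lemma walk_number_1: "walk_number t 1 = catalan (t + 2) - catalan (t + 1)"
  using walk_number_catalan[of t] walk_number_catalan[of "Suc t"]
  by (simp add: walk_number_Suc step_def eval_nat_numeral)

text \<open>The commutator of \<open>step\<close> with the multiplication by \<open>k + 2\<close>, which is the number of walks of
  length \<open>1\<close> from \<open>k\<close>. It allows to move the branch of length \<open>1\<close> along the stem.\<close>

lemma step_weighted:
  "step (\<lambda>k. (real k + 2) * f k) k =
    (real k + 2) * step f k + 2 * step f k + step f (Suc k) - step (step f) k - f 0"
proof (induction k)
  case (Suc k)
  have rec: "step g (Suc k) = step g k + g (Suc (Suc k))" for g k by (simp add: step_def)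
  show ?case using Suc.IH by (simp add: rec algebra_simps)
qed (simp add: step_def algebra_simps)

text \<open>A walk of length \<open>t + 1\<close> from \<open>k + 1\<close> either starts with \<open>0\<close> or, after subtracting \<open>1\<close> from
  its first label, continues the first \<open>s\<close> steps by a further one. So \<open>t\<close> can be traded for \<open>s\<close>, and
  each trade leaves a product of two Catalan numbers behind.\<close>

lemma funpow_step_shift:
  "(step ^^ s) (\<lambda>k. walk_number t (Suc k)) 0 =
    (\<Sum>k<t. catalan (t - k) * catalan (s + k + 1)) + catalan (s + t + 1)"
proof (induction t arbitrary: s)
  case 0
  show ?case using funpow_step_walk_number[of s 0] by (simp add: walk_number_catalan)
next
  case (Suc t)
  have "walk_number (Suc t) (Suc k) = catalan (t + 1) * 1 + step (\<lambda>k. walk_number t (Suc k)) k" for k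
    unfolding walk_number_Suc step_def sum.atMost_Suc_shift[of _ "Suc k"] walk_number_catalan by simp
  then have "(step ^^ s) (\<lambda>k. walk_number (Suc t) (Suc k)) 0 =
      catalan (t + 1) * (step ^^ s) (walk_number 0) 0 + (step ^^ Suc s) (\<lambda>k. walk_number t (Suc k)) 0"
    by (simp only: funpow_step_add funpow_step_mult funpow_Suc_right o_apply walk_number_0)
  also have "\<dots> = catalan (t + 1) * catalan (s + 1) +
      ((\<Sum>k<t. catalan (t - k) * catalan (Suc s + k + 1)) + catalan (Suc s + t + 1))"
    unfolding Suc.IH funpow_step_walk_number by (simp add: walk_number_catalan)
  also have "\<dots> = (\<Sum>k<Suc t. catalan (Suc t - k) * catalan (s + k + 1)) + catalan (s + Suc t + 1)"
    by (simp add: sum.lessThan_Suc_shift del: sum.lessThan_Suc)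
  finally show ?case .
qed

text \<open>Shortening the branch of length \<open>t + 1\<close> while lengthening the stem changes the number of
  labellings by iterates of the terms of the commutator.\<close>

lemma funpow_step_weighted_Suc:
  "(step ^^ s) (\<lambda>k. (real k + 2) * walk_number (Suc t) k) 0 =
    (step ^^ Suc s) (\<lambda>k. (real k + 2) * walk_number t k) 0 + catalan (s + t + 3) - 3 * catalan (s + t + 2)
      - (\<Sum>k<t. catalan (t - k) * catalan (s + k + 2))"
proof -
  let ?N = "walk_number"
  have "(\<lambda>k. (real k + 2) * ?N (Suc t) k) = (\<lambda>k. step (\<lambda>k. (real k + 2) * ?N t k) k +
      ((- 2) * ?N (Suc t) k + ((- 1) * ?N (Suc t) (Suc k) + (?N (Suc (Suc t)) k + ?N t 0 * ?N 0 k))))"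
    using step_weighted[of "?N t"] by (simp add: walk_number_Suc fun_eq_iff)
  then have "(step ^^ s) (\<lambda>k. (real k + 2) * ?N (Suc t) k) 0 =
      (step ^^ Suc s) (\<lambda>k. (real k + 2) * ?N t k) 0 + ((- 2) * (step ^^ s) (?N (Suc t)) 0 +
        ((- 1) * (step ^^ s) (\<lambda>k. ?N (Suc t) (Suc k)) 0 + ((step ^^ s) (?N (Suc (Suc t))) 0 +
          ?N t 0 * (step ^^ s) (?N 0) 0)))"
    by (simp only: funpow_step_add funpow_step_mult funpow_Suc_right o_apply)
  also have "\<dots> = (step ^^ Suc s) (\<lambda>k. (real k + 2) * ?N t k) 0 - 2 * catalan (s + t + 2)
      - (step ^^ s) (\<lambda>k. ?N (Suc t) (Suc k)) 0 + catalan (s + t + 3) + catalan (t + 1) * catalan (s + 1)"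
    unfolding funpow_step_walk_number walk_number_catalan by (simp add: eval_nat_numeral)
  also have "(step ^^ s) (\<lambda>k. ?N (Suc t) (Suc k)) 0 = catalan (t + 1) * catalan (s + 1) +
      (\<Sum>k<t. catalan (t - k) * catalan (s + k + 2)) + catalan (s + t + 2)"
    unfolding funpow_step_shift by (simp add: sum.lessThan_Suc_shift del: sum.lessThan_Suc)
  finally show ?thesis by simp
qed

text \<open>For \<open>t = 0\<close> both sides count the walks of length \<open>s + 1\<close>. The right-hand side changes from
  \<open>(s + 1, t)\<close> to \<open>(s, t + 1)\<close> in the same way as the left-hand side: in the sum over \<open>k\<close> an index
  shift turns the weights \<open>k + 1\<close> into \<open>k\<close>.\<close>

lemma funpow_step_weighted:
  "(step ^^ s) (\<lambda>k. (real k + 2) * walk_number t k) 0 =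
    (real t + 1) * catalan (s + t + 2) - 3 * real t * catalan (s + t + 1)
      - (\<Sum>k | k + 2 \<le> t. (real k + 1) * catalan (t - k - 1) * catalan (s + k + 2))"
proof (induction t arbitrary: s)
  case 0
  have "(\<lambda>k. real k + 2) = walk_number 1" by (simp add: walk_number_Suc step_def fun_eq_iff)
  then show ?case using funpow_step_walk_number[of s 1] by (simp add: walk_number_catalan)
next
  case (Suc t)
  have range: "{k. k + 2 \<le> m} = {..<m - 1}" for m :: nat by auto
  have shift: "(\<Sum>k<t - 1. (real k + 1) * catalan (t - k - 1) * catalan (Suc s + k + 2)) =
      (\<Sum>k<t. real k * catalan (t - k) * catalan (s + k + 2))"
    by (cases t) (simp_all add: sum.lessThan_Suc_shift add_ac del: sum.lessThan_Suc)
  have "(\<Sum>k<t. (real k + 1) * catalan (t - k) * catalan (s + k + 2)) =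
      (\<Sum>k<t. real k * catalan (t - k) * catalan (s + k + 2)) + (\<Sum>k<t. catalan (t - k) * catalan (s + k + 2))"
    by (simp add: sum.distrib[symmetric] algebra_simps)
  then show ?case
    unfolding funpow_step_weighted_Suc Suc.IH range shift by (simp add: algebra_simps eval_nat_numeral)
qed

theorem theorem1p1:
  fixes K :: "'k::field itself"
    and \<nu> :: "nat \<Rightarrow> nat \<Rightarrow> nat \<Rightarrow> nat \<Rightarrow> vertex"
    and q :: "nat \<Rightarrow> nat \<Rightarrow> nat \<Rightarrow> nat"
  assumes numbering: "\<And>s t u. vertex_numbering (quiver s t u) (\<nu> s t u)"
    and q_def: "\<And>s t u. q s t u = qh_number K (quiver s t u) (\<nu> s t u)"
  shows "(\<forall>t u. real (q 1 t u) =
            (catalan (t + 2) - catalan (t + 1)) * (catalan (u + 2) - catalan (u + 1))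
              + catalan (t + 1) * catalan (u + 1)) \<and>
         (\<forall>s t. q s t 1 = q s 1 t \<and>
            real (q s 1 t) =
              (real t + 1) * catalan (s + t + 2) - 3 * real t * catalan (s + t + 1)
                - (\<Sum>k | k + 2 \<le> t. (real k + 1) * catalan (t - k - 1) * catalan (s + k + 2)))"
proof -
  have q: "real (q s t u) = (step ^^ s) (\<lambda>k. walk_number t k * walk_number u k) 0" for s t u
    unfolding q_def by (rule qh_number_quiver[OF numbering])
  have "real (q 1 t u) = walk_number t 1 * walk_number u 1 + walk_number t 0 * walk_number u 0" for t u
    by (simp add: q step_def)
  moreover have "q s t 1 = q s 1 t" for s t
    using q[of s t 1] q[of s 1 t] by (simp add: mult.commute)
  moreover have "real (q s 1 t) = (step ^^ s) (\<lambda>k. (real k + 2) * walk_number t k) 0" for s t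
    unfolding q by (simp add: walk_number_Suc step_def add.commute)
  ultimately show ?thesis
    by (simp add: funpow_step_weighted walk_number_1[simplified] walk_number_catalan)
qed

end
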